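(* Let $E$ be a Banach lattice with the $\sigma$-interpolation property and assume that $E^*$ has order continuous norm. Suppose $u_0\in E^+$ and $\mathcal G$ is a collection of positive linear operators on $E$ such that the adjoint $T^*$ is a lattice homomorphism for each $T\in\mathcal G$, and such that: (a) for every $x\in E^+$ there exists $T\in\mathcal G$ with $x\le\|x\|_E\,Tu_0$; (b) for every disjoint sequence $(x_n)_{n\ge1}$ in $[0,u_0]$ and every sequence $(T_n)_{n\ge1}$ in $\mathcal G$ there exists $v\in E^+$ with $T_nx_n\le v$ for all $n$. Then $E$ is a Grothendieck space.
   Context: A Banach space $X$ is a Grothendieck space if every weak-$*$ convergent sequence in $X^*$ is weakly convergent (i.e. $\sigma(X^*,X)$-convergent sequences are $\sigma(X^*,X^{**})$-convergent). A Banach lattice $E$ has the $\sigma$-interpolation property if for any sequences $(x_n),(y_n)$ in $E$ with $x_n\le x_{n+1}\le y_{n+1}\le y_n$ for all $n$ there exists $z\in E$ with $x_n\le z\le y_n$ for all $n$. *)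

theory Defs
  imports "HOL-Analysis.Analysis"
begin

text \<open>Banach lattices: the ambient type carries a lattice order compatible with the
  additive group structure (class ordered_ab_group_add + lattice) and a complete norm
  (class banach); we additionally require compatibility with scalar multiplication
  and monotonicity of the norm with respect to the modulus.\<close>

definition labs :: "'a::{lattice, ab_group_add} \<Rightarrow> 'a" where
  "labs x = sup x (- x)"

definition banach_lattice :: "'a::{banach, lattice, ordered_ab_group_add} itself \<Rightarrow> bool" where
  "banach_lattice _ \<longleftrightarrow>
     (\<forall>(x::'a) c. 0 \<le> x \<longrightarrow> 0 \<le> c \<longrightarrow> 0 \<le> c *\<^sub>R x) \<and>
     (\<forall>x y::'a. labs x \<le> labs y \<longrightarrow> norm x \<le> norm y)"

definition sigma_interpolation :: "'a::order itself \<Rightarrow> bool" where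
  "sigma_interpolation _ \<longleftrightarrow>
     (\<forall>(x::nat \<Rightarrow> 'a) y. (\<forall>n. x n \<le> x (Suc n) \<and> x (Suc n) \<le> y (Suc n) \<and> y (Suc n) \<le> y n)
        \<longrightarrow> (\<exists>z. \<forall>n. x n \<le> z \<and> z \<le> y n))"

definition dual_le :: "('a::{real_normed_vector, order} \<Rightarrow>\<^sub>L real) \<Rightarrow> ('a \<Rightarrow>\<^sub>L real) \<Rightarrow> bool" where
  "dual_le f g \<longleftrightarrow> (\<forall>x. 0 \<le> x \<longrightarrow> blinfun_apply f x \<le> blinfun_apply g x)"

definition is_sup2 :: "('b \<Rightarrow> 'b \<Rightarrow> bool) \<Rightarrow> 'b \<Rightarrow> 'b \<Rightarrow> 'b \<Rightarrow> bool" where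
  "is_sup2 le x y z \<longleftrightarrow> le x z \<and> le y z \<and> (\<forall>w. le x w \<and> le y w \<longrightarrow> le z w)"

definition rsup :: "('b \<Rightarrow> 'b \<Rightarrow> bool) \<Rightarrow> 'b \<Rightarrow> 'b \<Rightarrow> 'b" where
  "rsup le x y = (THE z. is_sup2 le x y z)"

definition is_glb :: "('b \<Rightarrow> 'b \<Rightarrow> bool) \<Rightarrow> 'b set \<Rightarrow> 'b \<Rightarrow> bool" where
  "is_glb le D z \<longleftrightarrow> (\<forall>d\<in>D. le z d) \<and> (\<forall>w. (\<forall>d\<in>D. le w d) \<longrightarrow> le w z)"

definition downward_directed :: "('b \<Rightarrow> 'b \<Rightarrow> bool) \<Rightarrow> 'b set \<Rightarrow> bool" where
  "downward_directed le D \<longleftrightarrow> D \<noteq> {} \<and> (\<forall>a\<in>D. \<forall>b\<in>D. \<exists>c\<in>D. le c a \<and> le c b)"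

text \<open>Order continuous norm: every downward directed set (net) decreasing to 0 has norms
  decreasing to 0 (for decreasing nets in a normed lattice the norm net is decreasing, so
  convergence to 0 means infimum 0).\<close>
definition order_continuous_norm :: "('b::real_normed_vector \<Rightarrow> 'b \<Rightarrow> bool) \<Rightarrow> bool" where
  "order_continuous_norm le \<longleftrightarrow>
     (\<forall>D. downward_directed le D \<and> is_glb le D 0 \<longrightarrow> (INF d\<in>D. norm d) = 0)"

definition adjoint_op :: "('a::real_normed_vector \<Rightarrow>\<^sub>L 'a) \<Rightarrow> ('a \<Rightarrow>\<^sub>L real) \<Rightarrow> ('a \<Rightarrow>\<^sub>L real)" where
  "adjoint_op T f = f o\<^sub>L T"

definition lattice_hom :: "('b \<Rightarrow> 'b \<Rightarrow> bool) \<Rightarrow> ('b \<Rightarrow> 'b) \<Rightarrow> bool" where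
  "lattice_hom le h \<longleftrightarrow> (\<forall>x y. h (rsup le x y) = rsup le (h x) (h y))"

definition positive_op :: "('a::{real_normed_vector, order} \<Rightarrow>\<^sub>L 'a) \<Rightarrow> bool" where
  "positive_op T \<longleftrightarrow> (\<forall>x. 0 \<le> x \<longrightarrow> 0 \<le> blinfun_apply T x)"

definition grothendieck :: "'a::real_normed_vector itself \<Rightarrow> bool" where
  "grothendieck _ \<longleftrightarrow>
     (\<forall>(fs :: nat \<Rightarrow> ('a \<Rightarrow>\<^sub>L real)) f.
        (\<forall>x. (\<lambda>n. blinfun_apply (fs n) x) \<longlonglongrightarrow> blinfun_apply f x) \<longrightarrow>
        (\<forall>\<phi> :: ('a \<Rightarrow>\<^sub>L real) \<Rightarrow>\<^sub>L real. (\<lambda>n. blinfun_apply \<phi> (fs n)) \<longlonglongrightarrow> blinfun_apply \<phi> f))"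

end

theory Submission
  imports Defs "HOL-Library.Lattice_Algebras"
begin

text \<open>Let \<open>f\<^sub>n \<rightarrow> 0\<close> weak* and \<open>e = \<Sum> 2\<^sup>-\<^sup>n |f\<^sub>n|\<close>. If for every positive \<open>\<phi>\<close> in the bidual the quantities
  \<open>\<phi> ((|f\<^sub>n| - K e)\<^sup>+)\<close> tend to 0 uniformly in \<open>n\<close> as \<open>K \<rightarrow> \<infinity>\<close>, then order continuity of the dual norm
  allows \<open>\<phi>\<close> to be approximated by elements of \<open>E\<close> and \<open>f\<^sub>n \<rightarrow> 0\<close> weakly.

  Otherwise there are pairwise disjoint \<open>0 \<le> u\<^sub>j \<le> |f\<^sub>n\<^sub>j|\<close> with \<open>\<phi> u\<^sub>j \<ge> \<epsilon>\<close>. By Goldstine's theorem and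
  condition (a), for every \<open>N\<close> some \<open>T\<^sub>N\<close> satisfies \<open>u\<^sub>j (T\<^sub>N u\<^sub>0) \<ge> \<delta>\<close> for all \<open>j < N\<close>; the functionals
  \<open>T\<^sub>N\<^sup>* u\<^sub>j\<close>, \<open>j < N\<close>, are disjoint, so a diagonal selection yields disjoint \<open>y\<^sub>k\<close> in \<open>[0, u\<^sub>0]\<close> on which they
  stay large. Condition (b) gives one \<open>v\<close> on which infinitely many \<open>u\<^sub>j\<close> are large, and a second selection
  below \<open>v\<close> gives disjoint \<open>z\<^sub>k \<le> v\<close> with \<open>|f\<^sub>n\<^sub>k| z\<^sub>k\<close> bounded away from 0. By interpolation and Rosenthal's
  disjointification argument this is impossible for a weak* null sequence.\<close>

section \<open>Bounded linear functionals\<close>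

lemma additive_scaleR_of_int:
  fixes f :: "'v::real_vector \<Rightarrow> 'w::real_vector"
  assumes "Modules.additive f"
  shows "f (real_of_int k *\<^sub>R v) = real_of_int k *\<^sub>R f v"
proof -
  interpret Modules.additive f by fact
  have "f (real n *\<^sub>R v) = real n *\<^sub>R f v" for n
    by (induction n) (simp_all add: zero add scaleR_left_distrib)
  then show ?thesis by (cases k) (simp_all add: minus flip: of_nat_Suc)
qed

lemma additive_bounded_imp_bounded_linear:
  fixes f :: "'v::real_normed_vector \<Rightarrow> 'w::real_normed_vector"
  assumes "Modules.additive f" and bound: "\<And>v. norm (f v) \<le> C * norm v"
  shows "bounded_linear f"
proof (rule bounded_linear_intro)
  interpret Modules.additive f by fact
  show "f (v + w) = f v + f w" for v w by (rule add)
  show "norm (f v) \<le> norm v * C" for v using bound[of v] by (simp add: mult.commute)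
  show "f (c *\<^sub>R v) = c *\<^sub>R f v" for c v
  proof -
    have "norm (f (c *\<^sub>R v) - c *\<^sub>R f v) \<le> (\<bar>C\<bar> * norm v + norm (f v)) / real (Suc n)" for n
    proof -
      define k where "k = \<lfloor>real (Suc n) * c\<rfloor>"
      define t where "t = real (Suc n) * c - real_of_int k"
      have t: "0 \<le> t" "t \<le> 1" by (simp_all add: t_def k_def) linarith
      have "f (t *\<^sub>R v) = f (real_of_int (int (Suc n)) *\<^sub>R c *\<^sub>R v - real_of_int k *\<^sub>R v)"
        by (simp add: t_def scaleR_left_diff_distrib)
      then have "f (t *\<^sub>R v) = real (Suc n) *\<^sub>R f (c *\<^sub>R v) - real_of_int k *\<^sub>R f v"
        unfolding diff additive_scaleR_of_int[OF assms(1)] by simp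
      then have defect: "real (Suc n) *\<^sub>R (f (c *\<^sub>R v) - c *\<^sub>R f v) = f (t *\<^sub>R v) - t *\<^sub>R f v"
        by (simp add: t_def algebra_simps)
      have "norm (f (t *\<^sub>R v)) \<le> \<bar>C\<bar> * (t * norm v)"
        using bound[of "t *\<^sub>R v"] mult_right_mono[OF abs_ge_self, of "t * norm v" C] t by simp
      also have "\<dots> \<le> \<bar>C\<bar> * norm v" using t by (intro mult_left_mono mult_left_le_one_le) auto
      finally have "norm (f (t *\<^sub>R v)) \<le> \<bar>C\<bar> * norm v" .
      moreover have "norm (t *\<^sub>R f v) \<le> norm (f v)" using t by (simp add: mult_left_le_one_le)
      ultimately have "norm (real (Suc n) *\<^sub>R (f (c *\<^sub>R v) - c *\<^sub>R f v)) \<le> \<bar>C\<bar> * norm v + norm (f v)"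
        unfolding defect using norm_triangle_ineq4[of "f (t *\<^sub>R v)" "t *\<^sub>R f v"] by linarith
      then show ?thesis
        unfolding norm_scaleR by (simp only: abs_of_nat le_divide_eq mult.commute) simp
    qed
    then have "norm (f (c *\<^sub>R v) - c *\<^sub>R f v) \<le> 0"
      using LIMSEQ_le_const[OF LIMSEQ_Suc[OF lim_const_over_n]] by blast
    then show ?thesis by simp
  qed
qed

lemma blinfun_norming_vector:
  fixes f :: "'v::real_normed_vector \<Rightarrow>\<^sub>L real"
  assumes "c < norm f"
  obtains x where "norm x \<le> 1" "c < f x"
proof -
  consider "c < 0" | "0 \<le> c" by linarith
  then show thesis
  proof cases
    case 1
    then show thesis using that[of 0] by (simp add: blinfun.zero_right)
  next
    case 2
    then obtain v where v: "c * norm v < \<bar>f v\<bar>"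
      using norm_blinfun_bound[of c f] assms by (metis not_le real_norm_def)
    then have v0: "v \<noteq> 0" by (auto simp: blinfun.zero_right)
    show thesis
    proof (rule that[of "(sgn (f v) / norm v) *\<^sub>R v"])
      show "norm ((sgn (f v) / norm v) *\<^sub>R v) \<le> 1"
        by (simp add: abs_sgn_eq)
      have "c < \<bar>f v\<bar> / norm v" using v v0 by (simp add: less_divide_eq)
      then show "c < f ((sgn (f v) / norm v) *\<^sub>R v)"
        by (simp add: blinfun.scaleR_right abs_sgn mult.commute)
    qed
  qed
qed

lemma norm_blinfun_le_of_cball:
  fixes f :: "'v::real_normed_vector \<Rightarrow>\<^sub>L 'w::real_normed_vector"
  assumes "0 < r" and bound: "\<And>y. y \<in> cball x r \<Longrightarrow> norm (f y) \<le> C"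
  shows "norm f \<le> 2 * C / r"
proof (rule norm_blinfun_bound)
  show "0 \<le> 2 * C / r"
    using order_trans[OF norm_ge_zero bound[of x]] \<open>0 < r\<close> by simp
  fix y
  show "norm (f y) \<le> 2 * C / r * norm y"
  proof (cases "y = 0")
    case False
    define z where "z = (r / norm y) *\<^sub>R y"
    have "norm z = r" using False \<open>0 < r\<close> by (simp add: z_def)
    then have "norm (f (x + z)) \<le> C" "norm (f x) \<le> C"
      using \<open>0 < r\<close> by (auto intro!: bound simp: dist_norm)
    then have "norm (f z) \<le> 2 * C"
      using norm_triangle_ineq4[of "f (x + z)" "f x"] by (simp add: blinfun.add_right)
    then show ?thesis
      using False \<open>0 < r\<close> by (simp add: z_def blinfun.scaleR_right field_simps)
  qed (simp add: blinfun.zero_right)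
qed

lemma uniform_boundedness:
  fixes F :: "('v::banach \<Rightarrow>\<^sub>L 'w::real_normed_vector) set"
  assumes pointwise: "\<And>x. bounded ((\<lambda>f. blinfun_apply f x) ` F)"
  shows "bounded F"
proof -
  define A where "A m = {x. \<forall>f\<in>F. norm (blinfun_apply f x) \<le> real m}" for m
  have "closed (A m)" for m
  proof -
    have "A m = (\<Inter>f\<in>F. {x. norm (blinfun_apply f x) \<le> real m})" by (auto simp: A_def)
    moreover have "closed {x. norm (blinfun_apply f x) \<le> real m}" for f :: "'v \<Rightarrow>\<^sub>L 'w"
      by (intro closed_Collect_le continuous_intros)
    ultimately show ?thesis by auto
  qed
  moreover have "\<exists>m. x \<in> A m" for x
  proof -
    obtain K where K: "\<And>f. f \<in> F \<Longrightarrow> norm (blinfun_apply f x) \<le> K"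
      using pointwise[of x] by (auto simp: bounded_iff)
    obtain m :: nat where "K \<le> real m" using real_arch_simple by blast
    then show ?thesis using K by (auto simp: A_def intro: order_trans)
  qed
  then have "(\<Union>m. A m) = UNIV" by auto
  ultimately have "\<exists>m. interior (A m) \<noteq> {}"
    using Baire_category_alt[of "euclidean :: 'v topology" "range A"]
      completely_metrizable_space_euclidean
    by force
  then obtain m x where "x \<in> interior (A m)" by auto
  then obtain r where "0 < r" "cball x r \<subseteq> A m"
    by (meson interior_subset mem_interior_cball subset_trans)
  then have "norm f \<le> 2 * real m / r" if "f \<in> F" for f
    using that by (intro norm_blinfun_le_of_cball) (auto simp: A_def)
  then show ?thesis by (auto simp: bounded_iff)
qed

lemma weak_star_convergent_imp_bounded:
  fixes fs :: "nat \<Rightarrow> ('v::banach \<Rightarrow>\<^sub>L 'w::real_normed_vector)"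
  assumes "\<And>x. (\<lambda>n. fs n x) \<longlonglongrightarrow> f x"
  obtains B where "\<And>n. norm (fs n) \<le> B"
proof -
  have "bounded (range fs)"
  proof (rule uniform_boundedness)
    show "bounded ((\<lambda>f. blinfun_apply f x) ` range fs)" for x
      using convergent_imp_bounded[OF assms[of x]] by (simp add: image_image)
  qed
  then show thesis using that by (auto simp: bounded_iff)
qed

lemma summable_geometric_scaleR:
  fixes a :: "nat \<Rightarrow> 'v::banach"
  assumes "\<And>n. norm (a n) \<le> B"
  shows "summable (\<lambda>n. (1 / 2) ^ n *\<^sub>R a n)"
proof (rule summable_comparison_test)
  show "\<exists>N. \<forall>n\<ge>N. norm ((1 / 2) ^ n *\<^sub>R a n) \<le> (1 / 2) ^ n * B"
    by (rule exI[of _ 0]) (simp add: assms divide_right_mono power_one_over)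
  show "summable (\<lambda>n. (1 / 2 :: real) ^ n * B)"
    by (intro summable_mult2 summable_geometric) simp
qed

definition evaluation :: "'v::real_normed_vector \<Rightarrow> ('v \<Rightarrow>\<^sub>L real) \<Rightarrow>\<^sub>L real" where
  "evaluation x = Blinfun (\<lambda>f. blinfun_apply f x)"

lemma evaluation_apply [simp]: "blinfun_apply (evaluation x) f = blinfun_apply f x"
  by (simp add: evaluation_def bounded_linear_Blinfun_apply blinfun.bounded_linear_left)

lemma separating_functional_from_quadrant:
  fixes S :: "(real \<times> real) set"
  assumes "convex S" "S \<noteq> {}" and "S \<inter> {d..} \<times> {d..} = {}"
  obtains a b where "0 \<le> a" "0 \<le> b" "0 < a + b" "\<And>p q. (p, q) \<in> S \<Longrightarrow> a * p + b * q \<le> (a + b) * d"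
proof -
  have "\<exists>h s. h \<noteq> 0 \<and> (\<forall>p\<in>S. h \<bullet> p \<le> s) \<and> (\<forall>p\<in>{d..} \<times> {d..}. s \<le> h \<bullet> p)"
    using assms by (intro separating_hyperplane_sets) (auto simp: convex_Times)
  then obtain a b s where ab: "(a, b) \<noteq> (0 :: real \<times> real)"
    and below: "\<forall>p\<in>S. (a, b) \<bullet> p \<le> s" and above: "\<forall>p\<in>{d..} \<times> {d..}. s \<le> (a, b) \<bullet> p"
    by auto
  have above': "s \<le> a * p + b * q" if "d \<le> p" "d \<le> q" for p q
    using above that by simp
  have nonneg: "0 \<le> k" if "\<And>r. 0 \<le> r \<Longrightarrow> s - a * d - b * d \<le> k * r" for k
  proof (rule ccontr)
    assume "\<not> 0 \<le> k"
    then have "k < 0" by simp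
    then have "\<not> s - a * d - b * d \<le> k * ((\<bar>s - a * d - b * d\<bar> + 1) / - k)"
      "0 \<le> (\<bar>s - a * d - b * d\<bar> + 1) / - k"
      by (auto simp: divide_nonneg_neg)
    then show False using that by blast
  qed
  have "0 \<le> a" by (rule nonneg) (use above'[of "d + r" d for r] in \<open>simp add: algebra_simps\<close>)
  moreover have "0 \<le> b" by (rule nonneg) (use above'[of d "d + r" for r] in \<open>simp add: algebra_simps\<close>)
  moreover from calculation have "0 < a + b" using ab by (auto simp: zero_prod_def)
  moreover have "a * p + b * q \<le> (a + b) * d" if "(p, q) \<in> S" for p q
    using below that above'[of d d] by (force simp: algebra_simps)
  ultimately show thesis by (rule that)
qed

lemma convex_simultaneous_bound_pair:
  fixes v w :: "'a::real_vector \<Rightarrow> real"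
  assumes K: "convex K" "K \<noteq> {}" and lin: "linear v" "linear w"
    and avg: "\<And>t. 0 \<le> t \<Longrightarrow> t \<le> 1 \<Longrightarrow> \<exists>x\<in>K. c \<le> (1 - t) * v x + t * w x" and "d < c"
  shows "\<exists>x\<in>K. d \<le> v x \<and> d \<le> w x"
proof (rule ccontr)
  assume none: "\<not> ?thesis"
  have "linear (\<lambda>x. (v x, w x))"
    using lin by (auto simp: linear_iff)
  then have "convex ((\<lambda>x. (v x, w x)) ` K)" using K(1) by (rule convex_linear_image)
  moreover have "(\<lambda>x. (v x, w x)) ` K \<noteq> {}" using K(2) by simp
  moreover have "(\<lambda>x. (v x, w x)) ` K \<inter> {d..} \<times> {d..} = {}" using none by auto
  ultimately obtain a b where ab: "0 \<le> a" "0 \<le> b" "0 < a + b"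
    and below: "\<And>p q. (p, q) \<in> (\<lambda>x. (v x, w x)) ` K \<Longrightarrow> a * p + b * q \<le> (a + b) * d"
    by (rule separating_functional_from_quadrant) (rule that; assumption)
  define t where "t = b / (a + b)"
  have t: "0 \<le> t" "t \<le> 1" "1 - t = a / (a + b)"
    using ab by (auto simp: t_def field_simps)
  obtain x where x: "x \<in> K" "c \<le> (1 - t) * v x + t * w x" using avg t by blast
  have "(1 - t) * v x + t * w x = (a * v x + b * w x) / (a + b)"
    unfolding t(3) by (simp add: t_def add_divide_distrib)
  then have "(a + b) * c \<le> a * v x + b * w x"
    using x(2) ab(3) by (simp add: pos_le_divide_eq mult.commute)
  also have "\<dots> \<le> (a + b) * d" using below x(1) by blast
  finally show False using ab(3) \<open>d < c\<close> by simp
qed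

text \<open>Induction on the number of functionals reduces the separation argument to the plane.\<close>

lemma convex_simultaneous_bound:
  fixes u :: "'i \<Rightarrow> 'a::real_vector \<Rightarrow> real"
  assumes "finite I" "convex K" "K \<noteq> {}" "\<And>i. i \<in> I \<Longrightarrow> linear (u i)"
    and "\<And>l. (\<And>i. i \<in> I \<Longrightarrow> 0 \<le> l i) \<Longrightarrow> sum l I = 1 \<Longrightarrow> \<exists>x\<in>K. c \<le> (\<Sum>i\<in>I. l i * u i x)"
    and "d < c"
  shows "\<exists>x\<in>K. \<forall>i\<in>I. d \<le> u i x"
  using assms
proof (induction I arbitrary: K c rule: finite_induct)
  case (insert k I)
  obtain e where e: "d < e" "e < c" using dense insert.prems(5) by blast
  define K' where "K' = {x \<in> K. e \<le> u k x}"
  have lin: "linear (u k)" "linear (\<lambda>x. \<Sum>i\<in>I. l i * u i x)" for l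
    using insert.prems(3) by (auto simp: linear_iff algebra_simps sum.distrib sum_distrib_left)
  have mix: "\<exists>x\<in>K. c \<le> (1 - t) * (\<Sum>i\<in>I. l i * u i x) + t * u k x"
    if l: "\<And>i. i \<in> I \<Longrightarrow> 0 \<le> l i" "(1 - t) * sum l I = 1 - t" and t: "0 \<le> t" "t \<le> 1" for l t
  proof -
    let ?l = "(\<lambda>i. (1 - t) * l i)(k := t)"
    have sum_l: "(\<Sum>i\<in>insert k I. ?l i * h i) = (1 - t) * (\<Sum>i\<in>I. l i * h i) + t * h k" for h
    proof -
      have "(\<Sum>i\<in>I. ?l i * h i) = (\<Sum>i\<in>I. (1 - t) * (l i * h i))"
        using insert.hyps by (intro sum.cong) auto
      then show ?thesis using insert.hyps by (simp add: sum_distrib_left)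
    qed
    have "\<exists>x\<in>K. c \<le> (\<Sum>i\<in>insert k I. ?l i * u i x)"
    proof (rule insert.prems(4))
      show "0 \<le> ?l i" if "i \<in> insert k I" for i using that l(1) t by auto
      show "sum ?l (insert k I) = 1" using sum_l[of "\<lambda>_. 1"] l(2) by simp
    qed
    then show ?thesis unfolding sum_l .
  qed
  have "\<exists>x\<in>K'. \<forall>i\<in>I. d \<le> u i x"
  proof (rule insert.IH[OF _ _ _ _ e(1)])
    have "K' = K \<inter> u k -` {e..}" by (auto simp: K'_def)
    then show "convex K'"
      using insert.prems(1) convex_linear_vimage[OF lin(1), of "{e..}"] by (simp add: convex_Int)
    show "K' \<noteq> {}" using mix[of "\<lambda>_. 0" 1] e(2) by (auto simp: K'_def intro: less_imp_le order_trans)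
    fix l :: "'i \<Rightarrow> real" assume l: "\<And>i. i \<in> I \<Longrightarrow> 0 \<le> l i" "sum l I = 1"
    have "\<exists>x\<in>K. e \<le> (\<Sum>i\<in>I. l i * u i x) \<and> e \<le> u k x"
      using mix[OF l(1)] l(2) by (intro convex_simultaneous_bound_pair[OF insert.prems(1,2) lin(2,1) _ e(2)]) simp
    then show "\<exists>x\<in>K'. e \<le> (\<Sum>i\<in>I. l i * u i x)" by (auto simp: K'_def)
  qed (use insert.prems(3) in auto)
  then show ?case using e(1) by (force simp: K'_def)
qed auto

lemma finite_goldstine:
  fixes us :: "'i \<Rightarrow> 'v::real_normed_vector \<Rightarrow>\<^sub>L real"
    and \<phi> :: "('v \<Rightarrow>\<^sub>L real) \<Rightarrow>\<^sub>L real"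
  assumes "finite I" "0 < \<epsilon>" and us: "\<And>i. i \<in> I \<Longrightarrow> \<epsilon> \<le> \<phi> (us i)" and "norm \<phi> * c < \<epsilon>"
  shows "\<exists>x. norm x \<le> 1 \<and> (\<forall>i\<in>I. c \<le> us i x)"
proof (cases "\<phi> = 0")
  case True
  then show ?thesis using us \<open>0 < \<epsilon>\<close> by (force intro: exI[of _ 0])
next
  case False
  obtain c' where c': "c < c'" "c' < \<epsilon> / norm \<phi>"
    using assms(4) False dense[of c "\<epsilon> / norm \<phi>"] by (auto simp: field_simps)
  have "\<exists>x\<in>cball 0 1. \<forall>i\<in>I. c \<le> us i x"
  proof (rule convex_simultaneous_bound[OF \<open>finite I\<close> convex_cball _ _ _ c'(1)])
    show "linear (us i)" for i by (rule bounded_linear.linear) (rule blinfun.bounded_linear_right)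
    fix l :: "'i \<Rightarrow> real" assume l: "\<And>i. i \<in> I \<Longrightarrow> 0 \<le> l i" "sum l I = 1"
    define w where "w = (\<Sum>i\<in>I. l i *\<^sub>R us i)"
    have "\<epsilon> = (\<Sum>i\<in>I. l i * \<epsilon>)" using l(2) by (simp flip: sum_distrib_right)
    also have "\<dots> \<le> (\<Sum>i\<in>I. l i * \<phi> (us i))" using us l(1) by (intro sum_mono mult_left_mono) auto
    also have "\<dots> = \<phi> w" by (simp add: w_def blinfun.sum_right blinfun.scaleR_right)
    also have "\<dots> \<le> norm \<phi> * norm w" using norm_blinfun[of \<phi> w] by simp
    finally have "\<epsilon> / norm \<phi> \<le> norm w" using False by (simp add: field_simps)
    then have "c' < norm w" using c'(2) by simp
    then obtain x where "norm x \<le> 1" "c' < w x" by (rule blinfun_norming_vector)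
    then show "\<exists>x\<in>cball 0 1. c' \<le> (\<Sum>i\<in>I. l i * us i x)"
      by (intro bexI[of _ x]) (simp_all add: w_def blinfun.sum_left blinfun.scaleR_left)
  qed auto
  then show ?thesis by auto
qed

section \<open>Rosenthal's lemma\<close>

lemma rosenthal_disjointification:
  fixes \<rho> :: "nat \<Rightarrow> nat set \<Rightarrow> real"
  assumes nonneg: "\<And>k A. 0 \<le> \<rho> k A" and bound: "\<And>k. \<rho> k UNIV \<le> M"
    and super: "\<And>k A B. A \<inter> B = {} \<Longrightarrow> \<rho> k A + \<rho> k B \<le> \<rho> k (A \<union> B)" and "0 < \<epsilon>"
  shows "\<exists>A. infinite A \<and> (\<forall>k\<in>A. \<rho> k (A - {k}) \<le> \<epsilon>)"
proof (rule ccontr)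
  assume neg: "\<not> ?thesis"
  have bad: "\<exists>k\<in>A. \<epsilon> < \<rho> k (A - {k})" if "infinite A" for A
    using neg that by (meson not_le)
  have mono: "\<rho> k A \<le> \<rho> k B" if "A \<subseteq> B" for k A B
    using super[of A "B - A" k] nonneg[of k "B - A"] that by (simp add: Un_absorb1)
  have loss: "\<exists>B. infinite B \<and> (\<forall>k\<in>B. \<rho> k B \<le> M - real p * \<epsilon>)" for p
  proof (induction p)
    case 0
    then show ?case using bound by (intro exI[of _ UNIV]) auto
  next
    case (Suc p)
    then obtain A where A: "infinite A" "\<And>k. k \<in> A \<Longrightarrow> \<rho> k A \<le> M - real p * \<epsilon>" by blast
    obtain C :: "nat \<Rightarrow> nat set" where disjnt: "pairwise (\<lambda>q r. disjnt (C q) (C r)) UNIV"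
      and C: "\<And>q. C q \<subseteq> A" "\<And>q. infinite (C q)"
      using infinite_infinite_partition[OF A(1)] by (metis UN_subset_iff UNIV_I)
    obtain k where k: "\<And>q. k q \<in> C q" "\<And>q. \<epsilon> < \<rho> (k q) (C q - {k q})"
      using bad[OF C(2)] by metis
    have k_C: "k r \<in> C q \<longleftrightarrow> r = q" for q r
      using disjnt k(1)[of r] by (auto simp: pairwise_def disjnt_def)
    then have "inj k" using k(1) by (metis injI)
    then have "infinite (range k)" by (rule range_inj_infinite)
    moreover have "\<rho> (k q) (range k) \<le> M - real (Suc p) * \<epsilon>" for q
    proof -
      have "\<rho> (k q) (C q - {k q}) + \<rho> (k q) (range k) \<le> \<rho> (k q) ((C q - {k q}) \<union> range k)"
        using k_C by (intro super) auto
      also have "\<dots> \<le> \<rho> (k q) A" using C(1) k(1) by (intro mono) blast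
      also have "\<dots> \<le> M - real p * \<epsilon>" using A(2) C(1) k(1) by blast
      finally show ?thesis using k(2)[of q] by (simp add: algebra_simps)
    qed
    ultimately show ?case by blast
  qed
  obtain p :: nat where "M / \<epsilon> < real p" using reals_Archimedean2 by blast
  then have "M - real p * \<epsilon> < 0" using \<open>0 < \<epsilon>\<close> by (simp add: field_simps)
  moreover obtain B where B: "infinite B" "\<And>k. k \<in> B \<Longrightarrow> \<rho> k B \<le> M - real p * \<epsilon>"
    using loss[of p] by blast
  moreover obtain k where "k \<in> B" using B(1) infinite_imp_nonempty by blast
  ultimately show False using nonneg[of k B] by fastforce
qed

section \<open>Normed spaces with the Riesz decomposition property\<close>

locale riesz_normed_space =
  fixes le :: "'v::real_normed_vector \<Rightarrow> 'v \<Rightarrow> bool" (infix "\<sqsubseteq>" 50)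
  assumes le_iff_diff_nonneg: "a \<sqsubseteq> b \<longleftrightarrow> 0 \<sqsubseteq> b - a"
    and add_nonneg: "0 \<sqsubseteq> a \<Longrightarrow> 0 \<sqsubseteq> b \<Longrightarrow> 0 \<sqsubseteq> a + b"
    and scale_nonneg: "0 \<sqsubseteq> a \<Longrightarrow> 0 \<le> r \<Longrightarrow> 0 \<sqsubseteq> r *\<^sub>R a"
    and riesz_decomposition: "0 \<sqsubseteq> a \<Longrightarrow> 0 \<sqsubseteq> b \<Longrightarrow> 0 \<sqsubseteq> c \<Longrightarrow> c \<sqsubseteq> a + b \<Longrightarrow>
      \<exists>c1 c2. c = c1 + c2 \<and> 0 \<sqsubseteq> c1 \<and> c1 \<sqsubseteq> a \<and> 0 \<sqsubseteq> c2 \<and> c2 \<sqsubseteq> b"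
    and difference_of_nonneg: "\<exists>a b. v = a - b \<and> 0 \<sqsubseteq> a \<and> 0 \<sqsubseteq> b \<and> norm a \<le> norm v \<and> norm b \<le> norm v"
    and norm_mono: "0 \<sqsubseteq> a \<Longrightarrow> a \<sqsubseteq> b \<Longrightarrow> norm a \<le> norm b"
begin

lemma le_refl [simp]: "a \<sqsubseteq> a"
proof -
  obtain b where "0 \<sqsubseteq> b" using difference_of_nonneg by blast
  then have "0 \<sqsubseteq> 0 *\<^sub>R b" by (rule scale_nonneg) simp
  then show ?thesis by (subst le_iff_diff_nonneg) simp
qed

lemma le_trans: "a \<sqsubseteq> b \<Longrightarrow> b \<sqsubseteq> c \<Longrightarrow> a \<sqsubseteq> c"
  using add_nonneg[of "b - a" "c - b"] by (simp add: le_iff_diff_nonneg[of a] le_iff_diff_nonneg[of b])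

lemma le_add_mono: "a \<sqsubseteq> b \<Longrightarrow> c \<sqsubseteq> d \<Longrightarrow> a + c \<sqsubseteq> b + d"
  using add_nonneg[of "b - a" "d - c"]
  by (simp add: le_iff_diff_nonneg[of a] le_iff_diff_nonneg[of c] le_iff_diff_nonneg[of "a + c"] algebra_simps)

subsection \<open>Order and lattice structure of the dual\<close>

definition dual_order :: "('v \<Rightarrow>\<^sub>L real) \<Rightarrow> ('v \<Rightarrow>\<^sub>L real) \<Rightarrow> bool" (infix "\<preceq>" 50) where
  "f \<preceq> g \<longleftrightarrow> (\<forall>a. 0 \<sqsubseteq> a \<longrightarrow> blinfun_apply f a \<le> blinfun_apply g a)"

lemma dual_orderI: "(\<And>a. 0 \<sqsubseteq> a \<Longrightarrow> blinfun_apply f a \<le> blinfun_apply g a) \<Longrightarrow> f \<preceq> g"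
  by (simp add: dual_order_def)

lemma dual_orderD: "f \<preceq> g \<Longrightarrow> 0 \<sqsubseteq> a \<Longrightarrow> blinfun_apply f a \<le> blinfun_apply g a"
  by (simp add: dual_order_def)

lemma dual_nonnegD: "0 \<preceq> f \<Longrightarrow> 0 \<sqsubseteq> a \<Longrightarrow> 0 \<le> blinfun_apply f a"
  using dual_orderD[of 0 f a] by simp

lemma positive_functional_mono: "0 \<preceq> f \<Longrightarrow> a \<sqsubseteq> b \<Longrightarrow> blinfun_apply f a \<le> blinfun_apply f b"
  using dual_nonnegD[of f "b - a"] by (simp add: le_iff_diff_nonneg[of a] blinfun.diff_right)

lemma functional_eqI:
  assumes "\<And>a. 0 \<sqsubseteq> a \<Longrightarrow> blinfun_apply f a = blinfun_apply g a"
  shows "f = g"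
proof (rule blinfun_eqI)
  fix v
  obtain a b where "0 \<sqsubseteq> a" "0 \<sqsubseteq> b" "v = a - b"
    using difference_of_nonneg by blast
  then show "blinfun_apply f v = blinfun_apply g v"
    using assms by (simp add: blinfun.diff_right)
qed

lemma norm_positive_functional_le:
  fixes f :: "'v \<Rightarrow>\<^sub>L real"
  assumes "0 \<preceq> f" "0 \<le> C" "\<And>a. 0 \<sqsubseteq> a \<Longrightarrow> f a \<le> C * norm a"
  shows "norm f \<le> C"
proof (rule norm_blinfun_bound[OF \<open>0 \<le> C\<close>])
  fix v
  obtain a b where ab: "v = a - b" "0 \<sqsubseteq> a" "0 \<sqsubseteq> b" "norm a \<le> norm v" "norm b \<le> norm v"
    using difference_of_nonneg by blast
  have "f a \<le> C * norm v" "f b \<le> C * norm v"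
    using assms(3)[OF ab(2)] assms(3)[OF ab(3)] mult_left_mono[OF ab(4) \<open>0 \<le> C\<close>]
      mult_left_mono[OF ab(5) \<open>0 \<le> C\<close>] by linarith+
  then show "norm (f v) \<le> C * norm v"
    using dual_nonnegD[OF assms(1) ab(2)] dual_nonnegD[OF assms(1) ab(3)]
    by (simp add: ab(1) blinfun.diff_right abs_le_iff)
qed

lemma cone_extension:
  fixes p :: "'v \<Rightarrow> real"
  assumes p_add: "\<And>a b. 0 \<sqsubseteq> a \<Longrightarrow> 0 \<sqsubseteq> b \<Longrightarrow> p (a + b) = p a + p b"
    and p_bound: "\<And>a. 0 \<sqsubseteq> a \<Longrightarrow> \<bar>p a\<bar> \<le> C * norm a"
  shows "\<exists>\<psi>::'v \<Rightarrow>\<^sub>L real. \<forall>a. 0 \<sqsubseteq> a \<longrightarrow> \<psi> a = p a"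
proof -
  obtain A B where AB: "\<And>v. v = A v - B v" "\<And>v. 0 \<sqsubseteq> A v" "\<And>v. 0 \<sqsubseteq> B v"
      "\<And>v. norm (A v) \<le> norm v" "\<And>v. norm (B v) \<le> norm v"
    using difference_of_nonneg by metis
  define q where "q v = p (A v) - p (B v)" for v
  have q: "q (a - b) = p a - p b" if "0 \<sqsubseteq> a" "0 \<sqsubseteq> b" for a b
  proof -
    have "A (a - b) + b = a + B (a - b)"
      using AB(1)[of "a - b"] by (simp add: algebra_simps)
    then have "p (A (a - b)) + p b = p a + p (B (a - b))"
      using p_add that AB(2,3) by metis
    then show ?thesis by (simp add: q_def)
  qed
  have "bounded_linear q"
  proof (rule additive_bounded_imp_bounded_linear)
    show "Modules.additive q"
    proof
      fix v w
      have "v + w = (A v + A w) - (B v + B w)"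
        using AB(1)[of v] AB(1)[of w] by (simp add: algebra_simps)
      then have "q (v + w) = p (A v + A w) - p (B v + B w)"
        using q[of "A v + A w" "B v + B w"] AB(2,3) add_nonneg by simp
      then show "q (v + w) = q v + q w" using AB(2,3) p_add by (simp add: q_def)
    qed
    show "norm (q v) \<le> 2 * \<bar>C\<bar> * norm v" for v
    proof -
      have "\<bar>p a\<bar> \<le> \<bar>C\<bar> * norm v" if "0 \<sqsubseteq> a" "norm a \<le> norm v" for a
        using p_bound[OF that(1)] mult_mono[OF abs_ge_self[of C] that(2)] by simp
      from this[OF AB(2,4)] this[OF AB(3,5)] show ?thesis by (simp add: q_def)
    qed
  qed
  moreover have "q a = p a" if "0 \<sqsubseteq> a" for a
    using q[OF that le_refl] p_add[OF le_refl le_refl] by simp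
  ultimately show ?thesis
    using bounded_linear_Blinfun_apply by metis
qed

definition positive_ideal :: "'v set \<Rightarrow> bool" where
  "positive_ideal I \<longleftrightarrow> 0 \<in> I \<and> (\<forall>a\<in>I. 0 \<sqsubseteq> a) \<and> (\<forall>a\<in>I. \<forall>b\<in>I. a + b \<in> I) \<and>
    (\<forall>a\<in>I. \<forall>b. 0 \<sqsubseteq> b \<longrightarrow> b \<sqsubseteq> a \<longrightarrow> b \<in> I)"

lemma
  assumes "positive_ideal I"
  shows positive_ideal_zero: "0 \<in> I"
    and positive_ideal_nonneg: "a \<in> I \<Longrightarrow> 0 \<sqsubseteq> a"
    and positive_ideal_add: "a \<in> I \<Longrightarrow> b \<in> I \<Longrightarrow> a + b \<in> I"
    and positive_ideal_solid: "a \<in> I \<Longrightarrow> 0 \<sqsubseteq> b \<Longrightarrow> b \<sqsubseteq> a \<Longrightarrow> b \<in> I"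
  using assms unfolding positive_ideal_def by blast+

lemma positive_ideal_cone: "positive_ideal {a. 0 \<sqsubseteq> a}"
  by (auto simp: positive_ideal_def add_nonneg)

lemma positive_ideal_null:
  assumes "0 \<preceq> \<phi>"
  shows "positive_ideal {a. 0 \<sqsubseteq> a \<and> blinfun_apply \<phi> a = 0}"
proof -
  have "blinfun_apply \<phi> b = 0" if "0 \<sqsubseteq> b" "b \<sqsubseteq> a" "blinfun_apply \<phi> a = 0" for a b
    using dual_nonnegD[OF assms that(1)] positive_functional_mono[OF assms that(2)] that(3) by simp
  then show ?thesis by (auto simp: positive_ideal_def add_nonneg blinfun.bilinear_simps)
qed

lemma positive_ideal_dominated:
  fixes \<phi> \<psi> :: "'v \<Rightarrow>\<^sub>L real"
  shows "positive_ideal {a. 0 \<sqsubseteq> a \<and> (\<forall>b. 0 \<sqsubseteq> b \<longrightarrow> b \<sqsubseteq> a \<longrightarrow> \<phi> b \<le> \<psi> b)}"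
    (is "positive_ideal ?I")
  unfolding positive_ideal_def
proof (intro conjI ballI allI impI)
  have "b = 0" if "0 \<sqsubseteq> b" "b \<sqsubseteq> 0" for b using norm_mono[OF that] by simp
  then show "0 \<in> ?I" by (force simp: blinfun.zero_right)
  show "0 \<sqsubseteq> a" if "a \<in> ?I" for a using that by simp
  show "b \<in> ?I" if "a \<in> ?I" "0 \<sqsubseteq> b" "b \<sqsubseteq> a" for a b using that le_trans by blast
  show "a + b \<in> ?I" if ab: "a \<in> ?I" "b \<in> ?I" for a b
  proof -
    have "\<phi> d \<le> \<psi> d" if d: "0 \<sqsubseteq> d" "d \<sqsubseteq> a + b" for d
    proof -
      obtain d1 d2 where "d = d1 + d2" "0 \<sqsubseteq> d1" "d1 \<sqsubseteq> a" "0 \<sqsubseteq> d2" "d2 \<sqsubseteq> b"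
        using riesz_decomposition[of a b d] ab d by blast
      moreover from this have "\<phi> d1 \<le> \<psi> d1" "\<phi> d2 \<le> \<psi> d2" using ab by auto
      ultimately show ?thesis by (simp add: blinfun.add_right)
    qed
    then show ?thesis using ab add_nonneg by blast
  qed
qed

text \<open>The Riesz--Kantorovich formula.\<close>

definition ideal_sup :: "'v set \<Rightarrow> ('v \<Rightarrow>\<^sub>L real) \<Rightarrow> ('v \<Rightarrow>\<^sub>L real)" where
  "ideal_sup I \<phi> = (SOME \<psi>. \<forall>a. 0 \<sqsubseteq> a \<longrightarrow>
    blinfun_apply \<psi> a = (SUP b\<in>{b \<in> I. b \<sqsubseteq> a}. blinfun_apply \<phi> b))"

lemma
  fixes \<phi> :: "'v \<Rightarrow>\<^sub>L real"
  assumes "positive_ideal I"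
  shows ideal_sup_bdd_above: "bdd_above (\<phi> ` {b \<in> I. b \<sqsubseteq> a})"
    and ideal_sup_SUP_le: "0 \<sqsubseteq> a \<Longrightarrow> (SUP b\<in>{b \<in> I. b \<sqsubseteq> a}. \<phi> b) \<le> norm \<phi> * norm a"
proof -
  have le: "\<phi> b \<le> norm \<phi> * norm a" if "b \<in> I" "b \<sqsubseteq> a" for b
  proof -
    have "\<phi> b \<le> norm \<phi> * norm b" using norm_blinfun[of \<phi> b] by simp
    also have "\<dots> \<le> norm \<phi> * norm a"
      using norm_mono positive_ideal_nonneg[OF assms] that by (intro mult_left_mono) auto
    finally show ?thesis .
  qed
  then show "bdd_above (\<phi> ` {b \<in> I. b \<sqsubseteq> a})" by (auto simp: bdd_above_def)
  show "(SUP b\<in>{b \<in> I. b \<sqsubseteq> a}. \<phi> b) \<le> norm \<phi> * norm a" if "0 \<sqsubseteq> a"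
    using le that positive_ideal_zero[OF assms] by (intro cSUP_least) auto
qed

lemma ideal_SUP_add:
  fixes \<phi> :: "'v \<Rightarrow>\<^sub>L real"
  assumes I: "positive_ideal I" and ab: "0 \<sqsubseteq> a" "0 \<sqsubseteq> b"
  shows "(SUP d\<in>{d \<in> I. d \<sqsubseteq> a + b}. \<phi> d) = (SUP d\<in>{d \<in> I. d \<sqsubseteq> a}. \<phi> d) + (SUP d\<in>{d \<in> I. d \<sqsubseteq> b}. \<phi> d)"
    (is "?p (a + b) = ?p a + ?p b")
proof (rule antisym)
  note upper = cSUP_upper[OF _ ideal_sup_bdd_above[OF I]]
  note zero = positive_ideal_zero[OF I]
  show "?p (a + b) \<le> ?p a + ?p b"
  proof (rule cSUP_least)
    show "{d \<in> I. d \<sqsubseteq> a + b} \<noteq> {}" using zero add_nonneg[OF ab] by blast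
    fix d assume d: "d \<in> {d \<in> I. d \<sqsubseteq> a + b}"
    then obtain d1 d2 where dd: "d = d1 + d2" "0 \<sqsubseteq> d1" "d1 \<sqsubseteq> a" "0 \<sqsubseteq> d2" "d2 \<sqsubseteq> b"
      using riesz_decomposition[OF ab, of d] positive_ideal_nonneg[OF I] by blast
    have "d1 \<sqsubseteq> d" "d2 \<sqsubseteq> d"
      using dd le_iff_diff_nonneg[of d1 d] le_iff_diff_nonneg[of d2 d] by simp_all
    then have "d1 \<in> I" "d2 \<in> I" using positive_ideal_solid[OF I, of d] d dd by auto
    then show "\<phi> d \<le> ?p a + ?p b"
      using upper[of d1 a \<phi>] upper[of d2 b \<phi>] dd by (simp add: blinfun.add_right)
  qed
  have "?p a \<le> ?p (a + b) - ?p b"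
  proof (rule cSUP_least)
    show "{d \<in> I. d \<sqsubseteq> a} \<noteq> {}" using zero ab by blast
    fix d1 assume d1: "d1 \<in> {d \<in> I. d \<sqsubseteq> a}"
    have "?p b \<le> ?p (a + b) - \<phi> d1"
    proof (rule cSUP_least)
      show "{d \<in> I. d \<sqsubseteq> b} \<noteq> {}" using zero ab by blast
      fix d2 assume "d2 \<in> {d \<in> I. d \<sqsubseteq> b}"
      then have "d1 + d2 \<in> {d \<in> I. d \<sqsubseteq> a + b}"
        using d1 positive_ideal_add[OF I] le_add_mono by blast
      from upper[OF this, of \<phi>] show "\<phi> d2 \<le> ?p (a + b) - \<phi> d1" by (simp add: blinfun.add_right)
    qed
    then show "\<phi> d1 \<le> ?p (a + b) - ?p b" by simp
  qed
  then show "?p a + ?p b \<le> ?p (a + b)" by simp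
qed

lemma ideal_sup_eq:
  fixes \<phi> :: "'v \<Rightarrow>\<^sub>L real"
  assumes I: "positive_ideal I" and "0 \<sqsubseteq> a"
  shows "ideal_sup I \<phi> a = (SUP b\<in>{b \<in> I. b \<sqsubseteq> a}. \<phi> b)"
proof -
  have "\<exists>\<psi>::'v \<Rightarrow>\<^sub>L real. \<forall>a. 0 \<sqsubseteq> a \<longrightarrow> \<psi> a = (SUP b\<in>{b \<in> I. b \<sqsubseteq> a}. \<phi> b)"
  proof (rule cone_extension[OF ideal_SUP_add[OF I]])
    fix a assume a: "0 \<sqsubseteq> a"
    have "\<phi> 0 \<le> (SUP b\<in>{b \<in> I. b \<sqsubseteq> a}. \<phi> b)"
      using a positive_ideal_zero[OF I] by (intro cSUP_upper[OF _ ideal_sup_bdd_above[OF I]]) simp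
    then show "\<bar>SUP b\<in>{b \<in> I. b \<sqsubseteq> a}. \<phi> b\<bar> \<le> norm \<phi> * norm a"
      using ideal_sup_SUP_le[OF I a, of \<phi>] by (simp add: blinfun.zero_right)
  qed
  from someI_ex[OF this] show ?thesis using \<open>0 \<sqsubseteq> a\<close> by (simp add: ideal_sup_def)
qed

lemma
  fixes \<phi> :: "'v \<Rightarrow>\<^sub>L real"
  assumes I: "positive_ideal I" and a: "0 \<sqsubseteq> a"
  shows ideal_sup_upper: "b \<in> I \<Longrightarrow> b \<sqsubseteq> a \<Longrightarrow> \<phi> b \<le> ideal_sup I \<phi> a"
    and ideal_sup_least: "(\<And>b. b \<in> I \<Longrightarrow> b \<sqsubseteq> a \<Longrightarrow> \<phi> b \<le> u) \<Longrightarrow> ideal_sup I \<phi> a \<le> u"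
    and ideal_sup_approx: "0 < \<eta> \<Longrightarrow> \<exists>b\<in>I. b \<sqsubseteq> a \<and> ideal_sup I \<phi> a < \<phi> b + \<eta>"
proof -
  have ne: "{b \<in> I. b \<sqsubseteq> a} \<noteq> {}" using positive_ideal_zero[OF I] a by blast
  show "\<phi> b \<le> ideal_sup I \<phi> a" if "b \<in> I" "b \<sqsubseteq> a"
    unfolding ideal_sup_eq[OF I a] using that by (intro cSUP_upper ideal_sup_bdd_above[OF I]) simp
  show least: "ideal_sup I \<phi> a \<le> u" if "\<And>b. b \<in> I \<Longrightarrow> b \<sqsubseteq> a \<Longrightarrow> \<phi> b \<le> u" for u
    unfolding ideal_sup_eq[OF I a] using that by (intro cSUP_least[OF ne]) simp
  show "\<exists>b\<in>I. b \<sqsubseteq> a \<and> ideal_sup I \<phi> a < \<phi> b + \<eta>" if "0 < \<eta>"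
    using least[of "ideal_sup I \<phi> a - \<eta>"] that by force
qed

lemma ideal_sup_nonneg: "positive_ideal I \<Longrightarrow> 0 \<preceq> ideal_sup I \<phi>"
  using ideal_sup_upper[OF _ _ positive_ideal_zero, of I _ \<phi>]
  by (auto intro!: dual_orderI simp: blinfun.zero_right)

definition pos_part :: "('v \<Rightarrow>\<^sub>L real) \<Rightarrow> ('v \<Rightarrow>\<^sub>L real)" where
  "pos_part = ideal_sup {a. 0 \<sqsubseteq> a}"

lemma pos_part_upper: "0 \<sqsubseteq> b \<Longrightarrow> b \<sqsubseteq> a \<Longrightarrow> blinfun_apply \<phi> b \<le> pos_part \<phi> a"
  unfolding pos_part_def using ideal_sup_upper[OF positive_ideal_cone le_trans] by simp

lemma pos_part_approx:
  "0 \<sqsubseteq> a \<Longrightarrow> 0 < \<eta> \<Longrightarrow> \<exists>b. 0 \<sqsubseteq> b \<and> b \<sqsubseteq> a \<and> pos_part \<phi> a < blinfun_apply \<phi> b + \<eta>"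
  unfolding pos_part_def using ideal_sup_approx[OF positive_ideal_cone] by simp

lemma pos_part_nonneg: "0 \<preceq> pos_part \<phi>"
  unfolding pos_part_def by (rule ideal_sup_nonneg[OF positive_ideal_cone])

lemma pos_part_ge: "\<phi> \<preceq> pos_part \<phi>"
  by (simp add: dual_orderI pos_part_upper)

lemma pos_part_apply_le:
  "0 \<sqsubseteq> a \<Longrightarrow> (\<And>b. 0 \<sqsubseteq> b \<Longrightarrow> b \<sqsubseteq> a \<Longrightarrow> blinfun_apply \<phi> b \<le> u) \<Longrightarrow> pos_part \<phi> a \<le> u"
  unfolding pos_part_def by (rule ideal_sup_least[OF positive_ideal_cone]) auto

lemma pos_part_least:
  assumes "0 \<preceq> \<psi>" "\<phi> \<preceq> \<psi>"
  shows "pos_part \<phi> \<preceq> \<psi>"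
proof (rule dual_orderI)
  fix a assume "0 \<sqsubseteq> a"
  then show "pos_part \<phi> a \<le> \<psi> a"
  proof (rule pos_part_apply_le)
    show "\<phi> b \<le> \<psi> a" if "0 \<sqsubseteq> b" "b \<sqsubseteq> a" for b
      using dual_orderD[OF assms(2) that(1)] positive_functional_mono[OF assms(1) that(2)] by simp
  qed
qed

lemma dual_refl [simp]: "f \<preceq> f"
  by (simp add: dual_order_def)

lemma dual_trans [trans]: "f \<preceq> g \<Longrightarrow> g \<preceq> h \<Longrightarrow> f \<preceq> h"
  unfolding dual_order_def by (meson order_trans)

lemma dual_antisym: "f \<preceq> g \<Longrightarrow> g \<preceq> f \<Longrightarrow> f = g"
  by (rule functional_eqI) (simp add: dual_order_def antisym)

lemma dual_diff_nonneg [simp]: "0 \<preceq> g - f \<longleftrightarrow> f \<preceq> g"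
  by (simp add: dual_order_def blinfun.diff_left)

lemma dual_diff_le: "0 \<preceq> g \<Longrightarrow> f - g \<preceq> f"
  by (simp add: dual_order_def blinfun.diff_left)

lemma dual_scale_mono: "f \<preceq> g \<Longrightarrow> 0 \<le> c \<Longrightarrow> c *\<^sub>R f \<preceq> c *\<^sub>R g"
  by (simp add: dual_order_def blinfun.scaleR_left mult_left_mono)

lemma dual_scale_nonneg: "0 \<preceq> f \<Longrightarrow> 0 \<le> c \<Longrightarrow> 0 \<preceq> c *\<^sub>R f"
  using dual_scale_mono[of 0 f c] by simp

lemma dual_add_nonneg: "0 \<preceq> f \<Longrightarrow> 0 \<preceq> g \<Longrightarrow> 0 \<preceq> f + g"
  by (simp add: dual_order_def blinfun.add_left)

lemma dual_sum_nonneg: "(\<And>j. j \<in> J \<Longrightarrow> 0 \<preceq> f j) \<Longrightarrow> 0 \<preceq> sum f J"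
  by (simp add: dual_order_def blinfun.sum_left sum_nonneg)

lemma pos_part_mono: "f \<preceq> g \<Longrightarrow> pos_part f \<preceq> pos_part g"
  by (meson dual_trans pos_part_ge pos_part_least pos_part_nonneg)

lemma pos_part_nonpos: "f \<preceq> 0 \<Longrightarrow> pos_part f = 0"
  by (rule dual_antisym) (simp_all add: pos_part_least pos_part_nonneg)

lemma pos_part_of_nonneg: "0 \<preceq> f \<Longrightarrow> pos_part f = f"
  by (rule dual_antisym) (simp_all add: pos_part_least pos_part_ge)

lemma pos_part_le_scale: "1 \<le> r \<Longrightarrow> pos_part f \<preceq> pos_part (r *\<^sub>R f)"
proof (rule pos_part_least[OF pos_part_nonneg], rule dual_orderI)
  fix a assume "1 \<le> r" and a: "0 \<sqsubseteq> a"
  have "r * f a \<le> pos_part (r *\<^sub>R f) a"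
    using dual_orderD[OF pos_part_ge a, of "r *\<^sub>R f"] by (simp add: blinfun.scaleR_left)
  moreover have "0 \<le> pos_part (r *\<^sub>R f) a" by (rule dual_nonnegD[OF pos_part_nonneg a])
  moreover have "0 \<le> f a \<Longrightarrow> f a \<le> r * f a" using \<open>1 \<le> r\<close> by (simp add: mult_le_cancel_right1)
  ultimately show "f a \<le> pos_part (r *\<^sub>R f) a" by linarith
qed

lemma pos_part_uminus: "pos_part (- f) = pos_part f - f"
proof (rule dual_antisym)
  show "pos_part (- f) \<preceq> pos_part f - f"
    using pos_part_nonneg[of f] pos_part_ge[of f]
    by (intro pos_part_least) (simp_all add: dual_order_def blinfun.bilinear_simps)
  have "pos_part f \<preceq> pos_part (- f) + f"
    using pos_part_nonneg[of "- f"] pos_part_ge[of "- f"]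
    by (intro pos_part_least) (simp_all add: dual_order_def blinfun.bilinear_simps add_increasing le_diff_eq flip: diff_le_eq)
  then show "pos_part f - f \<preceq> pos_part (- f)"
    by (simp add: dual_order_def blinfun.bilinear_simps diff_le_eq)
qed

lemma pos_part_le_add_pos_part_diff: "0 \<preceq> h \<Longrightarrow> pos_part g \<preceq> pos_part (g - h) + h"
  using pos_part_nonneg[of "g - h"] pos_part_ge[of "g - h"]
  by (intro pos_part_least) (simp_all add: dual_order_def blinfun.bilinear_simps algebra_simps)

lemma norm_pos_part: "norm (pos_part f) \<le> norm f"
proof (rule norm_positive_functional_le[OF pos_part_nonneg])
  show "pos_part f a \<le> norm f * norm a" if "0 \<sqsubseteq> a" for a
    using ideal_sup_SUP_le[OF positive_ideal_cone that, of f] ideal_sup_eq[OF positive_ideal_cone that, of f]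
    by (simp add: pos_part_def)
qed simp

definition dual_sup :: "('v \<Rightarrow>\<^sub>L real) \<Rightarrow> ('v \<Rightarrow>\<^sub>L real) \<Rightarrow> ('v \<Rightarrow>\<^sub>L real)" where
  "dual_sup f g = g + pos_part (f - g)"

definition dual_inf :: "('v \<Rightarrow>\<^sub>L real) \<Rightarrow> ('v \<Rightarrow>\<^sub>L real) \<Rightarrow> ('v \<Rightarrow>\<^sub>L real)" where
  "dual_inf f g = f - pos_part (f - g)"

lemma dual_sup_add_inf: "dual_sup f g + dual_inf f g = f + g"
  by (simp add: dual_sup_def dual_inf_def)

lemma
  shows dual_sup_upper1: "f \<preceq> dual_sup f g"
    and dual_sup_upper2: "g \<preceq> dual_sup f g"
    and dual_inf_lower1: "dual_inf f g \<preceq> f"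
    and dual_inf_lower2: "dual_inf f g \<preceq> g"
  using pos_part_ge[of "f - g"] pos_part_nonneg[of "f - g"]
  by (simp_all add: dual_order_def dual_sup_def dual_inf_def blinfun.bilinear_simps algebra_simps)

lemma dual_sup_least: "f \<preceq> h \<Longrightarrow> g \<preceq> h \<Longrightarrow> dual_sup f g \<preceq> h"
  using pos_part_least[of "h - g" "f - g"]
  by (simp add: dual_order_def dual_sup_def blinfun.bilinear_simps algebra_simps)

lemma dual_inf_greatest: "h \<preceq> f \<Longrightarrow> h \<preceq> g \<Longrightarrow> h \<preceq> dual_inf f g"
  using pos_part_least[of "f - h" "f - g"]
  by (simp add: dual_order_def dual_inf_def blinfun.bilinear_simps algebra_simps)

definition modulus :: "('v \<Rightarrow>\<^sub>L real) \<Rightarrow> ('v \<Rightarrow>\<^sub>L real)" where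
  "modulus f = pos_part f + pos_part (- f)"

lemma
  shows pos_part_le_modulus: "pos_part f \<preceq> modulus f"
    and neg_part_le_modulus: "pos_part (- f) \<preceq> modulus f"
    and modulus_nonneg: "0 \<preceq> modulus f"
  using pos_part_nonneg[of f] pos_part_nonneg[of "- f"]
  by (auto simp: modulus_def dual_order_def blinfun.bilinear_simps)

lemma modulus_of_nonneg: "0 \<preceq> f \<Longrightarrow> modulus f = f"
  by (simp add: modulus_def pos_part_uminus pos_part_of_nonneg)

lemma modulus_diff_le:
  assumes "0 \<preceq> f" "f \<preceq> h" "0 \<preceq> g" "g \<preceq> h"
  shows "modulus (f - g) \<preceq> h"
proof -
  have "modulus (f - g) = dual_sup f g - dual_inf f g"
    using pos_part_uminus[of "f - g"] by (simp add: modulus_def dual_sup_def dual_inf_def)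
  also have "\<dots> \<preceq> dual_sup f g"
    using dual_inf_greatest[OF assms(1,3)] by (simp add: dual_order_def blinfun.diff_left)
  also have "\<dots> \<preceq> h" by (rule dual_sup_least[OF assms(2,4)])
  finally show ?thesis .
qed

lemma abs_le_modulus: "0 \<sqsubseteq> a \<Longrightarrow> \<bar>blinfun_apply f a\<bar> \<le> modulus f a"
  using dual_orderD[OF pos_part_ge[of f]] dual_orderD[OF pos_part_ge[of "- f"]]
    dual_orderD[OF pos_part_le_modulus[of f]] dual_orderD[OF neg_part_le_modulus[of f]]
  by (fastforce simp: blinfun.minus_left abs_le_iff)

lemma norm_modulus_le: "norm (modulus f) \<le> 2 * norm f"
  using norm_triangle_ineq[of "pos_part f" "pos_part (- f)"] norm_pos_part[of f] norm_pos_part[of "- f"]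
  by (simp add: modulus_def)

lemma modulus_approx:
  assumes "0 \<sqsubseteq> a" "0 < \<delta>" "\<delta> \<le> modulus f a"
  shows "\<exists>b. 0 \<sqsubseteq> b \<and> b \<sqsubseteq> a \<and> \<delta> / 4 \<le> \<bar>blinfun_apply f b\<bar>"
proof -
  have approx: "\<exists>b. 0 \<sqsubseteq> b \<and> b \<sqsubseteq> a \<and> \<delta> / 4 \<le> blinfun_apply g b" if "\<delta> / 2 \<le> pos_part g a" for g
    using pos_part_approx[OF assms(1), of "\<delta> / 4" g] that assms(2) by fastforce
  have "\<delta> / 2 \<le> pos_part f a \<or> \<delta> / 2 \<le> pos_part (- f) a"
    using assms(3) by (auto simp: modulus_def blinfun.add_left)
  then show ?thesis
    using approx[of f] approx[of "- f"] by (fastforce simp: blinfun.minus_left)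
qed

lemma dual_riesz_decomposition:
  assumes "0 \<preceq> f" "0 \<preceq> g" "0 \<preceq> h" "h \<preceq> f + g"
  shows "\<exists>h1 h2. h = h1 + h2 \<and> 0 \<preceq> h1 \<and> h1 \<preceq> f \<and> 0 \<preceq> h2 \<and> h2 \<preceq> g"
proof (intro exI conjI)
  show "h = dual_inf h f + pos_part (h - f)" by (simp add: dual_inf_def)
  show "0 \<preceq> dual_inf h f" using assms by (simp add: dual_inf_greatest)
  show "pos_part (h - f) \<preceq> g"
    using assms by (intro pos_part_least) (simp_all add: dual_order_def blinfun.bilinear_simps algebra_simps)
qed (fact dual_inf_lower2 pos_part_nonneg)+

lemma dual_riesz_normed_space: "riesz_normed_space dual_order"
proof
  fix f g :: "'v \<Rightarrow>\<^sub>L real"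
  show "f \<preceq> g \<longleftrightarrow> 0 \<preceq> g - f" by simp
  show "0 \<preceq> f \<Longrightarrow> 0 \<preceq> g \<Longrightarrow> 0 \<preceq> f + g" by (rule dual_add_nonneg)
  show "0 \<preceq> f \<Longrightarrow> 0 \<le> c \<Longrightarrow> 0 \<preceq> c *\<^sub>R f" for c by (rule dual_scale_nonneg)
  show "\<exists>a b. f = a - b \<and> 0 \<preceq> a \<and> 0 \<preceq> b \<and> norm a \<le> norm f \<and> norm b \<le> norm f"
    using norm_pos_part[of f] norm_pos_part[of "- f"] pos_part_nonneg[of f] pos_part_nonneg[of "- f"]
    by (intro exI[of _ "pos_part f"] exI[of _ "pos_part (- f)"]) (simp add: pos_part_uminus)
  show "norm f \<le> norm g" if fg: "0 \<preceq> f" "f \<preceq> g"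
  proof (rule norm_positive_functional_le[OF fg(1)])
    show "f a \<le> norm g * norm a" if "0 \<sqsubseteq> a" for a
      using dual_orderD[OF fg(2) that] norm_blinfun[of g a] by simp
  qed simp
qed (fact dual_riesz_decomposition)

subsection \<open>Disjoint functionals\<close>

definition dual_disjoint :: "('v \<Rightarrow>\<^sub>L real) \<Rightarrow> ('v \<Rightarrow>\<^sub>L real) \<Rightarrow> bool" where
  "dual_disjoint f g \<longleftrightarrow> dual_inf f g = 0"

lemma dual_disjoint_commute: "dual_disjoint f g \<Longrightarrow> dual_disjoint g f"
  using pos_part_uminus[of "f - g"] by (simp add: dual_disjoint_def dual_inf_def algebra_simps)

lemma dual_disjoint_pos_part: "dual_disjoint (pos_part f) (pos_part (- f))"
  by (simp add: dual_disjoint_def dual_inf_def pos_part_uminus)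

lemma dual_disjoint_iff_sup_eq_add: "dual_disjoint f g \<longleftrightarrow> dual_sup f g = f + g"
  using dual_sup_add_inf[of f g] by (auto simp: dual_disjoint_def)

lemma dual_disjointI:
  assumes "0 \<preceq> f" "0 \<preceq> g" "\<And>w. 0 \<preceq> w \<Longrightarrow> w \<preceq> f \<Longrightarrow> w \<preceq> g \<Longrightarrow> w = 0"
  shows "dual_disjoint f g"
  unfolding dual_disjoint_def
  by (intro assms(3) dual_inf_greatest dual_inf_lower1 dual_inf_lower2 assms(1,2))

lemma dual_disjointD: "dual_disjoint f g \<Longrightarrow> 0 \<preceq> w \<Longrightarrow> w \<preceq> f \<Longrightarrow> w \<preceq> g \<Longrightarrow> w = 0"
  using dual_inf_greatest[of w f g] dual_antisym by (simp add: dual_disjoint_def)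

lemma dual_disjoint_mono:
  assumes "dual_disjoint f g" "0 \<preceq> f'" "f' \<preceq> f" "0 \<preceq> g'" "g' \<preceq> g"
  shows "dual_disjoint f' g'"
  using assms by (meson dual_disjointD dual_disjointI dual_trans)

lemma dual_disjoint_sum:
  assumes "finite J" "0 \<preceq> f" "\<And>j. j \<in> J \<Longrightarrow> 0 \<preceq> g j" "\<And>j. j \<in> J \<Longrightarrow> dual_disjoint f (g j)"
  shows "dual_disjoint f (sum g J)"
  using assms(1,3,4)
proof (induction J)
  case empty
  show ?case using assms(2) by (intro dual_disjointI) (auto intro: dual_antisym)
next
  case (insert j J)
  have disj: "dual_disjoint f (sum g J)" and nonneg: "0 \<preceq> g j" "0 \<preceq> sum g J"
    using insert by (auto intro: dual_sum_nonneg)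
  show ?case
  proof (rule dual_disjointI[OF assms(2)])
    show "0 \<preceq> sum g (insert j J)" using insert.prems(1) by (rule dual_sum_nonneg)
    fix w assume w: "0 \<preceq> w" "w \<preceq> f" "w \<preceq> sum g (insert j J)"
    then obtain w1 w2 where ww: "w = w1 + w2" "0 \<preceq> w1" "w1 \<preceq> g j" "0 \<preceq> w2" "w2 \<preceq> sum g J"
      using dual_riesz_decomposition[OF nonneg w(1)] insert.hyps by auto
    have "w1 \<preceq> w" "w2 \<preceq> w" using ww by (simp_all add: dual_order_def blinfun.add_left)
    then have "w1 = 0" "w2 = 0"
      using dual_disjointD[of f "g j" w1] dual_disjointD[OF disj, of w2] insert.prems(2) ww w(2) dual_trans
      by blast+
    then show "w = 0" using ww(1) by simp
  qed
qed

lemma dual_disjoint_split: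
  assumes "dual_disjoint f g" "0 \<sqsubseteq> a" "0 < \<eta>"
  obtains b where "0 \<sqsubseteq> b" "b \<sqsubseteq> a" "blinfun_apply f (a - b) + blinfun_apply g b < \<eta>"
proof -
  obtain b where b: "0 \<sqsubseteq> b" "b \<sqsubseteq> a" "pos_part (f - g) a < (f - g) b + \<eta>"
    using pos_part_approx[OF assms(2,3)] by blast
  have "pos_part (f - g) = f" using assms(1) by (simp add: dual_disjoint_def dual_inf_def)
  then show thesis using that[OF b(1,2)] b(3) by (simp add: blinfun.bilinear_simps)
qed

lemma disjoint_functionals_separate:
  fixes \<mu> :: "'i \<Rightarrow> ('v \<Rightarrow>\<^sub>L real)"
  assumes J: "finite J" and u: "0 \<sqsubseteq> u" and \<mu>: "\<And>j. j \<in> J \<Longrightarrow> 0 \<preceq> \<mu> j"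
    and disj: "\<And>i j. i \<in> J \<Longrightarrow> j \<in> J \<Longrightarrow> i \<noteq> j \<Longrightarrow> dual_disjoint (\<mu> i) (\<mu> j)" and "0 < \<theta>"
  obtains a where "\<And>j. j \<in> J \<Longrightarrow> 0 \<sqsubseteq> a j" "\<And>j. j \<in> J \<Longrightarrow> a j \<sqsubseteq> u"
    "\<And>j. j \<in> J \<Longrightarrow> \<mu> j (u - a j) \<le> \<theta>" "\<And>i j. i \<in> J \<Longrightarrow> j \<in> J \<Longrightarrow> i \<noteq> j \<Longrightarrow> \<mu> j (a i) \<le> \<theta>"
proof -
  define \<sigma> where "\<sigma> j = sum \<mu> (J - {j})" for j
  have "\<exists>a. 0 \<sqsubseteq> a \<and> a \<sqsubseteq> u \<and> \<mu> j (u - a) + \<sigma> j a < \<theta>" if "j \<in> J" for j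
  proof -
    have "dual_disjoint (\<mu> j) (\<sigma> j)"
      unfolding \<sigma>_def using that J \<mu> disj by (intro dual_disjoint_sum) auto
    then show ?thesis by (rule dual_disjoint_split[OF _ u \<open>0 < \<theta>\<close>]) blast
  qed
  then obtain a where a: "\<And>j. j \<in> J \<Longrightarrow> 0 \<sqsubseteq> a j" "\<And>j. j \<in> J \<Longrightarrow> a j \<sqsubseteq> u"
    and split: "\<And>j. j \<in> J \<Longrightarrow> \<mu> j (u - a j) + \<sigma> j (a j) < \<theta>" by metis
  have \<mu>_nonneg: "0 \<le> \<mu> i (a j)" "0 \<le> \<mu> i (u - a j)" if "i \<in> J" "j \<in> J" for i j
    using dual_nonnegD[OF \<mu>[OF that(1)]] a[OF that(2)] le_iff_diff_nonneg by blast+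
  have \<sigma>_a: "\<sigma> j (a j) = (\<Sum>i\<in>J - {j}. \<mu> i (a j))" for j by (simp add: \<sigma>_def blinfun.sum_left)
  show thesis
  proof (rule that[OF a])
    fix j assume j: "j \<in> J"
    show "\<mu> j (u - a j) \<le> \<theta>"
      using split[OF j] sum_nonneg[of "J - {j}" "\<lambda>i. \<mu> i (a j)"] \<mu>_nonneg(1) j by (simp add: \<sigma>_a)
    show "\<mu> j (a i) \<le> \<theta>" if "i \<in> J" "i \<noteq> j" for i
    proof -
      have "\<mu> j (a i) \<le> \<sigma> i (a i)"
        unfolding \<sigma>_a using that j J \<mu>_nonneg(1) by (intro member_le_sum) auto
      then show ?thesis using split[OF that(1)] \<mu>_nonneg(2)[OF that(1) that(1)] by simp
    qed
  qed
qed

subsection \<open>Suprema and infima of families of functionals\<close>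

lemma directed_SUP_add:
  fixes D :: "('v \<Rightarrow>\<^sub>L real) set"
  assumes "D \<noteq> {}" and directed: "\<And>d d'. d \<in> D \<Longrightarrow> d' \<in> D \<Longrightarrow> \<exists>d''\<in>D. d \<preceq> d'' \<and> d' \<preceq> d''"
    and bdd: "\<And>a. 0 \<sqsubseteq> a \<Longrightarrow> bdd_above ((\<lambda>d. blinfun_apply d a) ` D)" and ab: "0 \<sqsubseteq> a" "0 \<sqsubseteq> b"
  shows "(SUP d\<in>D. blinfun_apply d (a + b)) = (SUP d\<in>D. blinfun_apply d a) + (SUP d\<in>D. blinfun_apply d b)"
    (is "?p (a + b) = ?p a + ?p b")
proof (rule antisym)
  note upper = cSUP_upper[OF _ bdd]
  show "?p (a + b) \<le> ?p a + ?p b"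
    using upper ab by (intro cSUP_least[OF \<open>D \<noteq> {}\<close>]) (auto simp: blinfun.add_right intro: add_mono)
  have "?p a \<le> ?p (a + b) - ?p b"
  proof (rule cSUP_least[OF \<open>D \<noteq> {}\<close>])
    fix d assume d: "d \<in> D"
    have "?p b \<le> ?p (a + b) - d a"
    proof (rule cSUP_least[OF \<open>D \<noteq> {}\<close>])
      fix d' assume "d' \<in> D"
      then obtain d'' where d'': "d'' \<in> D" "d \<preceq> d''" "d' \<preceq> d''" using directed d by blast
      then show "d' b \<le> ?p (a + b) - d a"
        using upper[OF d''(1) add_nonneg[OF ab]] dual_orderD[OF d''(2) ab(1)] dual_orderD[OF d''(3) ab(2)]
        by (simp add: blinfun.add_right)
    qed
    then show "d a \<le> ?p (a + b) - ?p b" by simp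
  qed
  then show "?p a + ?p b \<le> ?p (a + b)" by simp
qed

lemma directed_sup:
  fixes D :: "('v \<Rightarrow>\<^sub>L real) set"
  assumes "D \<noteq> {}" and directed: "\<And>d d'. d \<in> D \<Longrightarrow> d' \<in> D \<Longrightarrow> \<exists>d''\<in>D. d \<preceq> d'' \<and> d' \<preceq> d''"
    and bound: "\<And>d. d \<in> D \<Longrightarrow> d \<preceq> h"
  obtains s where "\<And>d. d \<in> D \<Longrightarrow> d \<preceq> s" "\<And>g. (\<And>d. d \<in> D \<Longrightarrow> d \<preceq> g) \<Longrightarrow> s \<preceq> g"
    "\<And>a \<eta>. 0 \<sqsubseteq> a \<Longrightarrow> 0 < \<eta> \<Longrightarrow> \<exists>d\<in>D. blinfun_apply s a < blinfun_apply d a + \<eta>"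
proof -
  define p where "p a = (SUP d\<in>D. blinfun_apply d a)" for a
  have bdd: "bdd_above ((\<lambda>d. blinfun_apply d a) ` D)" if "0 \<sqsubseteq> a" for a
    using dual_orderD[OF bound that] by (auto simp: bdd_above_def)
  have p_ge: "blinfun_apply d a \<le> p a" if "d \<in> D" "0 \<sqsubseteq> a" for d a
    unfolding p_def using that by (intro cSUP_upper bdd)
  have p_le: "p a \<le> u" if "\<And>d. d \<in> D \<Longrightarrow> blinfun_apply d a \<le> u" for a u
    unfolding p_def by (rule cSUP_least[OF \<open>D \<noteq> {}\<close> that])
  obtain d0 where d0: "d0 \<in> D" using \<open>D \<noteq> {}\<close> by blast
  have "\<exists>s::'v \<Rightarrow>\<^sub>L real. \<forall>a. 0 \<sqsubseteq> a \<longrightarrow> s a = p a"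
  proof (rule cone_extension)
    show "p (a + b) = p a + p b" if "0 \<sqsubseteq> a" "0 \<sqsubseteq> b" for a b
      unfolding p_def by (rule directed_SUP_add[OF \<open>D \<noteq> {}\<close> directed bdd that])
    show "\<bar>p a\<bar> \<le> (norm h + norm d0) * norm a" if a: "0 \<sqsubseteq> a" for a
      using p_le[of a "h a", OF dual_orderD[OF bound a]] p_ge[OF d0 a] norm_blinfun[of h a] norm_blinfun[of d0 a]
      by (simp add: algebra_simps abs_le_iff)
  qed
  then obtain s :: "'v \<Rightarrow>\<^sub>L real" where s: "\<And>a. 0 \<sqsubseteq> a \<Longrightarrow> s a = p a" by blast
  show thesis
  proof (rule that)
    show "d \<preceq> s" if "d \<in> D" for d using p_ge[OF that] s by (simp add: dual_order_def)
    show "s \<preceq> g" if "\<And>d. d \<in> D \<Longrightarrow> d \<preceq> g" for g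
      using dual_orderD[OF that] s by (auto intro!: dual_orderI p_le)
    show "\<exists>d\<in>D. s a < d a + \<eta>" if "0 \<sqsubseteq> a" "0 < \<eta>" for a \<eta>
      using p_le[of a "p a - \<eta>"] s[OF that(1)] that(2) by force
  qed
qed

lemma decreasing_functionals_limit:
  fixes f :: "nat \<Rightarrow> ('v \<Rightarrow>\<^sub>L real)"
  assumes nonneg: "\<And>n. 0 \<preceq> f n" and dec: "\<And>n. f (Suc n) \<preceq> f n"
  obtains g where "0 \<preceq> g" "\<And>n. g \<preceq> f n" "\<And>a. (\<lambda>n. f n a) \<longlonglongrightarrow> blinfun_apply g a"
proof -
  define p where "p a = lim (\<lambda>n. f n a)" for a
  have decseq: "decseq (\<lambda>n. f n a)" if "0 \<sqsubseteq> a" for a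
    using dual_orderD[OF dec that] by (simp add: decseq_Suc_iff)
  have lim: "(\<lambda>n. f n a) \<longlonglongrightarrow> p a" if "0 \<sqsubseteq> a" for a
    using decseq_convergent[OF decseq[OF that]] dual_nonnegD[OF nonneg that]
    unfolding p_def by (metis limI)
  have p_le: "p a \<le> f n a" if "0 \<sqsubseteq> a" for a n
    using decseq_ge[OF decseq[OF that] lim[OF that]] .
  have p_nonneg: "0 \<le> p a" if "0 \<sqsubseteq> a" for a
    using LIMSEQ_le_const[OF lim[OF that]] dual_nonnegD[OF nonneg that] by blast
  have "\<exists>g::'v \<Rightarrow>\<^sub>L real. \<forall>a. 0 \<sqsubseteq> a \<longrightarrow> g a = p a"
  proof (rule cone_extension)
    show "p (a + b) = p a + p b" if "0 \<sqsubseteq> a" "0 \<sqsubseteq> b" for a b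
      using LIMSEQ_unique[OF lim[OF add_nonneg[OF that]]] tendsto_add[OF lim[OF that(1)] lim[OF that(2)]]
      by (simp add: blinfun.add_right)
    show "\<bar>p a\<bar> \<le> norm (f 0) * norm a" if "0 \<sqsubseteq> a" for a
      using p_nonneg[OF that] p_le[OF that, of 0] norm_blinfun[of "f 0" a] by simp
  qed
  then obtain g :: "'v \<Rightarrow>\<^sub>L real" where g: "\<And>a. 0 \<sqsubseteq> a \<Longrightarrow> g a = p a" by blast
  show thesis
  proof (rule that[of g])
    show "0 \<preceq> g" "g \<preceq> f n" for n using g p_nonneg p_le by (simp_all add: dual_order_def)
    show "(\<lambda>n. f n v) \<longlonglongrightarrow> g v" for v
    proof -
      obtain a b where ab: "v = a - b" "0 \<sqsubseteq> a" "0 \<sqsubseteq> b" using difference_of_nonneg by blast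
      have "(\<lambda>n. f n a - f n b) \<longlonglongrightarrow> p a - p b" by (intro tendsto_diff lim ab)
      then show ?thesis by (simp add: ab g blinfun.diff_right)
    qed
  qed
qed

lemma exists_minimal_functional:
  fixes A :: "('v \<Rightarrow>\<^sub>L real) set"
  assumes "A \<noteq> {}" and nonneg: "\<And>f. f \<in> A \<Longrightarrow> 0 \<preceq> f" and e: "0 \<sqsubseteq> e"
    and closed: "\<And>r g. (\<And>n. r n \<in> A) \<Longrightarrow> 0 \<preceq> g \<Longrightarrow> (\<And>n. g \<preceq> r n) \<Longrightarrow>
      (\<And>a. (\<lambda>n. blinfun_apply (r n) a) \<longlonglongrightarrow> blinfun_apply g a) \<Longrightarrow> g \<in> A"
  obtains g where "g \<in> A" "\<And>h. h \<in> A \<Longrightarrow> h \<preceq> g \<Longrightarrow> g e \<le> h e"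
proof -
  have "\<exists>r. \<forall>n. r n \<in> A \<and> (r (Suc n) \<preceq> r n \<and>
      (\<forall>h\<in>A. h \<preceq> r n \<longrightarrow> blinfun_apply (r (Suc n)) e \<le> blinfun_apply h e + (1 / 2) ^ n))"
  proof (rule dependent_nat_choice)
    show "\<exists>r. r \<in> A" using \<open>A \<noteq> {}\<close> by blast
    fix r and n :: nat assume r: "r \<in> A"
    define B where "B = {h \<in> A. h \<preceq> r}"
    have "B \<noteq> {}" using r by (auto simp: B_def)
    moreover have bdd: "bdd_below ((\<lambda>h. blinfun_apply h e) ` B)"
      using dual_nonnegD[OF nonneg e] by (auto simp: B_def bdd_below_def)
    moreover have "(INF h\<in>B. blinfun_apply h e) < (INF h\<in>B. blinfun_apply h e) + (1 / 2) ^ n" by simp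
    ultimately obtain r' where r': "r' \<in> B" "r' e < (INF h\<in>B. blinfun_apply h e) + (1 / 2) ^ n"
      using cINF_less_iff[OF _ bdd] by blast
    have "r' e \<le> h e + (1 / 2) ^ n" if "h \<in> A" "h \<preceq> r" for h
      using cINF_lower[OF bdd, of h] that r'(2) by (simp add: B_def)
    then show "\<exists>r'. r' \<in> A \<and> (r' \<preceq> r \<and>
        (\<forall>h\<in>A. h \<preceq> r \<longrightarrow> blinfun_apply r' e \<le> blinfun_apply h e + (1 / 2) ^ n))"
      using r'(1) by (auto simp: B_def)
  qed
  then obtain r where r: "\<And>n. r n \<in> A" "\<And>n. r (Suc n) \<preceq> r n"
    "\<And>n h. h \<in> A \<Longrightarrow> h \<preceq> r n \<Longrightarrow> blinfun_apply (r (Suc n)) e \<le> blinfun_apply h e + (1 / 2) ^ n" by blast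
  obtain g where g: "0 \<preceq> g" "\<And>n. g \<preceq> r n" "\<And>a. (\<lambda>n. r n a) \<longlonglongrightarrow> g a"
    using decreasing_functionals_limit[of r] nonneg r(1,2) by blast
  show thesis
  proof (rule that[OF closed[OF r(1) g]])
    fix h assume h: "h \<in> A" "h \<preceq> g"
    have "(\<lambda>n. h e + (1 / 2) ^ n) \<longlonglongrightarrow> h e + 0"
      by (intro tendsto_add tendsto_const LIMSEQ_realpow_zero) auto
    moreover have "g e \<le> h e + (1 / 2) ^ n" for n
      using order_trans[OF dual_orderD[OF g(2) e] r(3)[OF h(1) dual_trans[OF h(2) g(2)]]] .
    ultimately show "g e \<le> h e" using LIMSEQ_le_const by fastforce
  qed
qed

end

section \<open>Biduals\<close>

locale riesz_bidual = riesz_normed_space le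
  for le :: "'v::real_normed_vector \<Rightarrow> 'v \<Rightarrow> bool" (infix "\<sqsubseteq>" 50)

sublocale riesz_bidual \<subseteq> dual: riesz_normed_space dual_order
  by (rule dual_riesz_normed_space)

context riesz_bidual
begin

notation dual.dual_order (infix "\<preceq>\<^sup>*" 50)

lemma evaluation_nonneg: "0 \<sqsubseteq> x \<Longrightarrow> 0 \<preceq>\<^sup>* evaluation x"
  by (simp add: dual.dual_order_def dual_nonnegD)

lemma abs_bidual_le_modulus:
  fixes \<psi> :: "('v \<Rightarrow>\<^sub>L real) \<Rightarrow>\<^sub>L real"
  shows "\<bar>\<psi> f\<bar> \<le> dual.modulus \<psi> (modulus f)"
proof -
  have "f = pos_part f - pos_part (- f)" by (simp add: pos_part_uminus)
  then have "\<psi> f = \<psi> (pos_part f) - \<psi> (pos_part (- f))" by (metis blinfun.diff_right)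
  then show ?thesis
    using dual.abs_le_modulus[OF pos_part_nonneg, of \<psi> f] dual.abs_le_modulus[OF pos_part_nonneg, of \<psi> "- f"]
    by (simp add: modulus_def blinfun.add_right)
qed

lemma dual_term_le_suminf:
  fixes g :: "nat \<Rightarrow> ('v \<Rightarrow>\<^sub>L real)"
  assumes "summable g" "\<And>n. 0 \<preceq> g n"
  shows "g n \<preceq> suminf g"
proof (rule dual_orderI)
  fix x assume x: "0 \<sqsubseteq> x"
  have lin: "bounded_linear (\<lambda>f. blinfun_apply f x)" by (rule blinfun.bounded_linear_left)
  have "sum (\<lambda>n. g n x) {n} \<le> (\<Sum>n. g n x)"
    using dual_nonnegD[OF assms(2) x]
    by (intro sum_le_suminf bounded_linear.summable[OF lin assms(1)]) auto
  then show "g n x \<le> suminf g x"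
    using bounded_linear.suminf[OF lin assms(1)] by simp
qed

lemma geometric_majorant:
  fixes a :: "nat \<Rightarrow> ('v \<Rightarrow>\<^sub>L real)"
  assumes "\<And>n. 0 \<preceq> a n" "\<And>n. norm (a n) \<le> B"
  obtains e where "0 \<preceq> e" "\<And>n. (1 / 2) ^ n *\<^sub>R a n \<preceq> e"
proof -
  have "(1 / 2) ^ n *\<^sub>R a n \<preceq> (\<Sum>n. (1 / 2) ^ n *\<^sub>R a n)" for n
    using assms(1) by (intro dual_term_le_suminf summable_geometric_scaleR[OF assms(2)] dual_scale_nonneg) auto
  moreover from this[of 0] have "0 \<preceq> (\<Sum>n. (1 / 2) ^ n *\<^sub>R a n)"
    using dual_trans[OF assms(1)[of 0]] by simp
  ultimately show thesis using that by blast
qed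

subsection \<open>Disjoint minorants of a sequence that is not equi-integrable\<close>

definition equi_integrable ::
    "(('v \<Rightarrow>\<^sub>L real) \<Rightarrow>\<^sub>L real) \<Rightarrow> ('v \<Rightarrow>\<^sub>L real) \<Rightarrow> (nat \<Rightarrow> ('v \<Rightarrow>\<^sub>L real)) \<Rightarrow> bool" where
  "equi_integrable \<phi> e a \<longleftrightarrow>
    (\<forall>\<epsilon>>0. \<exists>K\<ge>0. \<forall>n. blinfun_apply \<phi> (pos_part (a n - K *\<^sub>R e)) \<le> \<epsilon>)"

lemma excess_over_partial_sums:
  fixes a :: "nat \<Rightarrow> ('v \<Rightarrow>\<^sub>L real)"
  assumes a: "\<And>n. 0 \<preceq> a n" "\<And>n. a n \<preceq> C n *\<^sub>R e" "\<And>n. 0 \<le> C n"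
    and \<phi>: "0 \<preceq>\<^sup>* \<phi>" and "0 < \<epsilon>"
    and excess: "\<And>K. 0 \<le> K \<Longrightarrow> \<exists>n. \<epsilon> < \<phi> (pos_part (a n - K *\<^sub>R e))"
  obtains n where "strict_mono n"
    "\<And>j. \<epsilon> < \<phi> (pos_part (a (n (Suc j)) - 4 ^ j *\<^sub>R (\<Sum>m\<le>n j. a m)))"
proof -
  define s where "s n = (\<Sum>m\<le>n. a m)" for n
  have s_le: "s n \<preceq> (\<Sum>m\<le>n. C m) *\<^sub>R e" for n
    using dual_orderD[OF a(2)]
    by (auto simp: s_def dual_order_def blinfun.sum_left blinfun.scaleR_left sum_distrib_right intro: sum_mono)
  have a_le_s: "a m \<preceq> 4 ^ j *\<^sub>R s n" if "m \<le> n" for m n j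
  proof (rule dual_orderI)
    fix x assume x: "0 \<sqsubseteq> x"
    have "sum (\<lambda>i. a i x) {m} \<le> (\<Sum>i\<le>n. a i x)"
      using dual_nonnegD[OF a(1) x] that by (intro sum_mono2) auto
    also have "\<dots> \<le> 4 ^ j * (\<Sum>i\<le>n. a i x)"
      using sum_nonneg[of "{..n}" "\<lambda>i. a i x"] dual_nonnegD[OF a(1) x]
      by (simp add: mult_le_cancel_right1)
    finally show "a m x \<le> (4 ^ j *\<^sub>R s n) x"
      by (simp add: s_def blinfun.sum_left blinfun.scaleR_left)
  qed
  have "\<exists>n. \<forall>j. True \<and> (n j < n (Suc j) \<and> \<epsilon> < \<phi> (pos_part (a (n (Suc j)) - 4 ^ j *\<^sub>R s (n j))))"
  proof (rule dependent_nat_choice)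
    fix n j :: nat
    let ?K = "4 ^ j * (\<Sum>m\<le>n. C m)"
    have "0 \<le> ?K" using a(3) by (simp add: sum_nonneg)
    then obtain n' where n': "\<epsilon> < \<phi> (pos_part (a n' - ?K *\<^sub>R e))" using excess by blast
    have "4 ^ j *\<^sub>R s n \<preceq> ?K *\<^sub>R e" using dual_scale_mono[OF s_le[of n], of "4 ^ j"] by simp
    then have "a n' - ?K *\<^sub>R e \<preceq> a n' - 4 ^ j *\<^sub>R s n" by (simp add: dual_order_def blinfun.diff_left)
    from dual.positive_functional_mono[OF \<phi> pos_part_mono[OF this]] n'
    have large: "\<epsilon> < \<phi> (pos_part (a n' - 4 ^ j *\<^sub>R s n))" by simp
    have "n < n'"
    proof (rule ccontr)
      assume "\<not> n < n'"
      then have "a n' - 4 ^ j *\<^sub>R s n \<preceq> 0"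
        using a_le_s[of n' n j] by (simp add: dual_order_def blinfun.diff_left)
      then show False using large \<open>0 < \<epsilon>\<close> by (simp add: pos_part_nonpos blinfun.zero_right)
    qed
    then show "\<exists>n'. True \<and> (n < n' \<and> \<epsilon> < \<phi> (pos_part (a n' - 4 ^ j *\<^sub>R s n)))" using large by blast
  qed simp
  then show thesis using that by (auto simp: s_def strict_mono_Suc_iff)
qed

lemma dual_disjoint_excess:
  fixes x s :: "nat \<Rightarrow> ('v \<Rightarrow>\<^sub>L real)" and X :: "'v \<Rightarrow>\<^sub>L real"
  defines "u \<equiv> \<lambda>j. pos_part (x j - 4 ^ j *\<^sub>R s j - (1 / 2) ^ j *\<^sub>R X)"
  assumes x: "\<And>j. 0 \<preceq> x j" "\<And>j. (1 / 2) ^ j *\<^sub>R x j \<preceq> X"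
    and s: "\<And>j. 0 \<preceq> s j" "\<And>i j. i < j \<Longrightarrow> x i \<preceq> s j" and "i < j"
  shows "dual_disjoint (u j) (u i)"
proof -
  define l :: real where "l = 2 ^ (i + j)"
  have "l \<le> 2 ^ (2 * j)" unfolding l_def using \<open>i < j\<close> by (intro power_increasing) auto
  then have l: "1 \<le> l" "l \<le> 4 ^ j" by (simp_all add: l_def power_mult)
  define g where "g = x j - l *\<^sub>R x i"
  have X: "0 \<preceq> X" using dual_trans[OF _ x(2)[of 0]] x(1)[of 0] by simp
  have "u j \<preceq> pos_part g"
    unfolding u_def
  proof (intro pos_part_mono dual_orderI)
    fix y assume y: "0 \<sqsubseteq> y"
    have "l * x i y \<le> 4 ^ j * s j y"
      using l dual_orderD[OF s(2)[OF \<open>i < j\<close>] y] dual_nonnegD[OF x(1) y] by (intro mult_mono) auto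
    moreover have "0 \<le> (1 / 2) ^ j * X y" using dual_nonnegD[OF X y] by simp
    ultimately show "(x j - 4 ^ j *\<^sub>R s j - (1 / 2) ^ j *\<^sub>R X) y \<le> g y"
      unfolding g_def blinfun.diff_left blinfun.scaleR_left real_scaleR_def by linarith
  qed
  moreover have "u i \<preceq> pos_part (x i - (1 / l) *\<^sub>R x j)"
    unfolding u_def
  proof (intro pos_part_mono dual_orderI)
    fix y assume y: "0 \<sqsubseteq> y"
    have "(1 / 2) ^ i * ((1 / 2) ^ j * x j y) \<le> (1 / 2) ^ i * X y"
      using dual_orderD[OF x(2) y, of j] by (simp add: blinfun.scaleR_left)
    then have "1 / l * x j y \<le> (1 / 2) ^ i * X y"
      by (simp add: l_def power_add power_one_over field_simps)
    moreover have "0 \<le> 4 ^ i * s i y" using dual_nonnegD[OF s(1) y] by simp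
    ultimately show "(x i - 4 ^ i *\<^sub>R s i - (1 / 2) ^ i *\<^sub>R X) y \<le> (x i - (1 / l) *\<^sub>R x j) y"
      unfolding blinfun.diff_left blinfun.scaleR_left real_scaleR_def by linarith
  qed
  moreover have "pos_part (x i - (1 / l) *\<^sub>R x j) \<preceq> pos_part (- g)"
    using pos_part_le_scale[OF l(1), of "x i - (1 / l) *\<^sub>R x j"] l(1) by (simp add: g_def scaleR_right_diff_distrib)
  ultimately show ?thesis
    using dual_disjoint_mono[OF dual_disjoint_pos_part pos_part_nonneg _ pos_part_nonneg] dual_trans
    unfolding u_def by blast
qed

lemma disjoint_minorants_of_excess:
  fixes x s :: "nat \<Rightarrow> ('v \<Rightarrow>\<^sub>L real)"
  assumes x: "\<And>j. 0 \<preceq> x j" "\<And>j. norm (x j) \<le> B" and s: "\<And>j. 0 \<preceq> s j" "\<And>i j. i < j \<Longrightarrow> x i \<preceq> s j"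
    and \<phi>: "0 \<preceq>\<^sup>* \<phi>" and "0 < \<epsilon>" and excess: "\<And>j. \<epsilon> < \<phi> (pos_part (x j - 4 ^ j *\<^sub>R s j))"
  shows "\<exists>N u. (\<forall>j. 0 \<preceq> u j \<and> u j \<preceq> x (j + N) \<and> \<epsilon> / 2 \<le> \<phi> (u j)) \<and>
    (\<forall>i j. i \<noteq> j \<longrightarrow> dual_disjoint (u i) (u j))"
proof -
  obtain X where X: "0 \<preceq> X" "\<And>j. (1 / 2) ^ j *\<^sub>R x j \<preceq> X"
    using geometric_majorant[of x B] x by blast
  define u where "u j = pos_part (x j - 4 ^ j *\<^sub>R s j - (1 / 2) ^ j *\<^sub>R X)" for j
  have disj: "dual_disjoint (u j) (u i)" if "i < j" for i j
    unfolding u_def by (rule dual_disjoint_excess[OF x(1) X(2) s that])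
  have u_le: "u j \<preceq> x j" for j
    unfolding u_def using dual_trans[OF dual_diff_le dual_diff_le] dual_scale_nonneg s(1) X(1)
    by (intro pos_part_least[OF x(1)]) simp
  have mass: "\<epsilon> - (1 / 2) ^ j * \<phi> X \<le> \<phi> (u j)" for j
  proof -
    have "pos_part (x j - 4 ^ j *\<^sub>R s j) \<preceq> u j + (1 / 2) ^ j *\<^sub>R X"
      unfolding u_def using X(1) by (intro pos_part_le_add_pos_part_diff dual_scale_nonneg) auto
    from dual.positive_functional_mono[OF \<phi> this] show ?thesis
      using excess[of j] by (simp add: blinfun.add_right blinfun.scaleR_right)
  qed
  have "(\<lambda>j. (1 / 2) ^ j * \<phi> X) \<longlonglongrightarrow> 0 * \<phi> X"
    by (intro tendsto_mult LIMSEQ_realpow_zero tendsto_const) auto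
  then obtain N where N: "\<And>j. j \<ge> N \<Longrightarrow> \<bar>(1 / 2) ^ j * \<phi> X\<bar> < \<epsilon> / 2"
    using LIMSEQ_D[of "\<lambda>j. (1 / 2) ^ j * \<phi> X" 0 "\<epsilon> / 2"] \<open>0 < \<epsilon>\<close> by auto
  show ?thesis
  proof (intro exI[of _ N] exI[of _ "\<lambda>j. u (j + N)"] conjI allI impI)
    show "0 \<preceq> u (j + N)" for j by (simp add: u_def pos_part_nonneg)
    show "u (j + N) \<preceq> x (j + N)" for j by (rule u_le)
    show "\<epsilon> / 2 \<le> \<phi> (u (j + N))" for j using mass[of "j + N"] N[of "j + N"] by linarith
    show "dual_disjoint (u (i + N)) (u (j + N))" if "i \<noteq> j" for i j
      using disj[of "i + N" "j + N"] disj[of "j + N" "i + N"] that dual_disjoint_commute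
      by (cases "i < j") auto
  qed
qed

lemma disjoint_minorants:
  fixes a :: "nat \<Rightarrow> ('v \<Rightarrow>\<^sub>L real)"
  assumes a: "\<And>n. 0 \<preceq> a n" "\<And>n. norm (a n) \<le> B" "\<And>n. a n \<preceq> C n *\<^sub>R e" "\<And>n. 0 \<le> C n"
    and e: "0 \<preceq> e" and \<phi>: "0 \<preceq>\<^sup>* \<phi>" and not_equi: "\<not> equi_integrable \<phi> e a"
  obtains \<epsilon> n u where "0 < \<epsilon>" "strict_mono (n :: nat \<Rightarrow> nat)" "\<And>j. 0 \<preceq> u j" "\<And>j. u j \<preceq> a (n j)"
    "\<And>j. \<epsilon> \<le> blinfun_apply \<phi> (u j)" "\<And>i j. i \<noteq> j \<Longrightarrow> dual_disjoint (u i) (u j)"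
proof -
  obtain \<epsilon> where \<epsilon>: "0 < \<epsilon>" and excess: "\<And>K. 0 \<le> K \<Longrightarrow> \<exists>n. \<epsilon> < \<phi> (pos_part (a n - K *\<^sub>R e))"
    using not_equi unfolding equi_integrable_def by (meson not_le)
  obtain n where n: "strict_mono n"
      "\<And>j. \<epsilon> < \<phi> (pos_part (a (n (Suc j)) - 4 ^ j *\<^sub>R (\<Sum>m\<le>n j. a m)))"
    using excess_over_partial_sums[OF a(1,3,4) \<phi> \<epsilon> excess] by blast
  have a_le_sum: "a (n (Suc i)) \<preceq> (\<Sum>m\<le>n j. a m)" if "i < j" for i j
  proof (rule dual_orderI)
    fix y assume y: "0 \<sqsubseteq> y"
    have "sum (\<lambda>m. a m y) {n (Suc i)} \<le> (\<Sum>m\<le>n j. a m y)"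
      using dual_nonnegD[OF a(1) y] that strict_mono_less_eq[OF n(1)] by (intro sum_mono2) auto
    then show "a (n (Suc i)) y \<le> (\<Sum>m\<le>n j. a m) y" by (simp add: blinfun.sum_left)
  qed
  have "\<exists>N u. (\<forall>j. 0 \<preceq> u j \<and> u j \<preceq> a (n (Suc (j + N))) \<and> \<epsilon> / 2 \<le> \<phi> (u j)) \<and>
      (\<forall>i j. i \<noteq> j \<longrightarrow> dual_disjoint (u i) (u j))"
    by (rule disjoint_minorants_of_excess[OF a(1,2) dual_sum_nonneg[OF a(1)] a_le_sum \<phi> \<epsilon> n(2)])
  then obtain N u where u: "\<And>j. 0 \<preceq> u j" "\<And>j. u j \<preceq> a (n (Suc (j + N)))" "\<And>j. \<epsilon> / 2 \<le> \<phi> (u j)"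
    "\<And>i j. i \<noteq> j \<Longrightarrow> dual_disjoint (u i) (u j)" by blast
  show thesis
  proof (rule that)
    show "0 < \<epsilon> / 2" using \<epsilon> by simp
    show "strict_mono (\<lambda>j. n (Suc (j + N)))" using n(1) by (simp add: strict_mono_def)
  qed (rule u; assumption)+
qed

subsection \<open>The component of a functional in an ideal\<close>

definition ideal_component :: "('v \<Rightarrow>\<^sub>L real) set \<Rightarrow> ('v \<Rightarrow>\<^sub>L real) \<Rightarrow> ('v \<Rightarrow>\<^sub>L real) \<Rightarrow> bool" where
  "ideal_component I e c \<longleftrightarrow> (\<forall>a\<in>I. a \<preceq> e \<longrightarrow> a \<preceq> c) \<and>
    (\<forall>x. 0 \<sqsubseteq> x \<longrightarrow> (\<forall>\<eta>>0. \<exists>a\<in>I. a \<preceq> e \<and> blinfun_apply c x < blinfun_apply a x + \<eta>))"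

lemma
  assumes "ideal_component I e c"
  shows ideal_component_upper: "a \<in> I \<Longrightarrow> a \<preceq> e \<Longrightarrow> a \<preceq> c"
    and ideal_component_approx:
      "0 \<sqsubseteq> x \<Longrightarrow> 0 < \<eta> \<Longrightarrow> \<exists>a\<in>I. a \<preceq> e \<and> blinfun_apply c x < blinfun_apply a x + \<eta>"
  using assms by (auto simp: ideal_component_def)

lemma ideal_component_least:
  assumes c: "ideal_component I e c" and h: "\<And>a. a \<in> I \<Longrightarrow> a \<preceq> e \<Longrightarrow> a \<preceq> h"
  shows "c \<preceq> h"
proof (rule dual_orderI, rule field_le_epsilon)
  fix x and \<eta> :: real assume x: "0 \<sqsubseteq> x" and "0 < \<eta>"
  then obtain a where "a \<in> I" "a \<preceq> e" "c x < a x + \<eta>" using ideal_component_approx[OF c] by blast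
  then show "c x \<le> h x + \<eta>" using dual_orderD[OF h x] by fastforce
qed

lemma ideal_component_le: "ideal_component I e c \<Longrightarrow> c \<preceq> e"
  by (rule ideal_component_least)

lemma ideal_component_nonneg:
  "dual.positive_ideal I \<Longrightarrow> 0 \<preceq> e \<Longrightarrow> ideal_component I e c \<Longrightarrow> 0 \<preceq> c"
  by (meson dual.positive_ideal_zero ideal_component_upper)

lemma ideal_component_exists:
  assumes I: "dual.positive_ideal I" and e: "0 \<preceq> e"
  shows "\<exists>c. ideal_component I e c"
proof -
  define D where "D = {a \<in> I. a \<preceq> e}"
  have directed: "\<exists>d''\<in>D. d \<preceq> d'' \<and> d' \<preceq> d''" if d: "d \<in> D" "d' \<in> D" for d d'
  proof (rule bexI[of _ "dual_sup d d'"])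
    have nonneg: "0 \<preceq> d" "0 \<preceq> d'" using d dual.positive_ideal_nonneg[OF I] by (auto simp: D_def)
    have "dual_sup d d' \<preceq> d + d'"
      using nonneg by (intro dual_sup_least) (simp_all add: dual_order_def blinfun.add_left)
    then show "dual_sup d d' \<in> D"
      using d dual.positive_ideal_solid[OF I dual.positive_ideal_add[OF I, of d d']]
        dual_trans[OF nonneg(1) dual_sup_upper1, of d'] dual_sup_least[of d e d']
      by (simp add: D_def)
  qed (simp add: dual_sup_upper1 dual_sup_upper2)
  show ?thesis
  proof (rule directed_sup[of D e])
    show "D \<noteq> {}" using dual.positive_ideal_zero[OF I] e by (auto simp: D_def)
    fix s assume "\<And>d. d \<in> D \<Longrightarrow> d \<preceq> s" "\<And>a \<eta>. 0 \<sqsubseteq> a \<Longrightarrow> 0 < \<eta> \<Longrightarrow> \<exists>d\<in>D. s a < d a + \<eta>"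
    then have "ideal_component I e s" unfolding ideal_component_def D_def by blast
    then show ?thesis ..
  qed (use directed in \<open>auto simp: D_def\<close>)
qed

lemma ideal_component_disjoint:
  assumes I: "dual.positive_ideal I" and e: "0 \<preceq> e" and c: "ideal_component I e c"
  shows "dual_disjoint c (e - c)"
proof -
  have no_increment: "v = 0" if v: "v \<in> I" "v \<preceq> e - c" for v
  proof -
    have "c \<preceq> c - v"
    proof (rule ideal_component_least[OF c])
      fix a assume a: "a \<in> I" "a \<preceq> e"
      have "a + v \<preceq> e"
        using dual_orderD[OF ideal_component_upper[OF c a]] dual_orderD[OF v(2)]
        by (fastforce simp: dual_order_def blinfun.bilinear_simps)
      then have "a + v \<preceq> c" by (rule ideal_component_upper[OF c dual.positive_ideal_add[OF I a(1) v(1)]])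
      then show "a \<preceq> c - v" by (simp add: dual_order_def blinfun.bilinear_simps le_diff_eq)
    qed
    then have "v \<preceq> 0" by (simp add: dual_order_def blinfun.bilinear_simps)
    then show ?thesis using dual.positive_ideal_nonneg[OF I v(1)] by (rule dual_antisym)
  qed
  show ?thesis
  proof (rule dual_disjointI)
    show "0 \<preceq> c" by (rule ideal_component_nonneg[OF I e c])
    show "0 \<preceq> e - c" using ideal_component_le[OF c] by simp
    fix w assume w: "0 \<preceq> w" "w \<preceq> c" "w \<preceq> e - c"
    have "c \<preceq> c - w"
    proof (rule ideal_component_least[OF c])
      fix a assume a: "a \<in> I" "a \<preceq> e"
      have "0 \<preceq> a" "0 \<preceq> c - a" "w \<preceq> a + (c - a)"
        using dual.positive_ideal_nonneg[OF I a(1)] ideal_component_upper[OF c a] w(2) by simp_all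
      then obtain w1 w2 where ww: "w = w1 + w2" "0 \<preceq> w1" "w1 \<preceq> a" "0 \<preceq> w2" "w2 \<preceq> c - a"
        using dual_riesz_decomposition w(1) by blast
      have "w1 \<preceq> w" using ww(1,4) by (simp add: dual_order_def blinfun.add_left)
      then have "w1 = 0"
        using no_increment[OF dual.positive_ideal_solid[OF I a(1) ww(2,3)] dual_trans[OF _ w(3)]] by simp
      then show "a \<preceq> c - w"
        using ww(1,5) by (simp add: dual_order_def blinfun.diff_left le_diff_eq add.commute)
    qed
    then have "w \<preceq> 0" by (simp add: dual_order_def blinfun.diff_left)
    then show "w = 0" using w(1) by (rule dual_antisym)
  qed
qed

lemma ideal_sup_eq_on_component:
  assumes I: "dual.positive_ideal I" and c: "ideal_component I e c" and x: "0 \<sqsubseteq> x" and h: "0 \<preceq> h" "h \<preceq> c"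
  shows "dual.ideal_sup I (evaluation x) h = h x"
proof (rule antisym)
  show "dual.ideal_sup I (evaluation x) h \<le> h x"
    using dual_orderD x by (intro dual.ideal_sup_least[OF I h(1)]) auto
  show "h x \<le> dual.ideal_sup I (evaluation x) h"
  proof (rule field_le_epsilon)
    fix \<eta> :: real assume "0 < \<eta>"
    then obtain a where a: "a \<in> I" "a \<preceq> e" "c x < a x + \<eta>" using ideal_component_approx[OF c x] by blast
    have "0 \<preceq> a" "0 \<preceq> c - a" "h \<preceq> a + (c - a)"
      using dual.positive_ideal_nonneg[OF I a(1)] ideal_component_upper[OF c a(1,2)] h(2) by simp_all
    then obtain h1 h2 where hh: "h = h1 + h2" "0 \<preceq> h1" "h1 \<preceq> a" "0 \<preceq> h2" "h2 \<preceq> c - a"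
      using dual_riesz_decomposition h(1) by blast
    have "h1 \<preceq> h" using hh(1,4) by (simp add: dual_order_def blinfun.add_left)
    then have "h1 x \<le> dual.ideal_sup I (evaluation x) h"
      using dual.ideal_sup_upper[OF I h(1) dual.positive_ideal_solid[OF I a(1) hh(2,3)], of "evaluation x"] by simp
    moreover have "h2 x \<le> \<eta>" using dual_orderD[OF hh(5) x] a(3) by (simp add: blinfun.diff_left)
    ultimately show "h x \<le> dual.ideal_sup I (evaluation x) h + \<eta>"
      by (simp add: hh(1) blinfun.add_left)
  qed
qed

lemma ideal_sup_eq_0_off_component:
  fixes \<psi> :: "('v \<Rightarrow>\<^sub>L real) \<Rightarrow>\<^sub>L real"
  assumes I: "dual.positive_ideal I" and e: "0 \<preceq> e" and c: "ideal_component I e c" and h: "0 \<preceq> h" "h \<preceq> e - c"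
  shows "dual.ideal_sup I \<psi> h = 0"
proof -
  have vanish: "b = 0" if b: "b \<in> I" "b \<preceq> h" for b
  proof (rule dual_disjointD[OF ideal_component_disjoint[OF I e c]])
    show "0 \<preceq> b" using dual.positive_ideal_nonneg[OF I b(1)] .
    show "b \<preceq> e - c" using dual_trans[OF b(2) h(2)] .
    also have "e - c \<preceq> e" using ideal_component_nonneg[OF I e c] by (simp add: dual_order_def blinfun.diff_left)
    finally show "b \<preceq> c" using ideal_component_upper[OF c b(1)] by simp
  qed
  show ?thesis
  proof (rule antisym)
    show "dual.ideal_sup I \<psi> h \<le> 0"
    proof (rule dual.ideal_sup_least[OF I h(1)])
      show "\<psi> b \<le> 0" if "b \<in> I" "b \<preceq> h" for b
        using vanish[OF that] by (simp add: blinfun.zero_right)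
    qed
    show "0 \<le> dual.ideal_sup I \<psi> h"
      by (rule dual.dual_nonnegD[OF dual.ideal_sup_nonneg[OF I] h(1)])
  qed
qed

lemma modulus_ideal_sup_diff_evaluation_le:
  assumes I: "dual.positive_ideal I" and e: "0 \<preceq> e" and c: "ideal_component I e c" and y: "0 \<sqsubseteq> y" "y \<sqsubseteq> x"
  shows "dual.modulus (dual.ideal_sup I (evaluation x) - evaluation y) e \<le> c (x - y) + (e - c) y"
proof -
  let ?\<kappa> = "dual.ideal_sup I (evaluation x)"
  have x: "0 \<sqsubseteq> x" using y by (rule le_trans)
  have xy: "0 \<sqsubseteq> x - y" using y(2) le_iff_diff_nonneg by blast
  have "(?\<kappa> - evaluation y) h \<le> c (x - y) \<and> (evaluation y - ?\<kappa>) h \<le> (e - c) y"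
    if h: "0 \<preceq> h" "h \<preceq> e" for h
  proof -
    have "h \<preceq> c + (e - c)" using h(2) by simp
    then obtain h1 h2 where hh: "h = h1 + h2" "0 \<preceq> h1" "h1 \<preceq> c" "0 \<preceq> h2" "h2 \<preceq> e - c"
      using dual_riesz_decomposition[of c "e - c" h] ideal_component_nonneg[OF I e c]
        ideal_component_le[OF c] h(1) by auto
    have "?\<kappa> h = h1 x"
      using ideal_sup_eq_on_component[OF I c x hh(2,3)] ideal_sup_eq_0_off_component[OF I e c hh(4,5)]
      by (simp add: hh(1) blinfun.add_right)
    then have "(?\<kappa> - evaluation y) h = h1 (x - y) - h2 y"
      by (simp add: hh(1) blinfun.bilinear_simps)
    moreover have "0 \<le> h1 (x - y)" "h1 (x - y) \<le> c (x - y)" "0 \<le> h2 y" "h2 y \<le> (e - c) y"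
      using dual_nonnegD[OF hh(2) xy] dual_orderD[OF hh(3) xy] dual_nonnegD[OF hh(4) y(1)]
        dual_orderD[OF hh(5) y(1)] .
    ultimately show ?thesis by (simp add: blinfun.diff_left)
  qed
  then show ?thesis
    unfolding dual.modulus_def blinfun.add_left minus_diff_eq
    by (intro add_mono dual.pos_part_apply_le[OF e]) blast+
qed

end

section \<open>Duals with order continuous norm\<close>

locale order_continuous_dual = riesz_bidual le
  for le :: "'v::real_normed_vector \<Rightarrow> 'v \<Rightarrow> bool" (infix "\<sqsubseteq>" 50) +
  assumes order_continuous: "order_continuous_norm dual_order"
begin

lemma order_continuous_functional:
  fixes \<phi> :: "('v \<Rightarrow>\<^sub>L real) \<Rightarrow>\<^sub>L real"
  assumes D: "downward_directed dual_order D" "is_glb dual_order D 0" and "0 < \<eta>"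
  shows "\<exists>d\<in>D. \<bar>\<phi> d\<bar> < \<eta>"
proof -
  have INF: "(INF d\<in>D. norm d) = 0"
    using order_continuous D by (simp add: order_continuous_norm_def)
  have "\<not> \<eta> / (norm \<phi> + 1) \<le> (INF d\<in>D. norm d)"
    unfolding INF using \<open>0 < \<eta>\<close> by (simp add: add_nonneg_pos not_le)
  then obtain d where d: "d \<in> D" "norm d < \<eta> / (norm \<phi> + 1)"
    using cINF_greatest[of D "\<eta> / (norm \<phi> + 1)" norm] D(1) by (force simp: downward_directed_def)
  have "\<bar>\<phi> d\<bar> \<le> norm \<phi> * norm d" using norm_blinfun[of \<phi> d] by simp
  also have "\<dots> \<le> (norm \<phi> + 1) * norm d" by (intro mult_right_mono) auto
  also have "\<dots> < \<eta>" using d(2) by (simp add: add_nonneg_pos pos_less_divide_eq mult.commute)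
  finally show ?thesis using d(1) by blast
qed

lemma decreasing_sequence_limit:
  fixes b :: "nat \<Rightarrow> ('v \<Rightarrow>\<^sub>L real)"
  assumes "\<And>n. 0 \<preceq> b n" and dec: "\<And>n. b (Suc n) \<preceq> b n"
  obtains c where "0 \<preceq> c" "\<And>n. c \<preceq> b n"
    "\<And>(\<phi> :: ('v \<Rightarrow>\<^sub>L real) \<Rightarrow>\<^sub>L real) \<eta>. 0 < \<eta> \<Longrightarrow> \<exists>n. \<bar>\<phi> (b n - c)\<bar> < \<eta>"
proof -
  obtain c where c: "0 \<preceq> c" "\<And>n. c \<preceq> b n" "\<And>x. (\<lambda>n. b n x) \<longlonglongrightarrow> blinfun_apply c x"
    using decreasing_functionals_limit[of b] assms by blast
  have anti: "b n \<preceq> b m" if "m \<le> n" for m n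
    using that by (induction rule: dec_induct) (auto intro: dual_trans[OF dec])
  define D where "D = range (\<lambda>n. b n - c)"
  have "downward_directed dual_order D"
    unfolding downward_directed_def
  proof (intro conjI ballI)
    show "D \<noteq> {}" by (simp add: D_def)
    fix p q assume "p \<in> D" "q \<in> D"
    then obtain m n where mn: "p = b m - c" "q = b n - c" by (auto simp: D_def)
    have "b (max m n) - c \<in> D" "b (max m n) - c \<preceq> p" "b (max m n) - c \<preceq> q"
      using anti[of m "max m n"] anti[of n "max m n"] mn
      by (auto simp: D_def dual_order_def blinfun.diff_left)
    then show "\<exists>d\<in>D. d \<preceq> p \<and> d \<preceq> q" by blast
  qed
  moreover have "is_glb dual_order D 0"
    unfolding is_glb_def
  proof (intro conjI ballI allI impI)
    show "0 \<preceq> d" if "d \<in> D" for d using that c(2) by (auto simp: D_def)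
    fix w assume w: "\<forall>d\<in>D. w \<preceq> d"
    show "w \<preceq> 0"
    proof (rule dual_orderI)
      fix x assume x: "0 \<sqsubseteq> x"
      have "w x + c x \<le> b n x" for n
        using w dual_orderD[OF _ x, of w "b n - c"] by (simp add: D_def blinfun.diff_left)
      then have "w x + c x \<le> c x" using LIMSEQ_le_const[OF c(3)] by blast
      then show "w x \<le> blinfun_apply 0 x" by simp
    qed
  qed
  ultimately have "\<exists>n. \<bar>\<phi> (b n - c)\<bar> < \<eta>" if "0 < \<eta>" for \<phi> :: "('v \<Rightarrow>\<^sub>L real) \<Rightarrow>\<^sub>L real" and \<eta>
    using order_continuous_functional[OF _ _ that, of D \<phi>] by (auto simp: D_def)
  then show thesis using that c(1,2) by blast
qed

lemma decreasing_infima_small_complement: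
  fixes p :: "('v \<Rightarrow>\<^sub>L real) \<Rightarrow>\<^sub>L real"
  assumes p: "0 \<preceq>\<^sup>* p" and e: "0 \<preceq> e" and a: "\<And>n. 0 \<preceq> a n" "\<And>n. a n \<preceq> e"
    and mass: "\<And>n. p (e - a n) \<le> \<eta> * (1 / 2) ^ Suc n"
  obtains b where "\<And>n. 0 \<preceq> b n" "\<And>n. b n \<preceq> e" "\<And>n. b (Suc n) \<preceq> b n" "\<And>n. b (Suc n) \<preceq> a n"
    "\<And>n. p (e - b n) \<le> \<eta>"
proof -
  define b where "b = rec_nat e (\<lambda>n f. dual_inf f (a n))"
  have b: "b 0 = e" "\<And>n. b (Suc n) = dual_inf (b n) (a n)" by (simp_all add: b_def)
  have b_nonneg: "0 \<preceq> b n" for n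
    by (induction n) (simp_all add: b e a(1) dual_inf_greatest)
  have b_dec: "b (Suc n) \<preceq> b n" for n by (simp add: b dual_inf_lower1)
  have b_le: "b n \<preceq> e" for n
    by (induction n) (auto simp: b(1) intro: dual_trans[OF b_dec])
  have partial_mass: "p (e - b n) \<le> \<eta> * (1 - (1 / 2) ^ n)" for n
  proof (induction n)
    case 0
    then show ?case by (simp add: b blinfun.zero_right)
  next
    case (Suc n)
    have "pos_part (b n - a n) \<preceq> e - a n"
      using b_le[of n] a(2)[of n] by (intro pos_part_least) (simp_all add: dual_order_def blinfun.diff_left)
    from dual.positive_functional_mono[OF p this] mass[of n]
    have "p (pos_part (b n - a n)) \<le> \<eta> * (1 / 2) ^ Suc n" by linarith
    moreover have "e - b (Suc n) = (e - b n) + pos_part (b n - a n)" by (simp add: b dual_inf_def)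
    ultimately have "p (e - b (Suc n)) \<le> \<eta> * (1 - (1 / 2) ^ n) + \<eta> * (1 / 2) ^ Suc n"
      using Suc by (simp only: blinfun.add_right)
    also have "\<dots> = \<eta> * (1 - (1 / 2) ^ Suc n)" by (simp add: algebra_simps)
    finally show ?case .
  qed
  have "0 \<le> \<eta>" using mass[of 0] dual.dual_nonnegD[OF p, of "e - a 0"] a(2)[of 0] by simp
  then have "p (e - b n) \<le> \<eta>" for n
    using partial_mass[of n] mult_left_mono[of "1 - (1 / 2) ^ n" 1 \<eta>] by simp
  then show thesis using that[of b] b_nonneg b_le b_dec by (simp add: b dual_inf_lower2)
qed

lemma disjoint_functionals_exact_split:
  fixes p m :: "('v \<Rightarrow>\<^sub>L real) \<Rightarrow>\<^sub>L real"
  assumes p: "0 \<preceq>\<^sup>* p" and m: "0 \<preceq>\<^sup>* m" and disj: "dual.dual_disjoint p m" and e: "0 \<preceq> e" and "0 < \<eta>"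
  obtains c where "0 \<preceq> c" "c \<preceq> e" "m c = 0" "p (e - c) \<le> \<eta>"
proof -
  have "\<exists>a. 0 \<preceq> a \<and> a \<preceq> e \<and> p (e - a) + m a < \<eta> / 2 * (1 / 2) ^ Suc n" for n
    by (rule dual.dual_disjoint_split[OF disj e, of "\<eta> / 2 * (1 / 2) ^ Suc n"]) (use \<open>0 < \<eta>\<close> in auto)
  then obtain a where a: "\<And>n. 0 \<preceq> a n" "\<And>n. a n \<preceq> e"
    and split: "\<And>n. p (e - a n) + m (a n) < \<eta> / 2 * (1 / 2) ^ Suc n"
    by metis
  have p_a: "p (e - a n) \<le> \<eta> / 2 * (1 / 2) ^ Suc n" and m_a: "m (a n) \<le> \<eta> / 2 * (1 / 2) ^ Suc n" for n
    using split[of n] dual.dual_nonnegD[OF p, of "e - a n"] dual.dual_nonnegD[OF m a(1)[of n]] a(2)[of n]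
    by simp_all
  obtain b where b: "\<And>n. 0 \<preceq> b n" "\<And>n. b n \<preceq> e" "\<And>n. b (Suc n) \<preceq> b n" "\<And>n. b (Suc n) \<preceq> a n"
    and p_b: "\<And>n. p (e - b n) \<le> \<eta> / 2"
    by (rule decreasing_infima_small_complement[OF p e a p_a]) (rule that; assumption)
  obtain c where c: "0 \<preceq> c" "\<And>n. c \<preceq> b n"
    "\<And>(\<phi> :: ('v \<Rightarrow>\<^sub>L real) \<Rightarrow>\<^sub>L real) \<eta>. 0 < \<eta> \<Longrightarrow> \<exists>n. \<bar>\<phi> (b n - c)\<bar> < \<eta>"
    using decreasing_sequence_limit[of b] b(1,3) by blast
  show thesis
  proof (rule that)
    show "0 \<preceq> c" by (rule c)
    show "c \<preceq> e" by (rule dual_trans[OF c(2) b(2)])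
    have "m c \<le> \<eta> / 2 * (1 / 2) ^ Suc n" for n
      using dual.positive_functional_mono[OF m dual_trans[OF c(2) b(4)]] m_a by (rule order_trans)
    moreover have "(\<lambda>n. \<eta> / 2 * (1 / 2) ^ Suc n) \<longlonglongrightarrow> \<eta> / 2 * 0"
      by (intro tendsto_mult tendsto_const LIMSEQ_Suc[OF LIMSEQ_realpow_zero]) auto
    ultimately have "m c \<le> 0" using LIMSEQ_le_const by fastforce
    then show "m c = 0" using dual.dual_nonnegD[OF m c(1)] by simp
    obtain n where n: "\<bar>p (b n - c)\<bar> < \<eta> / 2" using c(3) \<open>0 < \<eta>\<close> half_gt_zero by blast
    have "p (e - c) = p (e - b n) + p (b n - c)" by (simp add: blinfun.diff_right)
    also have "\<dots> \<le> \<eta>" using p_b[of n] n by linarith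
    finally show "p (e - c) \<le> \<eta>" .
  qed
qed

end

section \<open>Weak convergence of equi-integrable weak* null sequences\<close>

locale equi_integrable_null_sequence = order_continuous_dual le
  for le :: "'v::real_normed_vector \<Rightarrow> 'v \<Rightarrow> bool" (infix "\<sqsubseteq>" 50) +
  fixes f :: "nat \<Rightarrow> ('v \<Rightarrow>\<^sub>L real)" and e :: "'v \<Rightarrow>\<^sub>L real"
  assumes weak_star_null: "(\<lambda>n. blinfun_apply (f n) x) \<longlonglongrightarrow> 0"
    and e_nonneg: "0 \<preceq> e"
    and dominated: "\<exists>C\<ge>0. modulus (f n) \<preceq> C *\<^sub>R e"
    and equi: "0 \<preceq>\<^sup>* \<psi> \<Longrightarrow> equi_integrable \<psi> e (\<lambda>n. modulus (f n))"
begin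

lemma tends_to_0_approximation:
  fixes \<phi> \<tau> :: "('v \<Rightarrow>\<^sub>L real) \<Rightarrow>\<^sub>L real"
  assumes \<tau>: "0 \<preceq>\<^sup>* \<tau>" and approx: "\<And>\<eta>. 0 < \<eta> \<Longrightarrow> \<exists>\<psi>. (\<lambda>n. blinfun_apply \<psi> (f n)) \<longlonglongrightarrow> 0 \<and>
      dual.modulus (\<phi> - \<psi>) \<preceq>\<^sup>* \<tau> \<and> dual.modulus (\<phi> - \<psi>) e \<le> \<eta>"
  shows "(\<lambda>n. \<phi> (f n)) \<longlonglongrightarrow> 0"
proof (rule LIMSEQ_I)
  fix \<zeta> :: real assume \<zeta>: "0 < \<zeta>"
  obtain K where K: "0 \<le> K" "\<And>n. \<tau> (pos_part (modulus (f n) - K *\<^sub>R e)) \<le> \<zeta> / 4"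
    using equi[OF \<tau>, unfolded equi_integrable_def, rule_format, of "\<zeta> / 4"] \<zeta> by auto
  obtain \<psi> where \<psi>: "(\<lambda>n. blinfun_apply \<psi> (f n)) \<longlonglongrightarrow> 0" "dual.modulus (\<phi> - \<psi>) \<preceq>\<^sup>* \<tau>"
      "dual.modulus (\<phi> - \<psi>) e \<le> \<zeta> / (4 * (K + 1))"
    using approx[of "\<zeta> / (4 * (K + 1))"] \<zeta> K(1) by auto
  have small: "\<bar>(\<phi> - \<psi>) (f n)\<bar> \<le> \<zeta> / 2" for n
  proof -
    let ?m = "dual.modulus (\<phi> - \<psi>)" and ?r = "pos_part (modulus (f n) - K *\<^sub>R e)"
    have "modulus (f n) \<preceq> K *\<^sub>R e + ?r"
      using pos_part_ge[of "modulus (f n) - K *\<^sub>R e"]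
      by (simp add: dual_order_def blinfun.bilinear_simps algebra_simps)
    then have "\<bar>(\<phi> - \<psi>) (f n)\<bar> \<le> ?m (K *\<^sub>R e + ?r)"
      by (rule order_trans[OF abs_bidual_le_modulus dual.positive_functional_mono[OF dual.modulus_nonneg]])
    also have "\<dots> = K * ?m e + ?m ?r" by (simp add: blinfun.add_right blinfun.scaleR_right)
    also have "K * ?m e \<le> K * (\<zeta> / (4 * (K + 1)))" using \<psi>(3) K(1) by (rule mult_left_mono)
    also have "\<dots> \<le> \<zeta> / 4" using K(1) \<zeta> by (simp add: field_simps)
    also have "?m ?r \<le> \<zeta> / 4"
      using dual.dual_orderD[OF \<psi>(2) pos_part_nonneg] K(2)[of n] by (rule order_trans)
    finally show ?thesis by simp
  qed
  obtain N where N: "\<And>n. n \<ge> N \<Longrightarrow> \<bar>\<psi> (f n)\<bar> < \<zeta> / 2"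
    using LIMSEQ_D[OF \<psi>(1), of "\<zeta> / 2"] \<zeta> by auto
  have "norm (\<phi> (f n) - 0) < \<zeta>" if "n \<ge> N" for n
    using N[OF that] small[of n] unfolding blinfun.diff_left real_norm_def by linarith
  then show "\<exists>N. \<forall>n\<ge>N. norm (\<phi> (f n) - 0) < \<zeta>" by blast
qed

lemma ideal_sup_evaluation_tends_to_0:
  assumes I: "dual.positive_ideal I" and x: "0 \<sqsubseteq> x"
  shows "(\<lambda>n. dual.ideal_sup I (evaluation x) (f n)) \<longlonglongrightarrow> 0"
proof (rule tends_to_0_approximation[OF evaluation_nonneg[OF x]])
  let ?\<kappa> = "dual.ideal_sup I (evaluation x)"
  fix \<eta> :: real assume "0 < \<eta>"
  obtain c where c: "ideal_component I e c" using ideal_component_exists[OF I e_nonneg] by blast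
  obtain y where y: "0 \<sqsubseteq> y" "y \<sqsubseteq> x" "c (x - y) + (e - c) y < \<eta>"
    using dual_disjoint_split[OF ideal_component_disjoint[OF I e_nonneg c] x \<open>0 < \<eta>\<close>] by blast
  have "dual.modulus (?\<kappa> - evaluation y) e \<le> \<eta>"
    using modulus_ideal_sup_diff_evaluation_le[OF I e_nonneg c y(1,2)] y(3) by linarith
  moreover have "dual.modulus (?\<kappa> - evaluation y) \<preceq>\<^sup>* evaluation x"
  proof (rule dual.modulus_diff_le)
    show "0 \<preceq>\<^sup>* ?\<kappa>" by (rule dual.ideal_sup_nonneg[OF I])
    show "?\<kappa> \<preceq>\<^sup>* evaluation x"
      using dual_orderD x by (intro dual.dual_orderI dual.ideal_sup_least[OF I]) auto
    show "0 \<preceq>\<^sup>* evaluation y" by (rule evaluation_nonneg[OF y(1)])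
    show "evaluation y \<preceq>\<^sup>* evaluation x"
      using positive_functional_mono y(2) by (auto intro: dual.dual_orderI)
  qed
  ultimately show "\<exists>\<psi>. (\<lambda>n. blinfun_apply \<psi> (f n)) \<longlonglongrightarrow> 0 \<and>
      dual.modulus (?\<kappa> - \<psi>) \<preceq>\<^sup>* evaluation x \<and> dual.modulus (?\<kappa> - \<psi>) e \<le> \<eta>"
    using weak_star_null[of y] by (intro exI[of _ "evaluation y"]) simp
qed

text \<open>What is left of \<open>\<phi>\<close> after removing positive functionals that vanish asymptotically along \<open>f\<close>.
  A minimal remainder is singular to every element of the space, hence vanishes at \<open>e\<close> by order continuity.\<close>

definition remainders :: "(('v \<Rightarrow>\<^sub>L real) \<Rightarrow>\<^sub>L real) \<Rightarrow> (('v \<Rightarrow>\<^sub>L real) \<Rightarrow>\<^sub>L real) set" where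
  "remainders \<phi> = {\<rho>. 0 \<preceq>\<^sup>* \<rho> \<and> \<rho> \<preceq>\<^sup>* \<phi> \<and> (\<lambda>n. blinfun_apply (\<phi> - \<rho>) (f n)) \<longlonglongrightarrow> 0}"

definition minimal_remainder :: "(('v \<Rightarrow>\<^sub>L real) \<Rightarrow>\<^sub>L real) \<Rightarrow> (('v \<Rightarrow>\<^sub>L real) \<Rightarrow>\<^sub>L real) \<Rightarrow> bool" where
  "minimal_remainder \<phi> \<rho> \<longleftrightarrow> \<rho> \<in> remainders \<phi> \<and>
    (\<forall>\<rho>'\<in>remainders \<phi>. \<rho>' \<preceq>\<^sup>* \<rho> \<longrightarrow> blinfun_apply \<rho> e \<le> blinfun_apply \<rho>' e)"

lemma
  assumes "minimal_remainder \<phi> \<rho>"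
  shows minimal_remainder_nonneg: "0 \<preceq>\<^sup>* \<rho>"
    and minimal_remainder_le: "\<rho> \<preceq>\<^sup>* \<phi>"
    and minimal_remainder_tends_to_0: "(\<lambda>n. blinfun_apply (\<phi> - \<rho>) (f n)) \<longlonglongrightarrow> 0"
    and minimal_remainder_minimal: "\<rho>' \<in> remainders \<phi> \<Longrightarrow> \<rho>' \<preceq>\<^sup>* \<rho> \<Longrightarrow> blinfun_apply \<rho> e \<le> blinfun_apply \<rho>' e"
  using assms by (auto simp: minimal_remainder_def remainders_def)

lemma minimal_remainder_exists:
  assumes \<phi>: "0 \<preceq>\<^sup>* \<phi>"
  shows "\<exists>\<rho>. minimal_remainder \<phi> \<rho>"
proof (rule dual.exists_minimal_functional[of "remainders \<phi>" e])
  have "\<phi> \<in> remainders \<phi>" using \<phi> by (simp add: remainders_def)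
  then show "remainders \<phi> \<noteq> {}" by blast
  show "0 \<preceq>\<^sup>* \<rho>" if "\<rho> \<in> remainders \<phi>" for \<rho> using that by (simp add: remainders_def)
  fix r g assume r: "\<And>n. r n \<in> remainders \<phi>" and g: "0 \<preceq>\<^sup>* g" "\<And>n. g \<preceq>\<^sup>* r n"
    and lim: "\<And>a. (\<lambda>n. blinfun_apply (r n) a) \<longlonglongrightarrow> blinfun_apply g a"
  have "(\<lambda>n. (\<phi> - g) (f n)) \<longlonglongrightarrow> 0"
  proof (rule tends_to_0_approximation[OF \<phi>])
    fix \<eta> :: real assume "0 < \<eta>"
    then obtain k where "norm (r k e - g e) < \<eta>" using LIMSEQ_D[OF lim] by blast
    moreover have "dual.modulus ((\<phi> - g) - (\<phi> - r k)) = r k - g"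
      using g(2)[of k] by (simp add: dual.modulus_of_nonneg)
    moreover have "r k - g \<preceq>\<^sup>* \<phi>"
      using dual.dual_trans[OF dual.dual_diff_le[OF g(1)]] r[of k] by (simp add: remainders_def)
    ultimately show "\<exists>\<psi>. (\<lambda>n. blinfun_apply \<psi> (f n)) \<longlonglongrightarrow> 0 \<and>
        dual.modulus ((\<phi> - g) - \<psi>) \<preceq>\<^sup>* \<phi> \<and> dual.modulus ((\<phi> - g) - \<psi>) e \<le> \<eta>"
      using r[of k] by (intro exI[of _ "\<phi> - r k"]) (simp add: remainders_def blinfun.diff_left)
  qed
  moreover have "g \<preceq>\<^sup>* \<phi>" using dual.dual_trans[OF g(2)[of 0]] r[of 0] by (simp add: remainders_def)
  ultimately show "g \<in> remainders \<phi>" using g(1) by (simp add: remainders_def)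
qed (use e_nonneg in \<open>auto simp: minimal_remainder_def\<close>)

lemma minimal_remainder_dominates_no_evaluation:
  assumes \<rho>: "minimal_remainder \<phi> \<rho>" and x: "0 \<sqsubseteq> x" and a: "0 \<preceq> a" "a \<preceq> e"
    and dom: "\<And>b. 0 \<preceq> b \<Longrightarrow> b \<preceq> a \<Longrightarrow> blinfun_apply b x \<le> \<rho> b"
  shows "blinfun_apply a x = 0"
proof -
  define I where "I = {a. 0 \<preceq> a \<and> (\<forall>b. 0 \<preceq> b \<longrightarrow> b \<preceq> a \<longrightarrow> evaluation x b \<le> \<rho> b)}"
  have I: "dual.positive_ideal I" unfolding I_def by (rule dual.positive_ideal_dominated)
  define \<kappa> where "\<kappa> = dual.ideal_sup I (evaluation x)"
  have \<kappa>_nonneg: "0 \<preceq>\<^sup>* \<kappa>" unfolding \<kappa>_def by (rule dual.ideal_sup_nonneg[OF I])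
  have \<kappa>_le: "\<kappa> \<preceq>\<^sup>* \<rho>"
  proof (rule dual.dual_orderI)
    fix g assume g: "0 \<preceq> g"
    show "\<kappa> g \<le> \<rho> g"
      unfolding \<kappa>_def
    proof (rule dual.ideal_sup_least[OF I g])
      fix b assume b: "b \<in> I" "b \<preceq> g"
      have "evaluation x b \<le> \<rho> b" using b(1) by (simp add: I_def)
      also have "\<dots> \<le> \<rho> g" by (rule dual.positive_functional_mono[OF minimal_remainder_nonneg[OF \<rho>] b(2)])
      finally show "evaluation x b \<le> \<rho> g" .
    qed
  qed
  have "(\<lambda>n. (\<phi> - \<rho>) (f n) + \<kappa> (f n)) \<longlonglongrightarrow> 0 + 0"
    unfolding \<kappa>_def
    by (intro tendsto_add minimal_remainder_tends_to_0[OF \<rho>] ideal_sup_evaluation_tends_to_0[OF I x])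
  then have "\<rho> - \<kappa> \<in> remainders \<phi>"
    using \<kappa>_le dual.dual_trans[OF dual.dual_diff_le[OF \<kappa>_nonneg] minimal_remainder_le[OF \<rho>]]
    by (simp add: remainders_def blinfun.diff_left algebra_simps)
  then have "\<rho> e \<le> (\<rho> - \<kappa>) e"
    using dual.dual_diff_le[OF \<kappa>_nonneg] by (rule minimal_remainder_minimal[OF \<rho>])
  then have "\<kappa> e \<le> 0" by (simp add: blinfun.diff_left)
  moreover have "a \<in> I" using a(1) dom by (simp add: I_def)
  then have "a x \<le> \<kappa> e"
    using dual.ideal_sup_upper[OF I e_nonneg _ a(2), of "evaluation x"] by (simp add: \<kappa>_def)
  ultimately show ?thesis using dual_nonnegD[OF a(1) x] by simp
qed

lemma minimal_remainder_almost_singular: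
  assumes \<rho>: "minimal_remainder \<phi> \<rho>" and x: "0 \<sqsubseteq> x" and \<eta>: "0 < \<eta>"
  obtains a where "0 \<preceq> a" "a \<preceq> e" "blinfun_apply a x = 0" "\<rho> (e - a) \<le> \<eta>"
proof -
  have ex: "0 \<le> e x" by (rule dual_nonnegD[OF e_nonneg x])
  define s where "s = \<eta> / (2 * (e x + 1))"
  have s: "0 < s" "s * e x \<le> \<eta> / 2" using \<eta> ex by (auto simp: s_def field_simps)
  define \<sigma> where "\<sigma> = \<rho> - evaluation (s *\<^sub>R x)"
  obtain a where a: "0 \<preceq> a" "a \<preceq> e" "dual.pos_part (- \<sigma>) a = 0" "dual.pos_part \<sigma> (e - a) \<le> \<eta> / 2"
    using disjoint_functionals_exact_split[OF dual.pos_part_nonneg dual.pos_part_nonneg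
        dual.dual_disjoint_pos_part e_nonneg half_gt_zero[OF \<eta>]] by blast
  have "a (s *\<^sub>R x) = 0"
  proof (rule minimal_remainder_dominates_no_evaluation[OF \<rho> scale_nonneg[OF x] a(1,2)])
    fix b assume b: "0 \<preceq> b" "b \<preceq> a"
    have "- \<sigma> b \<le> dual.pos_part (- \<sigma>) b"
      using dual.dual_orderD[OF dual.pos_part_ge b(1), of "- \<sigma>"] by (simp add: blinfun.minus_left)
    also have "\<dots> \<le> 0"
      using dual.positive_functional_mono[OF dual.pos_part_nonneg b(2), of "- \<sigma>"] a(3) by simp
    finally show "b (s *\<^sub>R x) \<le> \<rho> b" by (simp add: \<sigma>_def blinfun.diff_left)
  qed (use s in simp)
  then have ax: "a x = 0" using s(1) by (simp add: blinfun.scaleR_right)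
  have "\<rho> (e - a) = \<sigma> (e - a) + s * e x"
    by (simp add: \<sigma>_def blinfun.bilinear_simps ax)
  also have "\<sigma> (e - a) \<le> \<eta> / 2"
    using dual.dual_orderD[OF dual.pos_part_ge, of "e - a" \<sigma>] a(2,4) by simp
  finally have "\<rho> (e - a) \<le> \<eta>" using s(2) by simp
  then show thesis using that a(1,2) ax by blast
qed

lemma minimal_remainder_singular:
  assumes \<rho>: "minimal_remainder \<phi> \<rho>" and x: "0 \<sqsubseteq> x"
  obtains c where "0 \<preceq> c" "c \<preceq> e" "blinfun_apply c x = 0" "\<rho> (e - c) = 0"
proof -
  define I where "I = {a. 0 \<preceq> a \<and> evaluation x a = 0}"
  have I: "dual.positive_ideal I"
    unfolding I_def by (rule dual.positive_ideal_null[OF evaluation_nonneg[OF x]])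
  obtain c where c: "ideal_component I e c" using ideal_component_exists[OF I e_nonneg] by blast
  note \<rho>_nonneg = minimal_remainder_nonneg[OF \<rho>]
  note c_bounds = ideal_component_nonneg[OF I e_nonneg c] ideal_component_le[OF c]
  have "c x \<le> 0"
  proof (rule field_le_epsilon)
    fix \<eta> :: real assume "0 < \<eta>"
    then obtain a where "a \<in> I" "c x < a x + \<eta>" using ideal_component_approx[OF c x] by blast
    then show "c x \<le> 0 + \<eta>" by (simp add: I_def)
  qed
  then have "c x = 0" using dual_nonnegD[OF c_bounds(1) x] by simp
  moreover have "\<rho> (e - c) \<le> 0"
  proof (rule field_le_epsilon)
    fix \<eta> :: real assume "0 < \<eta>"
    then obtain a where a: "0 \<preceq> a" "a \<preceq> e" "a x = 0" "\<rho> (e - a) \<le> \<eta>"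
      by (rule minimal_remainder_almost_singular[OF \<rho> x])
    have "a \<preceq> c" using ideal_component_upper[OF c _ a(2)] a(1,3) by (simp add: I_def)
    then have "e - c \<preceq> e - a" by (simp add: dual_order_def blinfun.diff_left)
    from dual.positive_functional_mono[OF \<rho>_nonneg this] show "\<rho> (e - c) \<le> 0 + \<eta>" using a(4) by simp
  qed
  then have "\<rho> (e - c) = 0" using dual.dual_nonnegD[OF \<rho>_nonneg, of "e - c"] c_bounds(2) by simp
  ultimately show thesis using that c_bounds by blast
qed

lemma minimal_remainder_vanishes:
  assumes \<rho>: "minimal_remainder \<phi> \<rho>"
  shows "\<rho> e = 0"
proof -
  note \<rho>_nonneg = minimal_remainder_nonneg[OF \<rho>]
  define D where "D = {c. 0 \<preceq> c \<and> c \<preceq> e \<and> \<rho> (e - c) = 0}"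
  have "downward_directed dual_order D"
    unfolding downward_directed_def
  proof (intro conjI ballI)
    have "e \<in> D" using e_nonneg by (simp add: D_def blinfun.zero_right)
    then show "D \<noteq> {}" by blast
    fix c d assume cd: "c \<in> D" "d \<in> D"
    have "pos_part (c - d) \<preceq> e - d"
      using cd by (intro pos_part_least) (auto simp: D_def dual_order_def blinfun.diff_left)
    from dual.positive_functional_mono[OF \<rho>_nonneg this]
    have "\<rho> (pos_part (c - d)) = 0"
      using dual.dual_nonnegD[OF \<rho>_nonneg pos_part_nonneg[of "c - d"]] cd(2) by (simp add: D_def)
    then have "\<rho> ((e - c) + pos_part (c - d)) = 0" using cd(1) by (simp add: D_def blinfun.add_right)
    then have "\<rho> (e - dual_inf c d) = 0" by (simp add: dual_inf_def algebra_simps)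
    then have "dual_inf c d \<in> D"
      using cd dual_inf_greatest[of 0 c d] dual_trans[OF dual_inf_lower1, of c e d] by (simp add: D_def)
    then show "\<exists>w\<in>D. w \<preceq> c \<and> w \<preceq> d" using dual_inf_lower1 dual_inf_lower2 by blast
  qed
  moreover have "is_glb dual_order D 0"
    unfolding is_glb_def
  proof (intro conjI ballI allI impI)
    show "0 \<preceq> d" if "d \<in> D" for d using that by (simp add: D_def)
    fix w assume w: "\<forall>d\<in>D. w \<preceq> d"
    show "w \<preceq> 0"
    proof (rule dual_orderI)
      fix x assume x: "0 \<sqsubseteq> x"
      obtain c where "c \<in> D" "c x = 0"
        using minimal_remainder_singular[OF \<rho> x] by (auto simp: D_def)
      then show "w x \<le> blinfun_apply 0 x" using w dual_orderD[OF _ x, of w c] by simp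
    qed
  qed
  ultimately have small: "\<exists>d\<in>D. \<bar>\<rho> d\<bar> < \<eta>" if "0 < \<eta>" for \<eta>
    using that by (rule order_continuous_functional)
  have "\<rho> d = \<rho> e" if "d \<in> D" for d using that by (simp add: D_def blinfun.diff_right)
  then have "\<bar>\<rho> e\<bar> < \<eta>" if "0 < \<eta>" for \<eta> using small[OF that] by auto
  then show ?thesis using zero_less_abs_iff by blast
qed

theorem weakly_null:
  fixes \<phi> :: "('v \<Rightarrow>\<^sub>L real) \<Rightarrow>\<^sub>L real"
  shows "(\<lambda>n. \<phi> (f n)) \<longlonglongrightarrow> 0"
proof -
  have nonneg: "(\<lambda>n. \<psi> (f n)) \<longlonglongrightarrow> 0" if \<psi>: "0 \<preceq>\<^sup>* \<psi>" for \<psi>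
  proof -
    obtain \<rho> where \<rho>: "minimal_remainder \<psi> \<rho>" using minimal_remainder_exists[OF \<psi>] by blast
    note \<rho>_nonneg = minimal_remainder_nonneg[OF \<rho>]
    have "\<rho> (f n) = 0" for n
    proof -
      obtain C where "modulus (f n) \<preceq> C *\<^sub>R e" using dominated by blast
      from dual.positive_functional_mono[OF \<rho>_nonneg this]
      have "\<rho> (modulus (f n)) \<le> 0"
        by (simp add: blinfun.scaleR_right minimal_remainder_vanishes[OF \<rho>])
      then show ?thesis
        using abs_bidual_le_modulus[of \<rho> "f n"] by (simp add: dual.modulus_of_nonneg[OF \<rho>_nonneg])
    qed
    then show ?thesis using minimal_remainder_tends_to_0[OF \<rho>] by (simp add: blinfun.diff_left)
  qed
  have "(\<lambda>n. dual.pos_part \<phi> (f n) - dual.pos_part (- \<phi>) (f n)) \<longlonglongrightarrow> 0 - 0"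
    by (intro tendsto_diff nonneg dual.pos_part_nonneg)
  then show ?thesis by (simp add: dual.pos_part_uminus blinfun.diff_left)
qed

end

section \<open>Lattice-ordered groups\<close>

context
begin

interpretation lattice_group: lattice_ab_group_add_abs
  labs "(+)" "0 :: 'a::{lattice, ordered_ab_group_add}" "(-)" uminus "(\<le>)" "(<)" inf sup
  by unfold_locales (rule labs_def)

lemma diff_inf_eq_sup_diff: "a - inf b c = sup (a - b) (a - c)"
  for a b c :: "'a::{lattice, ordered_ab_group_add}"
  by (simp add: lattice_group.diff_inf_eq_sup lattice_group.add_sup_distrib_left)

lemma add_eq_sup_add_inf: "a + b = sup a b + inf a b"
  for a b :: "'a::{lattice, ordered_ab_group_add}"
  by (rule lattice_group.add_eq_inf_sup)

lemma sup_diff_sup_neg: "sup a 0 - sup (- a) 0 = a"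
  for a :: "'a::{lattice, ordered_ab_group_add}"
  using lattice_group.prts[of a] lattice_group.pprt_neg[of a]
  by (simp add: lattice_group.pprt_def)

lemma inf_sup_neg_eq_0: "inf (sup a 0) (sup (- a) 0) = 0"
  for a :: "'a::{lattice, ordered_ab_group_add}"
proof -
  have "sup a 0 + sup (- a) 0 = sup (sup a 0) (sup (- a) 0)"
  proof -
    have "sup a 0 + sup (- a) 0 = labs a"
      using lattice_group.abs_prts[of a] lattice_group.pprt_neg[of a] by (simp add: lattice_group.pprt_def)
    moreover have "sup (labs a) 0 = labs a"
      using lattice_group.abs_ge_zero[of a] by (simp add: sup_absorb1)
    ultimately show ?thesis by (simp add: labs_def sup.assoc sup.left_commute sup.commute)
  qed
  then show ?thesis using add_eq_sup_add_inf[of "sup a 0" "sup (- a) 0"] by simp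
qed

lemma labs_nonneg: "0 \<le> labs a"
  for a :: "'a::{lattice, ordered_ab_group_add}"
  by (rule lattice_group.abs_ge_zero)

lemma labs_of_nonneg: "0 \<le> a \<Longrightarrow> labs a = a"
  for a :: "'a::{lattice, ordered_ab_group_add}"
  by (rule lattice_group.abs_of_nonneg)

lemma inf_add_eq_0:
  fixes a b c :: "'a::{lattice, ordered_ab_group_add}"
  assumes "0 \<le> a" "0 \<le> b" "0 \<le> c" "inf a c = 0" "inf b c = 0"
  shows "inf (a + b) c = 0"
proof (rule antisym)
  have "inf (a + b) c \<le> inf (a + b) (a + c)"
    using assms by (simp add: le_infI2 add_increasing)
  also have "\<dots> = a" using assms(5) by (simp flip: lattice_group.add_inf_distrib_left)
  finally have "inf (a + b) c \<le> inf a c" by simp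
  then show "inf (a + b) c \<le> 0" using assms(4) by simp
  show "0 \<le> inf (a + b) c" using assms by simp
qed

end

lemma inf_sum_eq_0:
  fixes z :: "'i \<Rightarrow> 'a::{lattice, ordered_ab_group_add}"
  assumes "finite J" "0 \<le> c" "\<And>j. j \<in> J \<Longrightarrow> 0 \<le> z j" "\<And>j. j \<in> J \<Longrightarrow> inf (z j) c = 0"
  shows "inf (sum z J) c = 0"
  using assms(1,3,4)
  by (induction J) (use assms(2) in \<open>auto simp: inf_absorb1 sum_nonneg intro!: inf_add_eq_0\<close>)

lemma sum_disjoint_le:
  fixes z :: "'i \<Rightarrow> 'a::{lattice, ordered_ab_group_add}"
  assumes "finite J" "0 \<le> u" "\<And>j. j \<in> J \<Longrightarrow> 0 \<le> z j" "\<And>j. j \<in> J \<Longrightarrow> z j \<le> u"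
    and "\<And>i j. i \<in> J \<Longrightarrow> j \<in> J \<Longrightarrow> i \<noteq> j \<Longrightarrow> inf (z i) (z j) = 0"
  shows "sum z J \<le> u"
  using assms(1,3-5)
proof (induction J)
  case empty
  show ?case using \<open>0 \<le> u\<close> by simp
next
  case (insert k J)
  have "inf (sum z J) (z k) = 0"
    using insert by (intro inf_sum_eq_0) auto
  then have "sum z (insert k J) = sup (sum z J) (z k)"
    using add_eq_sup_add_inf[of "sum z J" "z k"] insert.hyps by (simp add: add.commute)
  also have "\<dots> \<le> u" using insert by auto
  finally show ?case .
qed

lemma finite_disjointification:
  fixes a :: "'i \<Rightarrow> 'a::{lattice, ordered_ab_group_add}"
  assumes J: "finite J" and a: "\<And>j. j \<in> J \<Longrightarrow> 0 \<le> a j"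
  obtains z where "\<And>j. 0 \<le> z j" "\<And>j. j \<in> J \<Longrightarrow> z j \<le> a j"
    "\<And>j. a j - z j \<le> sum a (J - {j})" "\<And>i j. i \<in> J \<Longrightarrow> j \<in> J \<Longrightarrow> i \<noteq> j \<Longrightarrow> inf (z i) (z j) = 0"
proof
  define z where "z j = sup (a j - sum a (J - {j})) 0" for j
  show "0 \<le> z j" for j by (simp add: z_def)
  show "z j \<le> a j" if "j \<in> J" for j
    using a that sum_nonneg[of "J - {j}" a] by (auto simp: z_def)
  have "a j - sum a (J - {j}) \<le> z j" for j by (simp add: z_def)
  then show "a j - z j \<le> sum a (J - {j})" for j by (simp add: diff_le_eq add.commute)
  have z_le: "z i \<le> sup (a i - a j) 0" if "i \<in> J" "j \<in> J" "i \<noteq> j" for i j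
  proof -
    have "a j \<le> sum a (J - {i})" using that J a sum_mono2[of "J - {i}" "{j}" a] by auto
    then show ?thesis unfolding z_def by (intro sup_mono diff_left_mono) auto
  qed
  show "inf (z i) (z j) = 0" if "i \<in> J" "j \<in> J" "i \<noteq> j" for i j
  proof (rule antisym)
    have "inf (z i) (z j) \<le> inf (sup (a i - a j) 0) (sup (- (a i - a j)) 0)"
      using z_le[of i j] z_le[of j i] that by (intro inf_mono) auto
    then show "inf (z i) (z j) \<le> 0" by (simp only: inf_sup_neg_eq_0)
  qed (simp add: z_def)
qed

lemma diff_inf_sup_le:
  fixes c u x :: "'a::{lattice, ordered_ab_group_add}"
  assumes "c \<le> u" "x \<le> u"
  shows "u - inf c (sup x 0) \<le> (u - c) + (u - x)"
proof -
  have "u - inf c (sup x 0) = sup (u - c) (u - sup x 0)" by (rule diff_inf_eq_sup_diff)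
  also have "\<dots> \<le> sup (u - c) (u - x)" by (intro sup_mono diff_left_mono) auto
  also have "\<dots> \<le> (u - c) + (u - x)" using assms by (auto intro: add_increasing add_increasing2)
  finally show ?thesis .
qed

lemma split_off_disjoint:
  fixes c u z :: "'a::{lattice, ordered_ab_group_add}"
  assumes c: "0 \<le> c" "c \<le> u" and z: "0 \<le> z" "z \<le> u"
  obtains y d where "0 \<le> y" "y \<le> c" "0 \<le> d" "d \<le> c" "inf y d = 0"
    "u - y \<le> (u - c) + ((u - z) + (u - z))" "u - d \<le> (u - c) + (z + z)"
proof (rule that)
  define w where "w = u - z"
  have "0 \<le> w" "w \<le> u" using z by (simp_all add: w_def)
  then have le_u: "z - w \<le> u" "w - z \<le> u" using z by (simp_all add: diff_le_eq add_increasing2)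
  let ?y = "inf c (sup (z - w) 0)" and ?d = "inf c (sup (w - z) 0)"
  show "0 \<le> ?y" "?y \<le> c" "0 \<le> ?d" "?d \<le> c" using c(1) by simp_all
  show "inf ?y ?d = 0"
  proof (rule antisym)
    have "inf ?y ?d \<le> inf (sup (z - w) 0) (sup (- (z - w)) 0)" by (auto intro: le_infI1 le_infI2)
    then show "inf ?y ?d \<le> 0" by (simp only: inf_sup_neg_eq_0)
  qed (use c(1) in simp)
  show "u - ?y \<le> (u - c) + ((u - z) + (u - z))"
    using diff_inf_sup_le[OF c(2) le_u(1)] by (simp add: w_def algebra_simps)
  show "u - ?d \<le> (u - c) + (z + z)"
    using diff_inf_sup_le[OF c(2) le_u(2)] by (simp add: w_def algebra_simps)
qed

lemma sigma_interpolation_between: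
  fixes a b :: "nat \<Rightarrow> 'a::lattice"
  assumes "sigma_interpolation TYPE('a)" and "\<And>m n. a m \<le> b n"
  shows "\<exists>z. \<forall>n. a n \<le> z \<and> z \<le> b n"
proof -
  define x where "x n = Sup_fin (a ` {..n})" for n
  define y where "y n = Inf_fin (b ` {..n})" for n
  have "x n \<le> x (Suc n)" "y (Suc n) \<le> y n" for n
    unfolding x_def y_def by (intro Sup_fin.subset_imp Inf_fin.subset_imp; force)+
  moreover have "x n \<le> y n" for n
    unfolding x_def y_def using assms(2) by (intro Sup_fin.boundedI Inf_fin.boundedI) auto
  ultimately obtain z where z: "\<And>n. x n \<le> z" "\<And>n. z \<le> y n"
    using assms(1) unfolding sigma_interpolation_def by meson
  have "a n \<le> x n" "y n \<le> b n" for n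
    unfolding x_def y_def by (auto intro: Sup_fin.coboundedI Inf_fin.coboundedI)
  then show ?thesis using z order_trans by blast
qed

section \<open>Banach lattices\<close>

locale banach_lattice_space =
  fixes TY :: "'a::{banach, lattice, ordered_ab_group_add} itself"
  assumes banach_lattice: "banach_lattice TYPE('a)"
begin

lemma scaleR_nonneg: "0 \<le> x \<Longrightarrow> 0 \<le> r \<Longrightarrow> 0 \<le> r *\<^sub>R (x::'a)"
  using banach_lattice by (simp add: banach_lattice_def)

lemma scaleR_le_scaleR: "r \<le> s \<Longrightarrow> 0 \<le> x \<Longrightarrow> r *\<^sub>R x \<le> s *\<^sub>R (x::'a)"
  using scaleR_nonneg[of x "s - r"] by (simp add: scaleR_left_diff_distrib)

lemma norm_le_norm_of_labs_le: "labs x \<le> labs y \<Longrightarrow> norm x \<le> norm (y::'a)"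
  using banach_lattice by (simp add: banach_lattice_def)

lemma norm_labs: "norm (labs x) = norm (x::'a)"
  by (intro antisym norm_le_norm_of_labs_le) (simp_all add: labs_of_nonneg labs_nonneg)

lemma riesz_normed_space: "riesz_normed_space ((\<le>) :: 'a \<Rightarrow> 'a \<Rightarrow> bool)"
proof
  fix a b c :: 'a and r :: real
  show "a \<le> b \<longleftrightarrow> 0 \<le> b - a" by simp
  show "0 \<le> a \<Longrightarrow> 0 \<le> b \<Longrightarrow> 0 \<le> a + b" by simp
  show "0 \<le> a \<Longrightarrow> 0 \<le> r \<Longrightarrow> 0 \<le> r *\<^sub>R a" by (rule scaleR_nonneg)
  show "norm a \<le> norm b" if "0 \<le> a" "a \<le> b"
    using that by (intro norm_le_norm_of_labs_le) (simp add: labs_of_nonneg order_trans[of 0 a b])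
  show "\<exists>c1 c2. c = c1 + c2 \<and> 0 \<le> c1 \<and> c1 \<le> a \<and> 0 \<le> c2 \<and> c2 \<le> b"
    if "0 \<le> a" "0 \<le> b" "0 \<le> c" "c \<le> a + b"
  proof (intro exI conjI)
    show "c = inf c a + (c - inf c a)" by simp
    show "c - inf c a \<le> b" using that by (simp add: diff_inf_eq_sup_diff algebra_simps)
  qed (use that in simp_all)
  show "\<exists>a b. c = a - b \<and> 0 \<le> a \<and> 0 \<le> b \<and> norm a \<le> norm c \<and> norm b \<le> norm c"
  proof (intro exI conjI)
    show "c = sup c 0 - sup (- c) 0" by (rule sup_diff_sup_neg[symmetric])
    have "sup c 0 \<le> labs c" "sup (- c) 0 \<le> labs c"
      using labs_nonneg[of c] by (auto simp: labs_def)
    then show "norm (sup c 0) \<le> norm c" "norm (sup (- c) 0) \<le> norm c"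
      by (auto intro: norm_le_norm_of_labs_le simp: labs_of_nonneg)
  qed simp_all
qed

lemma dual_order_eq_dual_le: "riesz_normed_space.dual_order ((\<le>) :: 'a \<Rightarrow> 'a \<Rightarrow> bool) = dual_le"
  by (intro ext) (simp add: riesz_normed_space.dual_order_def[OF riesz_normed_space] dual_le_def)

sublocale E: riesz_bidual "(\<le>) :: 'a \<Rightarrow> 'a \<Rightarrow> bool"
  rewrites "riesz_normed_space.dual_order ((\<le>) :: 'a \<Rightarrow> 'a \<Rightarrow> bool) = dual_le"
proof -
  show "riesz_bidual ((\<le>) :: 'a \<Rightarrow> 'a \<Rightarrow> bool)"
    using riesz_normed_space by (rule riesz_bidual.intro)
qed (rule dual_order_eq_dual_le)

notation dual_le (infix "\<preceq>" 50)
notation E.dual.dual_order (infix "\<preceq>\<^sup>*" 50)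

lemma rsup_dual: "rsup dual_le f g = E.dual_sup f g"
  unfolding rsup_def
proof (rule the_equality)
  show sup: "is_sup2 dual_le f g (E.dual_sup f g)"
    by (simp add: is_sup2_def E.dual_sup_upper1 E.dual_sup_upper2 E.dual_sup_least)
  show "h = E.dual_sup f g" if "is_sup2 dual_le f g h" for h
    using that sup by (auto simp: is_sup2_def intro: E.dual_antisym)
qed

lemma adjoint_op_add: "adjoint_op T (f + g) = adjoint_op T f + adjoint_op T g"
  by (simp add: adjoint_op_def bounded_bilinear.add_left[OF bounded_bilinear_blinfun_compose])

lemma adjoint_op_disjoint:
  assumes "lattice_hom dual_le (adjoint_op T)" "E.dual_disjoint f g"
  shows "E.dual_disjoint (adjoint_op T f) (adjoint_op T g)"
  using assms unfolding E.dual_disjoint_iff_sup_eq_add lattice_hom_def rsup_dual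
  by (metis adjoint_op_add)

end

section \<open>Selection of disjoint sequences\<close>

lemma unbounded_card_finite_cover:
  fixes R :: "nat \<Rightarrow> 'a set" and S :: "'i \<Rightarrow> nat \<Rightarrow> 'a set"
  assumes "finite J" "\<And>j n. finite (S j n)" "\<And>n. R n \<subseteq> (\<Union>j\<in>J. S j n)" "\<And>M. \<exists>n. M \<le> card (R n)"
  shows "\<exists>j\<in>J. \<forall>M. \<exists>n. M \<le> card (S j n)"
proof (rule ccontr)
  assume "\<not> ?thesis"
  then have "\<forall>j\<in>J. \<exists>M. \<forall>n. card (S j n) < M" by (simp add: not_le)
  then obtain M where M: "\<And>j n. j \<in> J \<Longrightarrow> card (S j n) < M j" by metis
  obtain n where "Suc (sum M J) \<le> card (R n)" using assms(4) by blast
  also have "card (R n) \<le> card (\<Union>j\<in>J. S j n)" using assms(1-3) by (intro card_mono) auto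
  also have "\<dots> \<le> (\<Sum>j\<in>J. card (S j n))" by (rule card_UN_le[OF assms(1)])
  also have "\<dots> \<le> sum M J" using M by (intro sum_mono less_imp_le)
  finally show False by simp
qed

context banach_lattice_space
begin

lemma disjoint_functionals_disjointify:
  fixes \<mu> :: "'i \<Rightarrow> ('a \<Rightarrow>\<^sub>L real)"
  assumes J: "finite J" and u: "0 \<le> u" and \<mu>: "\<And>j. j \<in> J \<Longrightarrow> 0 \<preceq> \<mu> j"
    and disj: "\<And>i j. i \<in> J \<Longrightarrow> j \<in> J \<Longrightarrow> i \<noteq> j \<Longrightarrow> E.dual_disjoint (\<mu> i) (\<mu> j)" and "0 < \<eta>"
  obtains z where "\<And>j. j \<in> J \<Longrightarrow> 0 \<le> z j" "\<And>j. j \<in> J \<Longrightarrow> z j \<le> u"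
    "\<And>j. j \<in> J \<Longrightarrow> \<mu> j (u - z j) \<le> \<eta>"
    "\<And>i j. i \<in> J \<Longrightarrow> j \<in> J \<Longrightarrow> i \<noteq> j \<Longrightarrow> inf (z i) (z j) = 0"
proof (cases "J = {}")
  case True
  then show thesis using that by simp
next
  case False
  define \<theta> where "\<theta> = \<eta> / card J"
  have \<theta>: "0 < \<theta>" "real (card J) * \<theta> = \<eta>" using False J \<open>0 < \<eta>\<close> by (auto simp: \<theta>_def card_gt_0_iff)
  obtain a where a: "\<And>j. j \<in> J \<Longrightarrow> 0 \<le> a j" "\<And>j. j \<in> J \<Longrightarrow> a j \<le> u"
    and \<mu>_a: "\<And>j. j \<in> J \<Longrightarrow> \<mu> j (u - a j) \<le> \<theta>" "\<And>i j. i \<in> J \<Longrightarrow> j \<in> J \<Longrightarrow> i \<noteq> j \<Longrightarrow> \<mu> j (a i) \<le> \<theta>"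
    by (rule E.disjoint_functionals_separate[OF J u, of \<mu> \<theta>]) (rule \<mu> disj \<theta>(1) that; assumption)+
  obtain z where z: "\<And>j. 0 \<le> z j" "\<And>j. j \<in> J \<Longrightarrow> z j \<le> a j"
    "\<And>j. a j - z j \<le> sum a (J - {j})" "\<And>i j. i \<in> J \<Longrightarrow> j \<in> J \<Longrightarrow> i \<noteq> j \<Longrightarrow> inf (z i) (z j) = 0"
    by (rule finite_disjointification[OF J, of a]) (rule a(1) that; assumption)+
  show thesis
  proof (rule that)
    fix j assume j: "j \<in> J"
    show "0 \<le> z j" by (rule z(1))
    show "z j \<le> u" using z(2)[OF j] a(2)[OF j] by (rule order_trans)
    have "u - z j \<le> (u - a j) + sum a (J - {j})" using z(3)[of j] by (simp add: algebra_simps)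
    from E.positive_functional_mono[OF \<mu>[OF j] this]
    have "\<mu> j (u - z j) \<le> \<mu> j (u - a j) + (\<Sum>i\<in>J - {j}. \<mu> j (a i))"
      by (simp add: blinfun.add_right blinfun.sum_right)
    also have "\<mu> j (u - a j) \<le> \<theta>" by (rule \<mu>_a(1)[OF j])
    also have "(\<Sum>i\<in>J - {j}. \<mu> j (a i)) \<le> (\<Sum>i\<in>J - {j}. \<theta>)" using \<mu>_a(2) j by (intro sum_mono) auto
    also have "\<theta> + (\<Sum>i\<in>J - {j}. \<theta>) = \<eta>" using J j \<theta>(2) sum.remove[OF J j, of "\<lambda>_. \<theta>"] by simp
    finally show "\<mu> j (u - z j) \<le> \<eta>" by simp
  qed (rule z(4))
qed

lemma exists_small_disjoint_part:
  fixes \<mu> :: "'a \<Rightarrow>\<^sub>L real"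
  assumes "finite J" "J \<noteq> {}" "0 \<preceq> \<mu>" "sum z J \<le> u"
  shows "\<exists>j\<in>J. real (card J) * blinfun_apply \<mu> (z j) \<le> blinfun_apply \<mu> u"
proof (rule ccontr)
  assume "\<not> ?thesis"
  then have "(\<Sum>j\<in>J. \<mu> u) < (\<Sum>j\<in>J. real (card J) * \<mu> (z j))"
    using assms(1,2) by (intro sum_strict_mono) (auto simp: not_le)
  also have "\<dots> = real (card J) * \<mu> (sum z J)" by (simp add: blinfun.sum_right sum_distrib_left)
  also have "\<dots> \<le> real (card J) * \<mu> u"
    by (intro mult_left_mono E.positive_functional_mono assms(3,4)) simp
  finally show False by simp
qed

end

locale disjoint_triangular_array = banach_lattice_space TY
  for TY :: "'a::{banach, lattice, ordered_ab_group_add} itself" +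
  fixes \<mu> :: "nat \<Rightarrow> nat \<Rightarrow> ('a \<Rightarrow>\<^sub>L real)" and u :: 'a and \<delta> :: real
  assumes u_nonneg: "0 \<le> u" and \<delta>_pos: "0 < \<delta>"
    and \<mu>_nonneg: "i < n \<Longrightarrow> 0 \<preceq> \<mu> n i"
    and \<mu>_mass: "i < n \<Longrightarrow> \<delta> \<le> blinfun_apply (\<mu> n i) u"
    and \<mu>_disjoint: "i < n \<Longrightarrow> j < n \<Longrightarrow> i \<noteq> j \<Longrightarrow> E.dual_disjoint (\<mu> n i) (\<mu> n j)"
begin

lemma exists_negligible_part:
  assumes R: "\<And>n. R n \<subseteq> {..<n}" "\<And>M. \<exists>n. M \<le> card (R n)"
    and J: "finite J" "1 \<le> real (card J) * \<tau>" and z: "\<And>j. j \<in> J \<Longrightarrow> 0 \<le> z j" "sum z J \<le> u" and "0 < \<tau>"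
  shows "\<exists>j\<in>J. \<forall>M. \<exists>m. M \<le> card {i \<in> R m. \<mu> m i (z j) \<le> \<tau> * \<mu> m i u}"
proof (rule unbounded_card_finite_cover[OF J(1) _ _ R(2)])
  show "finite {i \<in> R m. \<mu> m i (z j) \<le> \<tau> * \<mu> m i u}" for j m
    using finite_subset[OF R(1)] by simp
  show "R m \<subseteq> (\<Union>j\<in>J. {i \<in> R m. \<mu> m i (z j) \<le> \<tau> * \<mu> m i u})" for m
  proof
    fix i assume i: "i \<in> R m"
    then have nonneg: "0 \<preceq> \<mu> m i" using R(1) \<mu>_nonneg by auto
    have "J \<noteq> {}" using J(2) by auto
    then obtain j where j: "j \<in> J" "real (card J) * \<mu> m i (z j) \<le> \<mu> m i u"
      using exists_small_disjoint_part[OF J(1) _ nonneg z(2)] by blast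
    have "\<mu> m i (z j) \<le> (real (card J) * \<tau>) * \<mu> m i (z j)"
      using mult_right_mono[OF J(2) E.dual_nonnegD[OF nonneg z(1)[OF j(1)]]] by simp
    also have "\<dots> \<le> \<tau> * \<mu> m i u"
      using mult_left_mono[OF j(2), of \<tau>] \<open>0 < \<tau>\<close> by (simp add: algebra_simps)
    finally show "i \<in> (\<Union>j\<in>J. {i \<in> R m. \<mu> m i (z j) \<le> \<tau> * \<mu> m i u})" using i j(1) by auto
  qed
qed

lemma exists_concentrated_negligible_part:
  assumes R: "\<And>n. R n \<subseteq> {..<n}" "\<And>M. \<exists>n. M \<le> card (R n)" and "0 < \<tau>" "0 < \<eta>"
  obtains n j z where "j \<in> R n" "i0 < j" "0 \<le> z" "z \<le> u" "\<mu> n j (u - z) \<le> \<eta>"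
    "\<And>M. \<exists>m. M \<le> card {i \<in> R m. \<mu> m i z \<le> \<tau> * \<mu> m i u}"
proof -
  obtain M :: nat where M: "1 / \<tau> < real M" using reals_Archimedean2 by blast
  obtain n where n: "M + i0 + 1 \<le> card (R n)" using R(2) by blast
  define J where "J = R n - {..i0}"
  have J: "finite J" "\<And>j. j \<in> J \<Longrightarrow> j < n \<and> i0 < j \<and> j \<in> R n"
    using R(1)[of n] finite_subset by (auto simp: J_def)
  have "M \<le> card J"
    using n diff_card_le_card_Diff[of "{..i0}" "R n"] by (simp add: J_def)
  then have "real M * \<tau> \<le> real (card J) * \<tau>" using \<open>0 < \<tau>\<close> by simp
  moreover have "1 < real M * \<tau>" using M \<open>0 < \<tau>\<close> by (simp add: divide_less_eq)
  ultimately have card_J: "1 \<le> real (card J) * \<tau>" by simp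
  obtain z where z: "\<And>j. j \<in> J \<Longrightarrow> 0 \<le> z j" "\<And>j. j \<in> J \<Longrightarrow> z j \<le> u"
    "\<And>j. j \<in> J \<Longrightarrow> \<mu> n j (u - z j) \<le> \<eta>"
    "\<And>i j. i \<in> J \<Longrightarrow> j \<in> J \<Longrightarrow> i \<noteq> j \<Longrightarrow> inf (z i) (z j) = 0"
  proof (rule disjoint_functionals_disjointify[OF J(1) u_nonneg, of "\<mu> n" \<eta>])
    show "0 \<preceq> \<mu> n j" if "j \<in> J" for j using \<mu>_nonneg J(2)[OF that] by blast
    show "E.dual_disjoint (\<mu> n i) (\<mu> n j)" if "i \<in> J" "j \<in> J" "i \<noteq> j" for i j
      using \<mu>_disjoint J(2) that by blast
  qed (rule \<open>0 < \<eta>\<close>, rule that)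
  have "sum z J \<le> u" by (rule sum_disjoint_le[OF J(1) u_nonneg z(1,2,4)])
  then have "\<exists>j\<in>J. \<forall>M. \<exists>m. M \<le> card {i \<in> R m. \<mu> m i (z j) \<le> \<tau> * \<mu> m i u}"
    by (intro exists_negligible_part[OF R J(1) card_J z(1) _ \<open>0 < \<tau>\<close>])
  then obtain j where j: "j \<in> J" "\<And>M. \<exists>m. M \<le> card {i \<in> R m. \<mu> m i (z j) \<le> \<tau> * \<mu> m i u}"
    by blast
  show thesis
  proof (rule that)
    show "j \<in> R n" "i0 < j" using J(2)[OF j(1)] by simp_all
  qed (rule z(1-3)[OF j(1)] j(2))+
qed

text \<open>\<open>c\<close> is the part of \<open>u\<close> still free for later choices, \<open>R n\<close> the indices of row \<open>n\<close> still in play, and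
  \<open>s\<close> bounds the relative mass they have lost.\<close>

definition selection_state :: "'a \<Rightarrow> (nat \<Rightarrow> nat set) \<Rightarrow> real \<Rightarrow> bool" where
  "selection_state c R s \<longleftrightarrow> 0 \<le> c \<and> c \<le> u \<and> (\<forall>M. \<exists>n. M \<le> card (R n)) \<and> (\<forall>n. R n \<subseteq> {..<n}) \<and>
     (\<forall>n. \<forall>i\<in>R n. blinfun_apply (\<mu> n i) (u - c) \<le> s * blinfun_apply (\<mu> n i) u)"

lemma selection_state_initial: "selection_state u (\<lambda>n. {..<n}) 0"
proof -
  have "\<exists>n::nat. M \<le> card {..<n}" for M by (rule exI[of _ M]) simp
  then show ?thesis using u_nonneg by (simp add: selection_state_def blinfun.zero_right)
qed

lemma selection_step:
  assumes state: "selection_state c R s" and "s \<le> 1 / 4" and "0 < \<tau>"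
  shows "\<exists>c' R' j n y. selection_state c' R' (s + \<tau>) \<and> i0 < j \<and> j < n \<and> 0 \<le> y \<and> y \<le> c \<and>
    inf y c' = 0 \<and> c' \<le> c \<and> \<delta> / 2 \<le> \<mu> n j y"
proof -
  have c: "0 \<le> c" "c \<le> u" and R: "\<And>n. R n \<subseteq> {..<n}" "\<And>M. \<exists>n. M \<le> card (R n)"
    and R_mass: "\<And>n i. i \<in> R n \<Longrightarrow> \<mu> n i (u - c) \<le> s * \<mu> n i u"
    using state by (auto simp: selection_state_def)
  obtain n j z where j: "j \<in> R n" "i0 < j" and z: "0 \<le> z" "z \<le> u" "\<mu> n j (u - z) \<le> \<delta> / 8"
    and z_small: "\<And>M. \<exists>m. M \<le> card {i \<in> R m. \<mu> m i z \<le> \<tau> / 2 * \<mu> m i u}"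
    by (rule exists_concentrated_negligible_part[OF R, where \<tau> = "\<tau> / 2" and \<eta> = "\<delta> / 8" and ?i0.0 = i0])
      (use \<open>0 < \<tau>\<close> \<delta>_pos in simp, use \<delta>_pos in simp, rule that)
  define R' where "R' m = {i \<in> R m. \<mu> m i z \<le> \<tau> / 2 * \<mu> m i u}" for m
  obtain y c' where y: "0 \<le> y" "y \<le> c" "u - y \<le> (u - c) + ((u - z) + (u - z))"
    and c': "0 \<le> c'" "c' \<le> c" "inf y c' = 0" "u - c' \<le> (u - c) + (z + z)"
    by (rule split_off_disjoint[OF c z(1,2)]) (rule that)
  have jn: "j < n" using j(1) R(1) by auto
  have "\<mu> n j (u - y) \<le> \<mu> n j (u - c) + 2 * \<mu> n j (u - z)"
    using E.positive_functional_mono[OF \<mu>_nonneg[OF jn] y(3)] by (simp add: blinfun.add_right)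
  also have "\<mu> n j (u - c) \<le> 1 / 4 * \<mu> n j u"
    using R_mass[OF j(1)] mult_right_mono[OF \<open>s \<le> 1 / 4\<close>, of "\<mu> n j u"] \<mu>_mass[OF jn] \<delta>_pos by linarith
  also have "2 * \<mu> n j (u - z) \<le> 1 / 4 * \<mu> n j u" using z(3) \<mu>_mass[OF jn] by simp
  finally have "\<delta> / 2 \<le> \<mu> n j y" using \<mu>_mass[OF jn] by (simp add: blinfun.diff_right)
  moreover have "selection_state c' R' (s + \<tau>)"
    unfolding selection_state_def
  proof (intro conjI allI ballI)
    show "0 \<le> c'" "c' \<le> u" using c c' by auto
    show "\<exists>n. M \<le> card (R' n)" for M unfolding R'_def by (rule z_small)
    show "R' m \<subseteq> {..<m}" for m using R(1) by (auto simp: R'_def)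
    fix m i assume "i \<in> R' m"
    then have i: "i \<in> R m" "\<mu> m i z \<le> \<tau> / 2 * \<mu> m i u" "i < m" using R(1) by (auto simp: R'_def)
    have "\<mu> m i (u - c') \<le> \<mu> m i (u - c) + 2 * \<mu> m i z"
      using E.positive_functional_mono[OF \<mu>_nonneg[OF i(3)] c'(4)] by (simp add: blinfun.add_right)
    then show "\<mu> m i (u - c') \<le> (s + \<tau>) * \<mu> m i u"
      using R_mass[OF i(1)] i(2) by (simp add: algebra_simps)
  qed
  ultimately show ?thesis using j(2) jn y(1,2) c'(2,3) by blast
qed

lemma selection_sequence:
  obtains i n :: "nat \<Rightarrow> nat" and y c :: "nat \<Rightarrow> 'a"
  where "\<And>k. i k < i (Suc k)" "\<And>k. i k < n k" "\<And>k. 0 \<le> y k" "\<And>k. y k \<le> c k" "\<And>k. inf (y k) (c (Suc k)) = 0"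
    "\<And>k. c (Suc k) \<le> c k" "\<And>k. c k \<le> u" "\<And>k. \<delta> / 2 \<le> \<mu> (n k) (i k) (y k)"
proof -
  define s where "s k = 1 / 4 * (1 - (1 / 2 :: real) ^ k)" for k
  define P where "P k x \<longleftrightarrow> (case x of (c, R, i, n, y) \<Rightarrow> selection_state c R (s k))"
    for k and x :: "'a \<times> (nat \<Rightarrow> nat set) \<times> nat \<times> nat \<times> 'a"
  define Q where "Q x x' \<longleftrightarrow> (case x of (c, R, i, n, y) \<Rightarrow> case x' of (c', R', i', n', y') \<Rightarrow>
      i < i' \<and> i' < n' \<and> 0 \<le> y' \<and> y' \<le> c \<and> inf y' c' = 0 \<and> c' \<le> c \<and> c \<le> u \<and> \<delta> / 2 \<le> \<mu> n' i' y')"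
    for x x' :: "'a \<times> (nat \<Rightarrow> nat set) \<times> nat \<times> nat \<times> 'a"
  have "\<exists>f. \<forall>k. P k (f k) \<and> Q (f k) (f (Suc k))"
  proof (rule dependent_nat_choice)
    show "\<exists>x. P 0 x" using selection_state_initial by (auto simp: P_def s_def)
  next
    fix x k assume "P k x"
    moreover obtain c R i n y where x: "x = (c, R, i, n, y)" by (cases x) auto
    ultimately have state: "selection_state c R (s k)" by (simp add: P_def)
    have "s k \<le> 1 / 4" "0 < s (Suc k) - s k" by (simp_all add: s_def)
    from selection_step[OF state this, of i]
    obtain c' R' j n' y' where "selection_state c' R' (s (Suc k))" "i < j" "j < n'" "0 \<le> y'" "y' \<le> c"
      "inf y' c' = 0" "c' \<le> c" "\<delta> / 2 \<le> \<mu> n' j y'" by auto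
    then show "\<exists>x'. P (Suc k) x' \<and> Q x x'"
      using state by (intro exI[of _ "(c', R', j, n', y')"]) (simp add: P_def Q_def x selection_state_def)
  qed
  then obtain f where f: "\<And>k. Q (f k) (f (Suc k))" by blast
  define c where "c k = fst (f k)" for k
  define i where "i k = fst (snd (snd (f (Suc k))))" for k
  define n where "n k = fst (snd (snd (snd (f (Suc k)))))" for k
  define y where "y k = snd (snd (snd (snd (f (Suc k)))))" for k
  show thesis
    by (rule that[of i n y c])
      (use f in \<open>auto simp: Q_def c_def i_def n_def y_def split_beta\<close>)
qed

lemma disjoint_selection:
  obtains i N :: "nat \<Rightarrow> nat" and y where "strict_mono i" "\<And>k. 0 \<le> y k" "\<And>k. y k \<le> u"
    "\<And>k l. k \<noteq> l \<Longrightarrow> inf (y k) (y l) = 0" "\<And>k. \<delta> / 2 \<le> \<mu> (N k) (i k) (y k)"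
proof -
  obtain i N :: "nat \<Rightarrow> nat" and y c :: "nat \<Rightarrow> 'a"
    where i: "\<And>k. i k < i (Suc k)" and y: "\<And>k. 0 \<le> y k" "\<And>k. y k \<le> c k" "\<And>k. inf (y k) (c (Suc k)) = 0"
      and c: "\<And>k. c (Suc k) \<le> c k" "\<And>k. c k \<le> u" and y_mass: "\<And>k. \<delta> / 2 \<le> \<mu> (N k) (i k) (y k)"
    by (rule selection_sequence) (rule that)
  have disj_y: "inf (y k) (y l) = 0" if "k < l" for k l
  proof (rule antisym)
    have "c l \<le> c (Suc k)" using lift_Suc_antimono_le[of c] c(1) that by simp
    then have "inf (y k) (y l) \<le> inf (y k) (c (Suc k))"
      using order_trans[OF y(2)] by (intro inf_mono) auto
    then show "inf (y k) (y l) \<le> 0" using y(3) by simp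
  qed (simp add: y(1))
  show thesis
  proof (rule that)
    show "strict_mono i" using i by (simp add: strict_mono_Suc_iff)
    show "inf (y k) (y l) = 0" if "k \<noteq> l" for k l
      using disj_y[of k l] disj_y[of l k] that by (auto simp: inf_commute neq_iff)
    show "y k \<le> u" for k using y(2) c(2) by (rule order_trans)
  qed (rule y(1) y_mass)+
qed

end

section \<open>Weak* null sequences on disjoint sequences\<close>

context banach_lattice_space
begin

definition partial_sum_majorants :: "(nat \<Rightarrow> 'a) \<Rightarrow> nat set \<Rightarrow> 'a set" where
  "partial_sum_majorants x A = {w. 0 \<le> w \<and> (\<forall>n. sum x (A \<inter> {..<n}) \<le> w)}"

definition outer_content :: "('a \<Rightarrow>\<^sub>L real) \<Rightarrow> (nat \<Rightarrow> 'a) \<Rightarrow> nat set \<Rightarrow> real" where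
  "outer_content f x A = (INF w\<in>partial_sum_majorants x A. blinfun_apply f w)"

lemma outer_content_le: "0 \<preceq> f \<Longrightarrow> w \<in> partial_sum_majorants x A \<Longrightarrow> outer_content f x A \<le> blinfun_apply f w"
  unfolding outer_content_def using E.dual_nonnegD[of f]
  by (intro cINF_lower) (auto simp: bdd_below_def partial_sum_majorants_def)

lemma outer_content_greatest:
  "partial_sum_majorants x A \<noteq> {} \<Longrightarrow> (\<And>w. w \<in> partial_sum_majorants x A \<Longrightarrow> r \<le> blinfun_apply f w) \<Longrightarrow>
    r \<le> outer_content f x A"
  unfolding outer_content_def by (rule cINF_greatest)

text \<open>Interpolation makes this outer content superadditive, which replaces the countable additivity
  available in the \<open>\<sigma>\<close>-complete case.\<close>

lemma outer_content_superadditive: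
  assumes interp: "sigma_interpolation TYPE('a)" and f: "0 \<preceq> f" and x: "\<And>k. 0 \<le> x k"
    and ne: "partial_sum_majorants x (A \<union> B) \<noteq> {}" and "A \<inter> B = {}"
  shows "outer_content f x A + outer_content f x B \<le> outer_content f x (A \<union> B)"
proof (rule outer_content_greatest[OF ne])
  fix w assume w: "w \<in> partial_sum_majorants x (A \<union> B)"
  define S where "S C n = sum x (C \<inter> {..<n})" for C n
  have S_nonneg: "0 \<le> S C n" for C n using x by (simp add: S_def sum_nonneg)
  have "S A m \<le> w - S B n" for m n
  proof -
    have "S A m + S B n \<le> S A (max m n) + S B (max m n)"
      unfolding S_def using x by (intro add_mono sum_mono2) auto
    also have "\<dots> = S (A \<union> B) (max m n)"
      unfolding S_def using \<open>A \<inter> B = {}\<close> by (subst sum.union_disjoint[symmetric]) (auto simp: Int_Un_distrib2)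
    also have "\<dots> \<le> w" using w by (simp add: S_def partial_sum_majorants_def)
    finally show ?thesis by (simp add: le_diff_eq)
  qed
  then obtain a where a: "\<And>n. S A n \<le> a" "\<And>n. a \<le> w - S B n"
    using sigma_interpolation_between[OF interp, of "S A" "\<lambda>n. w - S B n"] by blast
  have "0 \<le> a" using S_nonneg a(1) by (rule order_trans)
  moreover have "S B n \<le> w - a" for n using a(2)[of n] by (simp add: algebra_simps)
  moreover from this[of 0] have "0 \<le> w - a" by (rule order_trans[OF S_nonneg])
  ultimately have "a \<in> partial_sum_majorants x A" "w - a \<in> partial_sum_majorants x B"
    using a(1) by (auto simp: partial_sum_majorants_def S_def)
  from outer_content_le[OF f this(1)] outer_content_le[OF f this(2)]
  show "outer_content f x A + outer_content f x B \<le> f w" by (simp add: blinfun.diff_right)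
qed

lemma exists_almost_disjoint_majorants:
  fixes f :: "nat \<Rightarrow> ('a \<Rightarrow>\<^sub>L real)"
  assumes interp: "sigma_interpolation TYPE('a)" and f: "\<And>k. 0 \<preceq> f k" "\<And>k. norm (f k) \<le> B"
    and x: "\<And>k. 0 \<le> x k" "\<And>J. finite J \<Longrightarrow> sum x J \<le> v" and "0 < \<epsilon>"
  shows "\<exists>A. infinite A \<and> (\<forall>k\<in>A. \<exists>w\<in>partial_sum_majorants x (A - {k}). f k w < \<epsilon>)"
proof -
  have v: "v \<in> partial_sum_majorants x A" for A
    using x(2)[of "{}"] x(2) by (simp add: partial_sum_majorants_def)
  then have ne: "partial_sum_majorants x A \<noteq> {}" for A by blast
  have "\<exists>A. infinite A \<and> (\<forall>k\<in>A. outer_content (f k) x (A - {k}) \<le> \<epsilon> / 2)"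
  proof (rule rosenthal_disjointification)
    show "0 \<le> outer_content (f k) x A" for k A
      using E.dual_nonnegD[OF f(1)] by (intro outer_content_greatest[OF ne]) (simp add: partial_sum_majorants_def)
    show "outer_content (f k) x UNIV \<le> B * norm v" for k
    proof -
      have "outer_content (f k) x UNIV \<le> f k v" by (rule outer_content_le[OF f(1) v])
      also have "\<dots> \<le> norm (f k) * norm v" using norm_blinfun[of "f k" v] by simp
      also have "\<dots> \<le> B * norm v" using f(2) by (intro mult_right_mono) auto
      finally show ?thesis .
    qed
    show "outer_content (f k) x A + outer_content (f k) x A' \<le> outer_content (f k) x (A \<union> A')"
      if "A \<inter> A' = {}" for k A A'
      by (rule outer_content_superadditive[OF interp f(1) x(1) ne that])
  qed (use \<open>0 < \<epsilon>\<close> in simp)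
  then obtain A where A: "infinite A" "\<And>k. k \<in> A \<Longrightarrow> outer_content (f k) x (A - {k}) \<le> \<epsilon> / 2" by blast
  have "\<exists>w\<in>partial_sum_majorants x (A - {k}). f k w < \<epsilon>" if "k \<in> A" for k
    using outer_content_greatest[OF ne, of "A - {k}" \<epsilon> "f k"] A(2)[OF that] \<open>0 < \<epsilon>\<close> by force
  then show ?thesis using A(1) by blast
qed

lemma exists_interpolated_sum:
  fixes x w :: "nat \<Rightarrow> 'a"
  assumes interp: "sigma_interpolation TYPE('a)" and x: "\<And>k. 0 \<le> x k" "\<And>J. finite J \<Longrightarrow> sum x J \<le> v"
    and w: "\<And>k. k \<in> A \<Longrightarrow> w k \<in> partial_sum_majorants x (A - {k})"
  obtains t where "\<And>k. k \<in> A \<Longrightarrow> x k \<le> t" "\<And>k. k \<in> A \<Longrightarrow> t \<le> w k + x k"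
proof -
  define b where "b k = (if k \<in> A then w k + x k else v)" for k
  have "sum x (A \<inter> {..<m}) \<le> b k" for m k
  proof (cases "k \<in> A")
    case True
    have "sum x (A \<inter> {..<m}) \<le> sum x (insert k ((A - {k}) \<inter> {..<m}))"
      using x(1) by (intro sum_mono2) auto
    also have "\<dots> \<le> x k + w k"
      using w[OF True] by (simp add: partial_sum_majorants_def)
    finally show ?thesis using True by (simp add: b_def add.commute)
  qed (simp add: b_def x(2))
  then obtain t where t: "\<And>n. sum x (A \<inter> {..<n}) \<le> t" "\<And>n. t \<le> b n"
    using sigma_interpolation_between[OF interp, of "\<lambda>n. sum x (A \<inter> {..<n})" b] by blast
  show thesis
  proof (rule that)
    fix k assume k: "k \<in> A"
    have "sum x {k} \<le> sum x (A \<inter> {..<Suc k})" using k x(1) by (intro sum_mono2) auto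
    then show "x k \<le> t" using t(1)[of "Suc k"] by simp
    show "t \<le> w k + x k" using t(2)[of k] k by (simp add: b_def)
  qed
qed

lemma weak_star_null_small_on_disjoint:
  fixes f :: "nat \<Rightarrow> ('a \<Rightarrow>\<^sub>L real)"
  assumes interp: "sigma_interpolation TYPE('a)" and null: "\<And>x. (\<lambda>n. f n x) \<longlonglongrightarrow> 0"
    and z: "\<And>k. 0 \<le> z k" "\<And>k. z k \<le> v" "\<And>k l. k \<noteq> l \<Longrightarrow> inf (z k) (z l) = 0" and "0 < \<delta>"
  shows "\<exists>k. E.modulus (f k) (z k) < \<delta>"
proof (rule ccontr)
  assume "\<not> ?thesis"
  then have "\<exists>x. 0 \<le> x \<and> x \<le> z k \<and> \<delta> / 4 \<le> \<bar>f k x\<bar>" for k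
    using E.modulus_approx[OF z(1) \<open>0 < \<delta>\<close>] by (simp add: not_less)
  then obtain x where x: "\<And>k. 0 \<le> x k" "\<And>k. x k \<le> z k" "\<And>k. \<delta> / 4 \<le> \<bar>f k (x k)\<bar>" by metis
  have sum_x: "sum x J \<le> v" if "finite J" for J
  proof (rule sum_disjoint_le[OF that])
    show "0 \<le> v" using z(1,2)[of 0] by (rule order_trans)
    show "0 \<le> x j" "x j \<le> v" for j using x(1,2)[of j] z(2)[of j] by auto
    show "inf (x i) (x j) = 0" if "i \<noteq> j" for i j
      using inf_mono[OF x(2) x(2), of i j] z(3)[OF that] x(1) by (simp add: antisym)
  qed
  obtain B where B: "\<And>n. norm (f n) \<le> B" using weak_star_convergent_imp_bounded[of f "\<lambda>_. 0"] null by blast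
  have "\<exists>A. infinite A \<and> (\<forall>k\<in>A. \<exists>w\<in>partial_sum_majorants x (A - {k}). E.modulus (f k) w < \<delta> / 8)"
  proof (rule exists_almost_disjoint_majorants[OF interp E.modulus_nonneg _ x(1) sum_x])
    show "norm (E.modulus (f k)) \<le> 2 * B" for k using E.norm_modulus_le[of "f k"] B[of k] by simp
  qed (use \<open>0 < \<delta>\<close> in simp_all)
  then obtain A w where A: "infinite A" "\<And>k. k \<in> A \<Longrightarrow> w k \<in> partial_sum_majorants x (A - {k})"
    and w: "\<And>k. k \<in> A \<Longrightarrow> E.modulus (f k) (w k) < \<delta> / 8"
    by metis
  obtain t where t: "\<And>k. k \<in> A \<Longrightarrow> x k \<le> t" "\<And>k. k \<in> A \<Longrightarrow> t \<le> w k + x k"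
    using exists_interpolated_sum[OF interp x(1) sum_x A(2)] by blast
  have large: "\<delta> / 8 \<le> \<bar>f k t\<bar>" if k: "k \<in> A" for k
  proof -
    have "\<bar>f k (t - x k)\<bar> \<le> E.modulus (f k) (t - x k)" using t(1)[OF k] by (intro E.abs_le_modulus) simp
    also have "\<dots> \<le> E.modulus (f k) (w k)"
      using t(2)[OF k] by (intro E.positive_functional_mono[OF E.modulus_nonneg]) (simp add: diff_le_eq)
    also have "\<dots> < \<delta> / 8" by (rule w[OF k])
    finally show ?thesis using x(3)[of k] unfolding blinfun.diff_right by linarith
  qed
  obtain N where "\<And>n. n \<ge> N \<Longrightarrow> \<bar>f n t\<bar> < \<delta> / 8"
    using LIMSEQ_D[OF null[of t], of "\<delta> / 8"] \<open>0 < \<delta>\<close> by auto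
  moreover obtain k where "k \<in> A" "N \<le> k" using A(1) by (meson infinite_nat_iff_unbounded_le)
  ultimately show False using large[of k] by (meson not_less)
qed

end

section \<open>The Grothendieck property\<close>

locale dominating_operator_family = banach_lattice_space TY
  for TY :: "'a::{banach, lattice, ordered_ab_group_add} itself" +
  fixes u0 :: 'a and G :: "('a \<Rightarrow>\<^sub>L 'a) set"
  assumes u0_nonneg: "0 \<le> u0"
    and positive: "T \<in> G \<Longrightarrow> positive_op T"
    and adjoint_hom: "T \<in> G \<Longrightarrow> lattice_hom dual_le (adjoint_op T)"
    and dominating: "0 \<le> x \<Longrightarrow> \<exists>T\<in>G. x \<le> norm x *\<^sub>R blinfun_apply T u0"
    and disjoint_images_bounded: "\<lbrakk>\<And>n. 0 \<le> xs n; \<And>n. xs n \<le> u0; \<And>m n. m \<noteq> n \<Longrightarrow> inf (xs m) (xs n) = 0;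
      \<And>n. Ts n \<in> G\<rbrakk> \<Longrightarrow> \<exists>v. 0 \<le> v \<and> (\<forall>n::nat. blinfun_apply (Ts n) (xs n) \<le> v)"
begin

lemma exists_simultaneously_dominating_operator:
  fixes \<phi> :: "('a \<Rightarrow>\<^sub>L real) \<Rightarrow>\<^sub>L real"
  assumes "finite I" and u: "\<And>i. i \<in> I \<Longrightarrow> 0 \<preceq> u i" "\<And>i. i \<in> I \<Longrightarrow> \<epsilon> \<le> \<phi> (u i)"
    and "0 < \<epsilon>" "norm \<phi> * \<delta> < \<epsilon>"
  shows "\<exists>T\<in>G. \<forall>i\<in>I. \<delta> \<le> u i (T u0)"
proof -
  have "\<exists>x. norm x \<le> 1 \<and> (\<forall>i\<in>I. \<delta> \<le> u i x)"
    by (rule finite_goldstine[OF \<open>finite I\<close> \<open>0 < \<epsilon>\<close> u(2) \<open>norm \<phi> * \<delta> < \<epsilon>\<close>])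
  then obtain x where x: "norm x \<le> 1" "\<And>i. i \<in> I \<Longrightarrow> \<delta> \<le> u i x" by blast
  obtain T where T: "T \<in> G" "labs x \<le> norm (labs x) *\<^sub>R T u0"
    using dominating[OF labs_nonneg] by blast
  have "0 \<le> T u0" using positive[OF T(1)] u0_nonneg by (simp add: positive_op_def)
  then have "norm (labs x) *\<^sub>R T u0 \<le> 1 *\<^sub>R T u0"
    using x(1) by (intro scaleR_le_scaleR) (simp_all add: norm_labs)
  moreover have "x \<le> labs x" by (simp add: labs_def)
  ultimately have x_le: "x \<le> T u0" using T(2) by simp
  have "\<delta> \<le> u i (T u0)" if "i \<in> I" for i
    using x(2)[OF that] E.positive_functional_mono[OF u(1)[OF that] x_le] by (rule order_trans)
  then show ?thesis using T(1) by blast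
qed

lemma exists_common_large_vector:
  fixes u :: "nat \<Rightarrow> ('a \<Rightarrow>\<^sub>L real)"
  assumes u: "\<And>i. 0 \<preceq> u i" "\<And>i j. i \<noteq> j \<Longrightarrow> E.dual_disjoint (u i) (u j)" and "0 < \<delta>"
    and large: "\<And>N. \<exists>T\<in>G. \<forall>i\<in>{..<N}. \<delta> \<le> u i (blinfun_apply T u0)"
  shows "\<exists>(i :: nat \<Rightarrow> nat) v. strict_mono i \<and> 0 \<le> v \<and> (\<forall>k. \<delta> / 2 \<le> u (i k) v)"
proof -
  obtain T where T: "\<And>N. T N \<in> G" "\<And>N i. i < N \<Longrightarrow> \<delta> \<le> u i (T N u0)"
    using large by (metis lessThan_iff)
  interpret array: disjoint_triangular_array TY "\<lambda>N i. adjoint_op (T N) (u i)" u0 \<delta>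
  proof unfold_locales
    fix N i j :: nat
    show "0 \<preceq> adjoint_op (T N) (u i)"
      using E.dual_nonnegD[OF u(1)] positive[OF T(1)]
      by (simp add: dual_le_def adjoint_op_def positive_op_def)
    show "\<delta> \<le> adjoint_op (T N) (u i) u0" if "i < N" using T(2)[OF that] by (simp add: adjoint_op_def)
    show "E.dual_disjoint (adjoint_op (T N) (u i)) (adjoint_op (T N) (u j))" if "i \<noteq> j"
      by (rule adjoint_op_disjoint[OF adjoint_hom[OF T(1)] u(2)[OF that]])
  qed (rule u0_nonneg \<open>0 < \<delta>\<close>)+
  obtain i N :: "nat \<Rightarrow> nat" and y where i: "strict_mono i"
    and y: "\<And>k. 0 \<le> y k" "\<And>k. y k \<le> u0" "\<And>k l. k \<noteq> l \<Longrightarrow> inf (y k) (y l) = 0"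
    and y_mass: "\<And>k. \<delta> / 2 \<le> adjoint_op (T (N k)) (u (i k)) (y k)"
    by (rule array.disjoint_selection) (rule that)
  have "\<exists>v. 0 \<le> v \<and> (\<forall>k. T (N k) (y k) \<le> v)"
    by (rule disjoint_images_bounded[OF y T(1)])
  then obtain v where v: "0 \<le> v" "\<And>k. T (N k) (y k) \<le> v" by blast
  have "\<delta> / 2 \<le> u (i k) v" for k
    using y_mass[of k] E.positive_functional_mono[OF u(1) v(2)[of k], of "i k"] by (simp add: adjoint_op_def)
  then show ?thesis using i v(1) by blast
qed

lemma equi_integrable_of_weak_star_null:
  fixes f :: "nat \<Rightarrow> ('a \<Rightarrow>\<^sub>L real)"
  assumes interp: "sigma_interpolation TYPE('a)" and null: "\<And>x. (\<lambda>n. f n x) \<longlonglongrightarrow> 0"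
    and e: "0 \<preceq> e" "\<And>n. E.modulus (f n) \<preceq> C n *\<^sub>R e" "\<And>n. 0 \<le> C n" and \<phi>: "0 \<preceq>\<^sup>* \<phi>"
  shows "E.equi_integrable \<phi> e (\<lambda>n. E.modulus (f n))"
proof (rule ccontr)
  assume not_equi: "\<not> ?thesis"
  obtain B where B: "\<And>n. norm (f n) \<le> B" using weak_star_convergent_imp_bounded[of f "\<lambda>_. 0"] null by blast
  have norm_f: "norm (E.modulus (f n)) \<le> 2 * B" for n using E.norm_modulus_le[of "f n"] B[of n] by simp
  obtain \<epsilon> n u where \<epsilon>: "0 < \<epsilon>" and n: "strict_mono (n :: nat \<Rightarrow> nat)"
    and u: "\<And>j. 0 \<preceq> u j" "\<And>i j. i \<noteq> j \<Longrightarrow> E.dual_disjoint (u i) (u j)"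
    and u_le: "\<And>j. u j \<preceq> E.modulus (f (n j))" and u_mass: "\<And>j. \<epsilon> \<le> \<phi> (u j)"
    by (rule E.disjoint_minorants[where a = "\<lambda>n. E.modulus (f n)", OF E.modulus_nonneg norm_f e(2,3,1) \<phi> not_equi])
      (rule that)
  define \<delta> where "\<delta> = \<epsilon> / (norm \<phi> + 1)"
  have "0 < norm \<phi> + 1" by (rule add_nonneg_pos) simp_all
  then have \<delta>: "0 < \<delta>" "norm \<phi> * \<delta> < \<epsilon>" using \<epsilon> by (simp_all add: \<delta>_def field_simps)
  have large: "\<exists>T\<in>G. \<forall>i\<in>{..<N}. \<delta> \<le> u i (blinfun_apply T u0)" for N
    by (rule exists_simultaneously_dominating_operator[OF _ u(1) u_mass \<epsilon> \<delta>(2)]) simp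
  have "\<exists>(i :: nat \<Rightarrow> nat) v. strict_mono i \<and> 0 \<le> v \<and> (\<forall>k. \<delta> / 2 \<le> u (i k) v)"
    using u \<delta>(1) large by (rule exists_common_large_vector)
  then obtain i v where i: "strict_mono (i :: nat \<Rightarrow> nat)" and v: "0 \<le> v" "\<And>k. \<delta> / 2 \<le> u (i k) v"
    by blast
  interpret array: disjoint_triangular_array TY "\<lambda>N k. u (i k)" v "\<delta> / 2"
  proof unfold_locales
    show "0 < \<delta> / 2" using \<delta>(1) by simp
    show "E.dual_disjoint (u (i k)) (u (i l))" if "k \<noteq> l" for k l
      using u(2) strict_mono_eq[OF i] that by blast
  qed (rule v u(1))+
  obtain k :: "nat \<Rightarrow> nat" and z where k: "strict_mono k"
    and z: "\<And>l. 0 \<le> z l" "\<And>l. z l \<le> v" "\<And>l m. l \<noteq> m \<Longrightarrow> inf (z l) (z m) = 0"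
    and z_mass: "\<And>l. \<delta> / 2 / 2 \<le> u (i (k l)) (z l)"
    by (rule array.disjoint_selection) (rule that)
  define p where "p l = n (i (k l))" for l
  have "strict_mono p" using n i k by (simp add: p_def strict_mono_def)
  then have null_p: "(\<lambda>l. f (p l) x) \<longlonglongrightarrow> 0" for x
    using LIMSEQ_subseq_LIMSEQ[OF null] by (simp add: o_def)
  have "\<exists>l. E.modulus (f (p l)) (z l) < \<delta> / 2 / 2"
    by (rule weak_star_null_small_on_disjoint[OF interp null_p z]) (use \<delta>(1) in simp_all)
  then obtain l where "E.modulus (f (p l)) (z l) < \<delta> / 2 / 2" ..
  then show False
    using z_mass[of l] E.dual_orderD[OF u_le z(1)[of l], of "i (k l)"] by (simp add: p_def)
qed

lemma weakly_null_of_weak_star_null: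
  fixes f :: "nat \<Rightarrow> ('a \<Rightarrow>\<^sub>L real)" and \<phi> :: "('a \<Rightarrow>\<^sub>L real) \<Rightarrow>\<^sub>L real"
  assumes interp: "sigma_interpolation TYPE('a)"
    and dual_oc: "order_continuous_norm (dual_le :: ('a \<Rightarrow>\<^sub>L real) \<Rightarrow> _ \<Rightarrow> bool)"
    and null: "\<And>x. (\<lambda>n. f n x) \<longlonglongrightarrow> 0"
  shows "(\<lambda>n. \<phi> (f n)) \<longlonglongrightarrow> 0"
proof -
  obtain B where B: "\<And>n. norm (f n) \<le> B" using weak_star_convergent_imp_bounded[of f "\<lambda>_. 0"] null by blast
  have norm_f: "norm (E.modulus (f n)) \<le> 2 * B" for n using E.norm_modulus_le[of "f n"] B[of n] by simp
  obtain e where e: "0 \<preceq> e" "\<And>n. (1 / 2) ^ n *\<^sub>R E.modulus (f n) \<preceq> e"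
    by (rule E.geometric_majorant[of "\<lambda>n. E.modulus (f n)", OF E.modulus_nonneg norm_f]) (rule that)
  have dominated: "E.modulus (f n) \<preceq> 2 ^ n *\<^sub>R e" for n
    using E.dual_scale_mono[OF e(2)[of n], of "2 ^ n"] by (simp add: power_one_over)
  interpret equi_integrable_null_sequence "(\<le>) :: 'a \<Rightarrow> 'a \<Rightarrow> bool" f e
  proof (unfold_locales, unfold dual_order_eq_dual_le)
    show "E.equi_integrable \<psi> e (\<lambda>n. E.modulus (f n))" if "0 \<preceq>\<^sup>* \<psi>" for \<psi>
      using dominated by (intro equi_integrable_of_weak_star_null[OF interp null e(1) _ _ that]) auto
    show "\<exists>C\<ge>0. E.modulus (f n) \<preceq> C *\<^sub>R e" for n
      using dominated[of n] by (intro exI[of _ "2 ^ n"]) simp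
  qed (fact dual_oc null e(1))+
  show ?thesis by (rule weakly_null)
qed

end

theorem theorem4p3:
  fixes u0 :: "'a::{banach, lattice, ordered_ab_group_add}"
    and G :: "('a \<Rightarrow>\<^sub>L 'a) set"
  assumes BL: "banach_lattice TYPE('a)"
    and interp: "sigma_interpolation TYPE('a)"
    and dual_oc: "order_continuous_norm (dual_le :: ('a \<Rightarrow>\<^sub>L real) \<Rightarrow> _ \<Rightarrow> bool)"
    and u0_pos: "0 \<le> u0"
    and G_pos: "\<forall>T\<in>G. positive_op T"
    and G_adj: "\<forall>T\<in>G. lattice_hom dual_le (adjoint_op T)"
    and cond_a: "\<forall>x. 0 \<le> x \<longrightarrow> (\<exists>T\<in>G. x \<le> norm x *\<^sub>R blinfun_apply T u0)"
    and cond_b: "\<forall>(xs :: nat \<Rightarrow> 'a) (Ts :: nat \<Rightarrow> ('a \<Rightarrow>\<^sub>L 'a)).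
          (\<forall>n. 0 \<le> xs n \<and> xs n \<le> u0) \<and>
          (\<forall>m n. m \<noteq> n \<longrightarrow> inf (labs (xs m)) (labs (xs n)) = 0) \<and>
          (\<forall>n. Ts n \<in> G)
          \<longrightarrow> (\<exists>v. 0 \<le> v \<and> (\<forall>n. blinfun_apply (Ts n) (xs n) \<le> v))"
  shows "grothendieck TYPE('a)"
proof -
  interpret dominating_operator_family "TYPE('a)" u0 G
  proof unfold_locales
    show "\<exists>v. 0 \<le> v \<and> (\<forall>n. blinfun_apply (Ts n) (xs n) \<le> v)"
      if "\<And>n. 0 \<le> xs n" "\<And>n. xs n \<le> u0" "\<And>m n. m \<noteq> n \<Longrightarrow> inf (xs m) (xs n) = 0" "\<And>n. Ts n \<in> G"
      for xs :: "nat \<Rightarrow> 'a" and Ts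
      by (rule cond_b[rule_format]) (simp add: labs_of_nonneg that)
  qed (use BL u0_pos G_pos G_adj cond_a in auto)
  show ?thesis
    unfolding grothendieck_def
  proof (intro allI impI)
    fix fs :: "nat \<Rightarrow> ('a \<Rightarrow>\<^sub>L real)" and f :: "'a \<Rightarrow>\<^sub>L real" and \<phi> :: "('a \<Rightarrow>\<^sub>L real) \<Rightarrow>\<^sub>L real"
    assume lim: "\<forall>x. (\<lambda>n. fs n x) \<longlonglongrightarrow> f x"
    have "(\<lambda>n. blinfun_apply (fs n - f) x) \<longlonglongrightarrow> 0" for x
      using LIM_zero[OF lim[rule_format, of x]] by (simp add: blinfun.diff_left)
    then have "(\<lambda>n. \<phi> (fs n - f)) \<longlonglongrightarrow> 0"
      by (rule weakly_null_of_weak_star_null[OF interp dual_oc])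
    then show "(\<lambda>n. \<phi> (fs n)) \<longlonglongrightarrow> \<phi> f"
      by (simp add: blinfun.diff_right LIM_zero_iff)
  qed
qed

end
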